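(* Let $n\ge1$ and let $\lambda$ be a partition with at most $n$ parts. Let $\mu^{(1)},\dots,\mu^{(r)}$ be the partitions $\mu$ of $|\lambda|$ with $\mu>\lambda$ strictly in dominance order, listed in any fixed order. Let $D$ be the determinant of the $(r+1)\times(r+1)$ matrix whose first row is $$\big(S_\lambda[X^{tq}],\,S_{\mu^{(1)}}[X^{tq}],\dots,S_{\mu^{(r)}}[X^{tq}]\big)$$ and whose row $s+1$ ($1\le s\le r$) is $$\big([\lambda]_{\lambda,\mu^{(s)}},\,[\lambda]_{\mu^{(1)},\mu^{(s)}},\dots,[\lambda]_{\mu^{(r)},\mu^{(s)}}\big).$$ Then $$J_\lambda(X;q,t)=\frac{c_{\lambda'}(t,q)}{v_\lambda(q,t)}\,D.$$
   Context: Plethystic notation: for a rational function $E$ in $x_1,\dots,x_n,q,t$ and $i\ge1$, $p_i[E]$ is obtained by replacing each of $x_1,\dots,x_n,q,t$ by its $i$-th power; $f[E]$ for a symmetric function $f$ is defined via the power-sum expansion. $S_j$ is the complete homogeneous symmetric function ($S_j=0$ for $j<0$), $S_\mu[E]=\det(S_{\mu_a-a+b}[E])_{a,b}$ the Schur function. $X=x_1+\cdots+x_n$, $X^{tq}=X(t-1)/(q-1)$. $J_\lambda(X;q,t)$ is Macdonald's integral form of the Macdonald polynomial in $x_1,\dots,x_n$. Dominance order: for $|\lambda|=|\mu|$, $\lambda\le\mu$ iff $\lambda_1+\cdots+\lambda_i\le\mu_1+\cdots+\mu_i$ for all $i$. For $\alpha\in\mathbb{N}^n$, $[|\alpha|]=q^{\alpha_1}t^{n-1}+q^{\alpha_2}t^{n-2}+\cdots+q^{\alpha_n}$.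 For a partition $\mu$ with at most $n$ parts (padded with zeros) and $\alpha\in\mathbb{N}^n$, $\epsilon(\mu,\alpha)=\sum_\tau \mathrm{sign}(\tau)$, summed over permutations $\tau$ of $\{1,\dots,n\}$ with $\alpha_j=\mu_{\tau(j)}-\tau(j)+j$ for all $j$ (so $S_\mu=\sum_{\alpha\in\mathbb{N}^n}\epsilon(\mu,\alpha)S_{\alpha_1}\cdots S_{\alpha_n}$). For partitions $\mu,\nu$ of equal weight with at most $n$ parts, $[\lambda]_{\mu\nu}=\sum_\alpha\epsilon(\mu,\alpha)\big([|\lambda|]-[|\alpha|]\big)$, summed over the distinct permutations $\alpha\in\mathbb{N}^n$ of $\nu$. $v_\lambda(q,t)=\prod_{\mu>\lambda}([|\lambda|]-[|\mu|])$ over partitions $\mu$ of $|\lambda|$ strictly dominating $\lambda$. $\lambda'$ is the conjugate partition and $c_{\lambda'}(t,q)=\prod_{(i,j)\in\lambda}\big(1-q^{\lambda_i-j+1}t^{\lambda'_j-i}\big)$, the product over the cells $(i,j)$ (row $i$, column $j$) of the diagram of $\lambda$. *)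

theory Defs
  imports
    "HOL-Computational_Algebra.Computational_Algebra"
    "HOL-Computational_Algebra.Field_as_Ring"
    "HOL-Library.Poly_Mapping"
    "Jordan_Normal_Form.Determinant"
begin

section \<open>Coefficients and polynomials\<close>

text \<open>The field \<open>\<rat>(q,t)\<close>: \<open>q\<close> is the variable of the inner polynomial ring, \<open>t\<close> that of the
  outer one.\<close>

type_synonym qt_field = "rat poly poly fract"

definition qpar :: qt_field where "qpar = to_fract [:[:0, 1:]:]"
definition tpar :: qt_field where "tpar = to_fract [:0, 1:]"

text \<open>The substitution \<open>q \<mapsto> q\<^sup>i\<close>, \<open>t \<mapsto> t\<^sup>i\<close>, meaningful for \<open>i \<ge> 1\<close>.\<close>

definition qt_poly_subst :: "nat \<Rightarrow> rat poly poly \<Rightarrow> rat poly poly" where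
  "qt_poly_subst i f =
     pcompose (map_poly (\<lambda>c. pcompose c (Polynomial.monom 1 i)) f) (Polynomial.monom 1 i)"

definition qt_subst :: "nat \<Rightarrow> qt_field \<Rightarrow> qt_field" where
  "qt_subst i c = Fract (qt_poly_subst i (fst (quot_of_fract c)))
                        (qt_poly_subst i (snd (quot_of_fract c)))"

text \<open>Polynomials over \<open>\<rat>(q,t)\<close> in \<open>x\<^sub>0, x\<^sub>1, \<dots>\<close>; indices are zero-based throughout, so the
  \<open>n\<close> variables are \<open>x\<^sub>0, \<dots>, x\<^sub>n\<^sub>-\<^sub>1\<close>. A key is an exponent vector.\<close>

type_synonym xpoly = "(nat \<Rightarrow>\<^sub>0 nat) \<Rightarrow>\<^sub>0 qt_field"

definition Const :: "qt_field \<Rightarrow> xpoly" where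
  "Const c = Poly_Mapping.single 0 c"

definition xvar :: "nat \<Rightarrow> xpoly" where
  "xvar j = Poly_Mapping.single (Poly_Mapping.single j 1) 1"

section \<open>Symmetric functions and plethysm\<close>

text \<open>The ring of symmetric functions over \<open>\<rat>(q,t)\<close> is the free polynomial ring on the power
  sums \<open>p\<^sub>1, p\<^sub>2, \<dots>\<close>. In the exponent vector \<open>m\<close> of a power-sum product, the entry at
  \<open>k\<close> is the exponent of \<open>p\<^sub>k\<^sub>+\<^sub>1\<close>.\<close>

type_synonym symfun = "(nat \<Rightarrow>\<^sub>0 nat) \<Rightarrow>\<^sub>0 qt_field"

definition p_pleth :: "nat \<Rightarrow> xpoly \<Rightarrow> xpoly" where
  "p_pleth i E = (\<Sum>m\<in>Poly_Mapping.keys E.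
     Poly_Mapping.single (Poly_Mapping.map (\<lambda>e. i * e) m) (qt_subst i (Poly_Mapping.lookup E m)))"

definition pleth :: "symfun \<Rightarrow> xpoly \<Rightarrow> xpoly" where
  "pleth f E = (\<Sum>m\<in>Poly_Mapping.keys f. Const (Poly_Mapping.lookup f m) *
     (\<Prod>k\<in>Poly_Mapping.keys m. p_pleth (Suc k) E ^ Poly_Mapping.lookup m k))"

definition Xalph :: "nat \<Rightarrow> xpoly" where
  "Xalph n = (\<Sum>j<n. xvar j)"

definition Xtq :: "nat \<Rightarrow> xpoly" where
  "Xtq n = Xalph n * Const ((tpar - 1) / (qpar - 1))"

definition p_weight :: "(nat \<Rightarrow>\<^sub>0 nat) \<Rightarrow> nat" where
  "p_weight m = (\<Sum>k\<in>Poly_Mapping.keys m. Suc k * Poly_Mapping.lookup m k)"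

text \<open>\<open>z\<^sub>\<rho> = \<Prod>\<^sub>i i\<^bsup>m\<^sub>i\<^esup> m\<^sub>i!\<close> for the partition \<open>\<rho>\<close> with \<open>m\<^sub>i\<close> parts equal to \<open>i\<close>.\<close>

definition z_factor :: "(nat \<Rightarrow>\<^sub>0 nat) \<Rightarrow> nat" where
  "z_factor m = (\<Prod>k\<in>Poly_Mapping.keys m.
     Suc k ^ Poly_Mapping.lookup m k * fact (Poly_Mapping.lookup m k))"

definition complete_sym :: "int \<Rightarrow> symfun" where
  "complete_sym j = (if j < 0 then 0 else
     (\<Sum>m | p_weight m = nat j. Poly_Mapping.single m (1 / of_nat (z_factor m))))"

section \<open>Partitions\<close>

text \<open>A partition is the sequence of its parts, continued by zeros.\<close>

definition is_partition :: "(nat \<Rightarrow> nat) \<Rightarrow> bool" where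
  "is_partition lam \<longleftrightarrow> antimono lam \<and> finite {i. lam i \<noteq> 0}"

definition num_parts :: "(nat \<Rightarrow> nat) \<Rightarrow> nat" where
  "num_parts lam = card {i. lam i \<noteq> 0}"

definition psize :: "(nat \<Rightarrow> nat) \<Rightarrow> nat" where
  "psize lam = (\<Sum>i | lam i \<noteq> 0. lam i)"

definition dominated :: "(nat \<Rightarrow> nat) \<Rightarrow> (nat \<Rightarrow> nat) \<Rightarrow> bool" where
  "dominated lam mu \<longleftrightarrow> psize lam = psize mu \<and> (\<forall>k. (\<Sum>i<k. lam i) \<le> (\<Sum>i<k. mu i))"

definition strictly_above :: "(nat \<Rightarrow> nat) \<Rightarrow> (nat \<Rightarrow> nat) set" where
  "strictly_above lam = {mu. is_partition mu \<and> dominated lam mu \<and> mu \<noteq> lam}"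

definition strictly_below :: "(nat \<Rightarrow> nat) \<Rightarrow> (nat \<Rightarrow> nat) set" where
  "strictly_below lam = {mu. is_partition mu \<and> dominated mu lam \<and> mu \<noteq> lam}"

definition conjugate :: "(nat \<Rightarrow> nat) \<Rightarrow> nat \<Rightarrow> nat" where
  "conjugate lam j = card {i. j < lam i}"

definition cells :: "(nat \<Rightarrow> nat) \<Rightarrow> (nat \<times> nat) set" where
  "cells lam = {(i, j). j < lam i}"

text \<open>Elements of \<open>\<nat>\<^sup>n\<close> are functions vanishing from \<open>n\<close> on; \<open>nu\<close> should have at most \<open>n\<close> parts.\<close>

definition distinct_perms :: "nat \<Rightarrow> (nat \<Rightarrow> nat) \<Rightarrow> (nat \<Rightarrow> nat) set" where
  "distinct_perms n nu = {nu \<circ> \<pi> | \<pi>. \<pi> permutes {..<n}}"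

section \<open>Schur functions and Macdonald polynomials\<close>

definition schur_pleth :: "(nat \<Rightarrow> nat) \<Rightarrow> xpoly \<Rightarrow> xpoly" where
  "schur_pleth mu E = det (mat (num_parts mu) (num_parts mu)
     (\<lambda>(a, b). pleth (complete_sym (int (mu a) - int a + int b)) E))"

definition monomial_sym :: "nat \<Rightarrow> (nat \<Rightarrow> nat) \<Rightarrow> xpoly" where
  "monomial_sym N mu = (if num_parts mu \<le> N
     then \<Sum>\<alpha>\<in>distinct_perms N mu. \<Prod>i<N. xvar i ^ \<alpha> i else 0)"

text \<open>\<open>\<langle>p\<^sub>\<rho>, p\<^sub>\<sigma>\<rangle> = \<delta>\<^sub>\<rho>\<^sub>\<sigma> z\<^sub>\<rho> \<Prod>\<^sub>i (1 - q\<^bsup>\<rho>\<^sub>i\<^esup>) / (1 - t\<^bsup>\<rho>\<^sub>i\<^esup>)\<close>.\<close>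

definition qt_inner :: "symfun \<Rightarrow> symfun \<Rightarrow> qt_field" where
  "qt_inner f g = (\<Sum>m\<in>Poly_Mapping.keys f \<inter> Poly_Mapping.keys g.
     Poly_Mapping.lookup f m * Poly_Mapping.lookup g m * of_nat (z_factor m) *
     (\<Prod>k\<in>Poly_Mapping.keys m. ((1 - qpar ^ Suc k) / (1 - tpar ^ Suc k)) ^ Poly_Mapping.lookup m k))"

text \<open>\<open>f = m\<^sub>\<lambda> + \<Sum>\<^bsub>\<mu> < \<lambda>\<^esub> u\<^sub>\<mu> m\<^sub>\<mu>\<close> as symmetric functions, that is, in every number of variables
  with the same coefficients.\<close>

definition monomial_triangular :: "(nat \<Rightarrow> nat) \<Rightarrow> symfun \<Rightarrow> bool" where
  "monomial_triangular lam f \<longleftrightarrow> (\<exists>u. \<forall>N. pleth f (Xalph N) =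
     monomial_sym N lam + (\<Sum>mu\<in>strictly_below lam. Const (u mu) * monomial_sym N mu))"

text \<open>Macdonald's characterization of the family \<open>P\<^sub>\<lambda>(q,t)\<close>; the last clause only makes the
  family unique as a function on all sequences.\<close>

definition macdonald_family :: "((nat \<Rightarrow> nat) \<Rightarrow> symfun) \<Rightarrow> bool" where
  "macdonald_family P \<longleftrightarrow>
     (\<forall>lam. is_partition lam \<longrightarrow> monomial_triangular lam (P lam)) \<and>
     (\<forall>lam mu. is_partition lam \<longrightarrow> is_partition mu \<longrightarrow> lam \<noteq> mu \<longrightarrow> qt_inner (P lam) (P mu) = 0) \<and>
     (\<forall>lam. \<not> is_partition lam \<longrightarrow> P lam = 0)"

definition macdonald_P :: "(nat \<Rightarrow> nat) \<Rightarrow> symfun" where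
  "macdonald_P = (THE P. macdonald_family P)"

text \<open>\<open>c\<^sub>\<lambda>(q,t) = \<Prod>\<^sub>s (1 - q\<^bsup>a(s)\<^esup> t\<^bsup>l(s)+1\<^esup>)\<close>, with \<open>a\<close>, \<open>l\<close> the arm and leg lengths of the cell \<open>s\<close>
  (cells being zero-based).\<close>

definition c_norm :: "(nat \<Rightarrow> nat) \<Rightarrow> qt_field" where
  "c_norm lam = (\<Prod>(i, j)\<in>cells lam.
     1 - qpar ^ (lam i - Suc j) * tpar ^ (conjugate lam j - Suc i + 1))"

definition macdonald_J :: "nat \<Rightarrow> (nat \<Rightarrow> nat) \<Rightarrow> xpoly" where
  "macdonald_J n lam = Const (c_norm lam) * pleth (macdonald_P lam) (Xalph n)"

section \<open>Ingredients of the determinant\<close>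

text \<open>\<open>c\<^bsub>\<lambda>'\<^esub>(t,q)\<close>: the one-based exponents \<open>\<lambda>\<^sub>i - j + 1\<close> and \<open>\<lambda>'\<^sub>j - i\<close>, shifted to zero-based
  cells.\<close>

definition c_norm_conj :: "(nat \<Rightarrow> nat) \<Rightarrow> qt_field" where
  "c_norm_conj lam = (\<Prod>(i, j)\<in>cells lam.
     1 - qpar ^ (lam i - j) * tpar ^ (conjugate lam j - Suc i))"

definition eigen :: "nat \<Rightarrow> (nat \<Rightarrow> nat) \<Rightarrow> qt_field" where
  "eigen n \<alpha> = (\<Sum>i<n. qpar ^ \<alpha> i * tpar ^ (n - Suc i))"

definition epsilon :: "nat \<Rightarrow> (nat \<Rightarrow> nat) \<Rightarrow> (nat \<Rightarrow> nat) \<Rightarrow> int" where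
  "epsilon n mu \<alpha> =
     (\<Sum>\<tau> | \<tau> permutes {..<n} \<and> (\<forall>j<n. int (\<alpha> j) = int (mu (\<tau> j)) - int (\<tau> j) + int j). sign \<tau>)"

definition bracket :: "nat \<Rightarrow> (nat \<Rightarrow> nat) \<Rightarrow> (nat \<Rightarrow> nat) \<Rightarrow> (nat \<Rightarrow> nat) \<Rightarrow> qt_field" where
  "bracket n lam mu nu =
     (\<Sum>\<alpha>\<in>distinct_perms n nu. of_int (epsilon n mu \<alpha>) * (eigen n lam - eigen n \<alpha>))"

definition v_norm :: "nat \<Rightarrow> (nat \<Rightarrow> nat) \<Rightarrow> qt_field" where
  "v_norm n lam = (\<Prod>mu\<in>strictly_above lam. eigen n lam - eigen n mu)"

text \<open>\<open>mus\<close> lists the partitions strictly above \<open>lam\<close>; row and column \<open>0\<close> are the row of Schur functions and the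
  column of \<open>lam\<close> itself.\<close>

definition det_matrix :: "nat \<Rightarrow> (nat \<Rightarrow> nat) \<Rightarrow> (nat \<Rightarrow> nat) list \<Rightarrow> xpoly mat" where
  "det_matrix n lam mus = mat (Suc (length mus)) (Suc (length mus)) (\<lambda>(s, c).
     if s = 0 then schur_pleth ((lam # mus) ! c) (Xtq n)
     else Const (bracket n lam ((lam # mus) ! c) (mus ! (s - 1))))"

section \<open>Consistency of the encoding\<close>

text \<open>The effect of the power sums on \<open>X\<close> and \<open>X\<^sup>t\<^sup>q\<close> (\<open>p_pleth_Xalph\<close>, \<open>p_pleth_Xtq\<close>), and the fact that
  \<open>complete_sym\<close>, given by its power-sum expansion, is the complete homogeneous symmetric function,
  i.e. the sum of all monomials of the given degree in every number of variables
  (\<open>complete_sym_Xalph\<close>).\<close>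

lemma qt_poly_subst_mult: "qt_poly_subst i (f * g) = qt_poly_subst i f * qt_poly_subst i g"
proof -
  let ?h = "\<lambda>c::rat poly. pcompose c (Polynomial.monom 1 i)"
  have "map_poly ?h (f * g) = map_poly ?h f * map_poly ?h g"
    by (rule poly_eqI) (simp add: coeff_map_poly coeff_mult pcompose_sum pcompose_mult)
  then show ?thesis
    by (simp add: qt_poly_subst_def pcompose_mult)
qed

lemma qt_poly_subst_eq_0_iff: "i > 0 \<Longrightarrow> qt_poly_subst i f = 0 \<longleftrightarrow> f = 0"
  by (simp add: qt_poly_subst_def pcompose_eq_0_iff degree_monom_eq map_poly_eq_0_iff)

lemma qt_subst_Fract:
  assumes "i > 0" "b \<noteq> 0"
  shows "qt_subst i (Fract a b) = Fract (qt_poly_subst i a) (qt_poly_subst i b)"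
proof -
  define c d where "c = fst (quot_of_fract (Fract a b))" and "d = snd (quot_of_fract (Fract a b))"
  have "Fract c d = Fract a b"
    by (simp add: c_def d_def)
  moreover have "d \<noteq> 0"
    by (simp add: d_def)
  ultimately have "c * b = a * d"
    using assms by (simp add: eq_fract)
  then have "qt_poly_subst i c * qt_poly_subst i b = qt_poly_subst i a * qt_poly_subst i d"
    by (metis qt_poly_subst_mult)
  then show ?thesis
    using assms \<open>d \<noteq> 0\<close>
    by (simp add: qt_subst_def c_def [symmetric] d_def [symmetric] eq_fract qt_poly_subst_eq_0_iff)
qed

lemma qt_poly_subst_diff: "qt_poly_subst i (f - g) = qt_poly_subst i f - qt_poly_subst i g"
proof -
  let ?h = "\<lambda>c::rat poly. pcompose c (Polynomial.monom 1 i)"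
  have "map_poly ?h (f - g) = map_poly ?h f - map_poly ?h g"
    by (rule poly_eqI) (simp add: coeff_map_poly pcompose_diff)
  then show ?thesis
    by (simp add: qt_poly_subst_def pcompose_diff)
qed

lemma qt_poly_subst_1: "qt_poly_subst i 1 = 1"
  by (simp add: qt_poly_subst_def pcompose_1)

lemma qt_poly_subst_t: "qt_poly_subst i [:0, 1:] = [:0, 1:] ^ i"
  by (simp add: qt_poly_subst_def map_poly_pCons pcompose_pCons monom_altdef pcompose_1)

lemma qt_poly_subst_q: "qt_poly_subst i [:[:0, 1:]:] = [:[:0, 1:]:] ^ i"
  by (simp add: qt_poly_subst_def map_poly_pCons pcompose_pCons monom_altdef poly_const_pow)

lemma qt_subst_0: "qt_subst i 0 = 0"
  unfolding qt_subst_def quot_of_fract_0 fst_conv snd_conv qt_poly_subst_1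
  by (simp add: qt_poly_subst_def Zero_fract_def)

lemma qt_subst_1: "qt_subst i 1 = 1"
  by (simp add: qt_subst_def qt_poly_subst_1 One_fract_def [symmetric])

lemma to_fract_power: "to_fract (x ^ n) = to_fract x ^ n"
  by (induction n) auto

lemma qt_subst_Xtq_factor: 
  assumes "i > 0"
  shows "qt_subst i ((tpar - 1) / (qpar - 1)) = (tpar ^ i - 1) / (qpar ^ i - 1)"
proof -
  have "(tpar - 1) / (qpar - 1) = Fract ([:0, 1:] - 1) ([:[:0, 1:]:] - 1)"
    by (simp add: tpar_def qpar_def to_fract_def One_fract_def)
  moreover have "(tpar ^ i - 1) / (qpar ^ i - 1) = Fract ([:0, 1:] ^ i - 1) ([:[:0, 1:]:] ^ i - 1)"
    unfolding tpar_def qpar_def to_fract_power [symmetric]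
    by (simp add: to_fract_def One_fract_def)
  moreover have "[:[:0, 1:]:] - 1 \<noteq> (0 :: rat poly poly)"
    by (simp add: one_pCons)
  ultimately show ?thesis
    using assms by (simp add: qt_subst_Fract qt_poly_subst_diff qt_poly_subst_1 qt_poly_subst_t qt_poly_subst_q)
qed

lemma xvar_power: "xvar j ^ e = Poly_Mapping.single (Poly_Mapping.single j e) 1"
  by (induction e) (simp_all add: xvar_def mult_single single_add [symmetric])

lemma linear_form_eq: "(\<Sum>j<n. xvar j) * Const c = (\<Sum>j<n. Poly_Mapping.single (Poly_Mapping.single j (Suc 0)) c)"
  by (simp add: xvar_def Const_def sum_distrib_right mult_single)

lemma p_pleth_linear:
  "p_pleth i ((\<Sum>j<n. xvar j) * Const c) = (\<Sum>j<n. xvar j ^ i) * Const (qt_subst i c)"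
proof (cases "c = 0")
  case True
  then show ?thesis
    by (simp add: p_pleth_def Const_def qt_subst_0)
next
  case False
  let ?E = "\<Sum>j<n. Poly_Mapping.single (Poly_Mapping.single j (Suc 0) :: nat \<Rightarrow>\<^sub>0 nat) c"
  let ?u = "\<lambda>j. Poly_Mapping.single j (Suc 0) :: nat \<Rightarrow>\<^sub>0 nat"
  have inj: "inj_on ?u A" for A
    by (rule inj_onI) (metis keys_single singleton_inject Suc_neq_Zero)
  have l: "Poly_Mapping.lookup ?E m = (if m \<in> ?u ` {..<n} then c else 0)" for m
  proof (cases "m \<in> ?u ` {..<n}")
    case True
    then obtain j where j: "j < n" "m = ?u j" by auto
    have "Poly_Mapping.lookup ?E m = (\<Sum>k<n. if k = j then c else 0)"
      unfolding lookup_sum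
      by (intro sum.cong) (use inj [of UNIV] j in \<open>auto simp: lookup_single when_def dest: injD\<close>)
    then show ?thesis using True j by simp
  next
    case False
    then have "Poly_Mapping.lookup ?E m = (\<Sum>k<n. 0)"
      unfolding lookup_sum
      by (intro sum.cong) (auto simp: lookup_single when_def)
    then show ?thesis using False by simp
  qed
  have k: "Poly_Mapping.keys ?E = ?u ` {..<n}"
  proof (rule Set.set_eqI)
    fix m
    show "m \<in> Poly_Mapping.keys ?E \<longleftrightarrow> m \<in> ?u ` {..<n}"
      unfolding in_keys_iff l using False by presburger
  qed
  have "p_pleth i ?E = (\<Sum>j<n. Poly_Mapping.single (Poly_Mapping.single j i) (qt_subst i c))"
    unfolding p_pleth_def k
    by (subst sum.reindex[OF inj], rule sum.cong) (simp_all add: l)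
  also have "\<dots> = (\<Sum>j<n. xvar j ^ i) * Const (qt_subst i c)"
    by (simp add: xvar_power Const_def sum_distrib_right mult_single)
  finally show ?thesis
    by (simp only: linear_form_eq)
qed

lemma p_pleth_Xalph: "p_pleth i (Xalph n) = (\<Sum>j<n. xvar j ^ i)"
  using p_pleth_linear[of i n 1] by (simp add: Xalph_def Const_def qt_subst_1)

lemma p_pleth_Xtq:
  "i > 0 \<Longrightarrow> p_pleth i (Xtq n) = (\<Sum>j<n. xvar j ^ i) * Const ((tpar ^ i - 1) / (qpar ^ i - 1))"
  by (simp add: Xtq_def Xalph_def p_pleth_linear qt_subst_Xtq_factor)


definition p_prod :: "(nat \<Rightarrow> xpoly) \<Rightarrow> (nat \<Rightarrow>\<^sub>0 nat) \<Rightarrow> xpoly" where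
  "p_prod P m = (\<Prod>k\<in>Poly_Mapping.keys m. P k ^ Poly_Mapping.lookup m k)"

lemma keys_subset_p_weight: "Poly_Mapping.keys m \<subseteq> {..<p_weight m}"
proof
  fix k assume k: "k \<in> Poly_Mapping.keys m"
  then have "Suc k * 1 \<le> Suc k * Poly_Mapping.lookup m k"
    by (intro mult_le_mono2) (simp add: in_keys_iff)
  then have "k < Suc k * Poly_Mapping.lookup m k"
    by (simp only: nat_mult_1_right Suc_le_eq)
  also have "\<dots> \<le> p_weight m"
    unfolding p_weight_def using k by (intro member_le_sum) auto
  finally show "k \<in> {..<p_weight m}" by simp
qed

lemma lookup_le_p_weight: "Poly_Mapping.lookup m k \<le> p_weight m"
proof (cases "k \<in> Poly_Mapping.keys m")
  case True
  have "Poly_Mapping.lookup m k \<le> Suc k * Poly_Mapping.lookup m k"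
    by simp
  also have "\<dots> \<le> p_weight m"
    unfolding p_weight_def using True by (intro member_le_sum) auto
  finally show ?thesis .
qed (simp add: in_keys_iff)

lemma finite_p_weight: "finite {m. p_weight m = j}"
proof -
  have "Poly_Mapping.lookup ` {m. p_weight m = j} \<subseteq> {f. \<forall>k. (k \<in> {..<j} \<longrightarrow> f k \<in> {..j}) \<and> (k \<notin> {..<j} \<longrightarrow> f k = 0)}"
  proof (rule subsetI)
    fix f assume "f \<in> Poly_Mapping.lookup ` {m. p_weight m = j}"
    then obtain m where m: "f = Poly_Mapping.lookup m" "p_weight m = j" by blast
    have "f k \<le> j" for k
      using lookup_le_p_weight[of m k] m by simp
    moreover have "f k = 0" if "\<not> k < j" for k
      using keys_subset_p_weight[of m] m that by (metis in_keys_iff lessThan_iff subsetD)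
    ultimately show "f \<in> {f. \<forall>k. (k \<in> {..<j} \<longrightarrow> f k \<in> {..j}) \<and> (k \<notin> {..<j} \<longrightarrow> f k = 0)}"
      by simp
  qed
  then have "finite (Poly_Mapping.lookup ` {m. p_weight m = j})"
    by (rule finite_subset) (intro finite_set_of_finite_funs finite_lessThan finite_atMost)
  then show ?thesis
    by (rule finite_imageD) (rule inj_onI, simp only: poly_mapping_eq_iff)
qed

lemma p_weight_alt: "finite A \<Longrightarrow> Poly_Mapping.keys m \<subseteq> A \<Longrightarrow> p_weight m = (\<Sum>k\<in>A. Suc k * Poly_Mapping.lookup m k)"
  unfolding p_weight_def by (rule sum.mono_neutral_left) (auto simp: in_keys_iff)

lemma z_factor_alt: "finite A \<Longrightarrow> Poly_Mapping.keys m \<subseteq> A \<Longrightarrow> z_factor m = (\<Prod>k\<in>A. Suc k ^ Poly_Mapping.lookup m k * fact (Poly_Mapping.lookup m k))"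
  unfolding z_factor_def by (rule prod.mono_neutral_left) (auto simp: in_keys_iff)

lemma p_prod_alt: "finite A \<Longrightarrow> Poly_Mapping.keys m \<subseteq> A \<Longrightarrow> p_prod P m = (\<Prod>k\<in>A. P k ^ Poly_Mapping.lookup m k)"
  unfolding p_prod_def by (rule prod.mono_neutral_left) (auto simp: in_keys_iff)

abbreviation "unit_exp k \<equiv> Poly_Mapping.single k (Suc 0) :: nat \<Rightarrow>\<^sub>0 nat"

lemma add_unit_exp:
  shows "p_weight (m + unit_exp k) = p_weight m + Suc k"
    and "z_factor (m + unit_exp k) = z_factor m * (Suc k * Suc (Poly_Mapping.lookup m k))"
    and "p_prod P (m + unit_exp k) = p_prod P m * P k"
proof -
  let ?A = "insert k (Poly_Mapping.keys m)"
  let ?B = "?A - {k}"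
  have A: "finite ?A" "Poly_Mapping.keys m \<subseteq> ?A" "Poly_Mapping.keys (m + unit_exp k) \<subseteq> ?A"
    using keys_add[of m "unit_exp k"] by auto
  have B: "?A = insert k ?B" "finite ?B" "k \<notin> ?B" by auto
  have l: "Poly_Mapping.lookup (m + unit_exp k) i = Poly_Mapping.lookup m i" if "i \<in> ?B" for i
    using that by (auto simp: lookup_add lookup_single)
  have lk: "Poly_Mapping.lookup (m + unit_exp k) k = Suc (Poly_Mapping.lookup m k)"
    by (simp add: lookup_add)
  have s: "sum f ?A = f k + sum f ?B" for f :: "nat \<Rightarrow> nat"
    by (subst B(1), subst sum.insert) (use B in auto)
  have p: "prod f ?A = f k * prod f ?B" for f :: "nat \<Rightarrow> 'a::comm_monoid_mult"
    by (subst B(1), subst prod.insert) (use B in auto)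
  show "p_weight (m + unit_exp k) = p_weight m + Suc k"
    unfolding p_weight_alt[OF A(1,2)] p_weight_alt[OF A(1,3)] s lk
    using sum.cong[OF refl, of ?B "\<lambda>i. Suc i * Poly_Mapping.lookup (m + unit_exp k) i"
      "\<lambda>i. Suc i * Poly_Mapping.lookup m i"] l by simp
  show "z_factor (m + unit_exp k) = z_factor m * (Suc k * Suc (Poly_Mapping.lookup m k))"
    unfolding z_factor_alt[OF A(1,2)] z_factor_alt[OF A(1,3)] p lk
    using prod.cong[OF refl, of ?B "\<lambda>i. Suc i ^ Poly_Mapping.lookup (m + unit_exp k) i * fact (Poly_Mapping.lookup (m + unit_exp k) i)"
      "\<lambda>i. Suc i ^ Poly_Mapping.lookup m i * fact (Poly_Mapping.lookup m i)"] l
    by (simp add: algebra_simps)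
  show "p_prod P (m + unit_exp k) = p_prod P m * P k"
    unfolding p_prod_alt[OF A(1,2)] p_prod_alt[OF A(1,3)] p lk
    using prod.cong[OF refl, of ?B "\<lambda>i. P i ^ Poly_Mapping.lookup (m + unit_exp k) i"
      "\<lambda>i. P i ^ Poly_Mapping.lookup m i"] l
    by (simp add: algebra_simps)
qed

lemma z_factor_pos: "z_factor m > 0"
  unfolding z_factor_def by (intro prod_pos) auto

lemma Const_add: "Const (a + b) = Const a + Const b"
  and Const_mult: "Const (a * b) = Const a * Const b"
  and Const_0: "Const 0 = 0" and Const_1: "Const 1 = 1"
  by (simp_all add: Const_def single_add mult_single)

lemma Const_sum: "Const (sum f A) = (\<Sum>a\<in>A. Const (f a))"
  by (induction A rule: infinite_finite_induct) (simp_all add: Const_add Const_0)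

definition p_complete :: "(nat \<Rightarrow> xpoly) \<Rightarrow> nat \<Rightarrow> xpoly" where
  "p_complete P j = (\<Sum>m | p_weight m = j. Const (1 / of_nat (z_factor m)) * p_prod P m)"

lemma pleth_complete_sym:
  "pleth (complete_sym (int j)) E = p_complete (\<lambda>k. p_pleth (Suc k) E) j"
proof -
  let ?f = "complete_sym (int j)"
  let ?W = "{m. p_weight m = j}"
  have l: "Poly_Mapping.lookup ?f m = (if m \<in> ?W then 1 / of_nat (z_factor m) else 0)" for m
  proof -
    have "Poly_Mapping.lookup ?f m = (\<Sum>m'\<in>?W. if m' = m then 1 / of_nat (z_factor m) else 0)"
      unfolding complete_sym_def by (auto simp: lookup_sum lookup_single when_def intro!: sum.cong)
    then show ?thesis by (simp add: finite_p_weight)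
  qed
  have k: "Poly_Mapping.keys ?f = ?W"
  proof (rule Set.set_eqI)
    fix m
    have "(1 / of_nat (z_factor m) :: qt_field) \<noteq> 0"
      using z_factor_pos[of m] by simp
    then show "m \<in> Poly_Mapping.keys ?f \<longleftrightarrow> m \<in> ?W"
      unfolding in_keys_iff l by presburger
  qed
  show ?thesis
    unfolding pleth_def k p_complete_def p_prod_def by (rule sum.cong) (simp_all add: l)
qed

lemma p_complete_rec: "of_nat j * p_complete P j = (\<Sum>k<j. P k * p_complete P (j - Suc k))"
proof -
  let ?z = "\<lambda>m. 1 / of_nat (z_factor m) :: qt_field"
  let ?S = "SIGMA m : {m. p_weight m = j}. Poly_Mapping.keys m"
  let ?T = "SIGMA k : {..<j}. {m. p_weight m = j - Suc k}"
  let ?g = "\<lambda>(k, m). (m + unit_exp k, k)"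
  have "of_nat j * p_complete P j = (\<Sum>m | p_weight m = j. \<Sum>k\<in>Poly_Mapping.keys m.
          Const (of_nat (Suc k * Poly_Mapping.lookup m k) * ?z m) * p_prod P m)"
  proof -
    have "of_nat j * (Const (?z m) * p_prod P m) = (\<Sum>k\<in>Poly_Mapping.keys m.
          Const (of_nat (Suc k * Poly_Mapping.lookup m k) * ?z m) * p_prod P m)" if "p_weight m = j" for m
    proof -
      have "of_nat j = Const (of_nat j)" for j
        by (simp add: Const_def)
      then have "of_nat j * (Const (?z m) * p_prod P m) = Const (of_nat j * ?z m) * p_prod P m"
        by (simp only: Const_mult mult.assoc)
      also have "of_nat j * ?z m = (\<Sum>k\<in>Poly_Mapping.keys m. of_nat (Suc k * Poly_Mapping.lookup m k) * ?z m)"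
        unfolding that[symmetric] p_weight_def by (simp only: of_nat_sum sum_distrib_right)
      finally show ?thesis by (simp only: Const_sum sum_distrib_right)
    qed
    then show ?thesis unfolding p_complete_def sum_distrib_left by (intro sum.cong) auto
  qed
  also have "\<dots> = (\<Sum>(m, k)\<in>?S. Const (of_nat (Suc k * Poly_Mapping.lookup m k) * ?z m) * p_prod P m)"
    by (rule sum.Sigma) (auto simp: finite_p_weight)
  also have "\<dots> = (\<Sum>(k, m)\<in>?T. P k * (Const (?z m) * p_prod P m))"
  proof (rule sum.reindex_bij_witness[where j = "\<lambda>(m, k). (k, m - unit_exp k)" and i = ?g], goal_cases)
    case (1 a)
    obtain m k where a: "a = (m, k)" "p_weight m = j" "k \<in> Poly_Mapping.keys m" using 1 by auto
    have "m - unit_exp k + unit_exp k = m"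
      using a(3) by (intro poly_mapping_eqI) (auto simp: lookup_add lookup_minus lookup_single when_def in_keys_iff)
    then show ?case by (simp add: a)
  next
    case (2 a)
    obtain m k where a: "a = (m, k)" "p_weight m = j" "k \<in> Poly_Mapping.keys m" using 2 by auto
    have e: "m - unit_exp k + unit_exp k = m"
      using a(3) by (intro poly_mapping_eqI) (auto simp: lookup_add lookup_minus lookup_single when_def in_keys_iff)
    then have "j = p_weight (m - unit_exp k) + Suc k"
      using add_unit_exp(1)[of "m - unit_exp k" k] a by simp
    then show ?case by (simp add: a)
  next
    case (3 b)
    then show ?case by (auto simp: split_beta)
  next
    case (4 b)
    obtain k m where b: "b = (k, m)" "p_weight m = j - Suc k" "k < j" using 4 by auto
    then show ?case by (auto simp: add_unit_exp in_keys_iff lookup_add)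
  next
    case (5 a)
    obtain m k where a: "a = (m, k)" "p_weight m = j" "k \<in> Poly_Mapping.keys m" using 5 by auto
    define m' where "m' = m - unit_exp k"
    have e: "m' + unit_exp k = m"
      unfolding m'_def
      using a(3) by (intro poly_mapping_eqI) (auto simp: lookup_add lookup_minus lookup_single when_def in_keys_iff)
    have l: "Poly_Mapping.lookup m k = Suc (Poly_Mapping.lookup m' k)"
      by (simp add: e[symmetric] lookup_add)
    have "of_nat (Suc k * Poly_Mapping.lookup m k) * ?z m = ?z m'"
      unfolding l e[symmetric] add_unit_exp of_nat_mult
      unfolding l[unfolded e[symmetric]] of_nat_mult
      using z_factor_pos[of m'] by (simp add: divide_simps del: of_nat_Suc)
    then show ?case
      by (simp add: a m'_def[symmetric]) (simp add: e[symmetric] add_unit_exp)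
  qed
  also have "\<dots> = (\<Sum>k<j. P k * p_complete P (j - Suc k))"
    unfolding p_complete_def sum_distrib_left by (rule sum.Sigma[symmetric]) (auto simp: finite_p_weight)
  finally show ?thesis .
qed

definition weak_comps :: "nat \<Rightarrow> nat \<Rightarrow> (nat \<Rightarrow> nat) set" where
  "weak_comps n j = {\<alpha>. (\<forall>i\<ge>n. \<alpha> i = 0) \<and> (\<Sum>i<n. \<alpha> i) = j}"

lemma finite_weak_comps: "finite (weak_comps n j)"
proof -
  have "weak_comps n j \<subseteq> {f. \<forall>k. (k \<in> {..<n} \<longrightarrow> f k \<in> {..j}) \<and> (k \<notin> {..<n} \<longrightarrow> f k = 0)}"
    by (auto simp: weak_comps_def intro: member_le_sum)
  then show ?thesis
    by (rule finite_subset) (intro finite_set_of_finite_funs finite_lessThan finite_atMost)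
qed

definition x_complete :: "nat \<Rightarrow> nat \<Rightarrow> xpoly" where
  "x_complete n j = (\<Sum>\<alpha>\<in>weak_comps n j. \<Prod>i<n. xvar i ^ \<alpha> i)"

lemma sum_fun_upd_add: "i < (n::nat) \<Longrightarrow> (\<Sum>l<n. (\<alpha>(i := (\<alpha> i + k))) l) = (\<Sum>l<n. \<alpha> l) + (k::nat)"
proof -
  assume i: "i < n"
  have "(\<Sum>l<n. (\<alpha>(i := (\<alpha> i + k))) l) = (\<Sum>l<n. \<alpha> l + (if l = i then k else 0))"
    by (intro sum.cong) auto
  also have "\<dots> = (\<Sum>l<n. \<alpha> l) + (\<Sum>l<n. if l = i then k else 0)"
    by (rule sum.distrib)
  also have "(\<Sum>l<n. if l = i then k else 0) = k"
    using i by (simp add: sum.delta)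
  finally show ?thesis .
qed

lemma prod_fun_upd_add: "i < n \<Longrightarrow> (\<Prod>l<n. xvar l ^ (\<alpha>(i := (\<alpha> i + k))) l) = (\<Prod>l<n. xvar l ^ \<alpha> l) * xvar i ^ k"
proof -
  assume i: "i < n"
  have "(\<Prod>l<n. xvar l ^ (\<alpha>(i := (\<alpha> i + k))) l) = (\<Prod>l<n. xvar l ^ \<alpha> l * (if l = i then xvar i ^ k else 1))"
    by (intro prod.cong) (auto simp: power_add)
  then show ?thesis using i by (simp add: prod.distrib)
qed

lemma x_complete_rec: "of_nat j * x_complete n j = (\<Sum>k<j. (\<Sum>i<n. xvar i ^ Suc k) * x_complete n (j - Suc k))"
proof -
  let ?M = "\<lambda>\<alpha>. \<Prod>i<n. xvar i ^ \<alpha> i"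
  let ?S = "SIGMA \<alpha> : weak_comps n j. SIGMA i : {..<n}. {..<\<alpha> i}"
  let ?T = "SIGMA k : {..<j}. SIGMA i : {..<n}. weak_comps n (j - Suc k)"
  have "of_nat j * x_complete n j = (\<Sum>\<alpha>\<in>weak_comps n j. \<Sum>i<n. \<Sum>k<\<alpha> i. ?M \<alpha>)"
    unfolding x_complete_def sum_distrib_left
    by (intro sum.cong) (auto simp: weak_comps_def sum_distrib_right [symmetric] of_nat_sum [symmetric])
  also have "\<dots> = (\<Sum>(\<alpha>, i, k)\<in>?S. ?M \<alpha>)"
    by (simp add: sum.Sigma finite_weak_comps split_beta del: sum_constant)
  also have "\<dots> = (\<Sum>(k, i, \<beta>)\<in>?T. xvar i ^ Suc k * ?M \<beta>)"
  proof (rule sum.reindex_bij_witness[where j = "\<lambda>(\<alpha>, i, k). (k, i, \<alpha>(i := \<alpha> i - Suc k))"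
        and i = "\<lambda>(k, i, \<beta>). (\<beta>(i := \<beta> i + Suc k), i, k)"], goal_cases)
    case (1 a)
    then show ?case by (auto simp: fun_eq_iff)
  next
    case (2 a)
    then obtain \<alpha> i k where a: "a = (\<alpha>, i, k)" "\<alpha> \<in> weak_comps n j" "i < n" "k < \<alpha> i" by auto
    define \<beta> where "\<beta> = \<alpha>(i := \<alpha> i - Suc k)"
    have e: "\<alpha> = \<beta>(i := \<beta> i + Suc k)" using a by (auto simp: \<beta>_def fun_eq_iff)
    have "j = (\<Sum>l<n. \<beta> l) + Suc k"
      using a(2) sum_fun_upd_add[OF a(3), of \<beta> "Suc k"] unfolding e[symmetric] by (simp add: weak_comps_def)
    moreover have "\<forall>i\<ge>n. \<beta> i = 0"
      using a(2,3) by (auto simp: \<beta>_def weak_comps_def)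
    ultimately show ?case using a by (auto simp: \<beta>_def[symmetric] weak_comps_def)
  next
    case (3 b)
    then show ?case by (auto simp: fun_eq_iff)
  next
    case (4 b)
    then obtain k i \<beta> where b: "b = (k, i, \<beta>)" "k < j" "i < n" "\<beta> \<in> weak_comps n (j - Suc k)" by auto
    then show ?case using sum_fun_upd_add[OF b(3), of \<beta> "Suc k"] by (auto simp: weak_comps_def)
  next
    case (5 a)
    then obtain \<alpha> i k where a: "a = (\<alpha>, i, k)" "\<alpha> \<in> weak_comps n j" "i < n" "k < \<alpha> i" by auto
    define \<beta> where "\<beta> = \<alpha>(i := \<alpha> i - Suc k)"
    have e: "\<alpha> = \<beta>(i := \<beta> i + Suc k)" using a by (auto simp: \<beta>_def fun_eq_iff)
    have "?M \<alpha> = ?M \<beta> * xvar i ^ Suc k"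
      using prod_fun_upd_add[OF a(3), of \<beta> "Suc k"] unfolding e[symmetric] .
    then show ?case by (simp add: a \<beta>_def[symmetric] mult.commute)
  qed
  also have "\<dots> = (\<Sum>k<j. \<Sum>i<n. \<Sum>\<beta>\<in>weak_comps n (j - Suc k). xvar i ^ Suc k * ?M \<beta>)"
    by (simp add: sum.Sigma finite_weak_comps split_beta)
  also have "\<dots> = (\<Sum>k<j. (\<Sum>i<n. xvar i ^ Suc k) * x_complete n (j - Suc k))"
    unfolding x_complete_def sum_product ..
  finally show ?thesis .
qed

lemma p_weight_eq_0_iff: "p_weight m = 0 \<longleftrightarrow> m = 0"
  using keys_subset_p_weight[of m] by (auto simp: p_weight_def)

lemma xpoly_of_nat_cancel: "of_nat j * a = of_nat j * b \<Longrightarrow> j > 0 \<Longrightarrow> a = (b::xpoly)"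
  using mult_left_cancel[of "of_nat j :: xpoly" a b] by simp

lemma complete_sym_Xalph:
  "pleth (complete_sym (int j)) (Xalph n) =
     (\<Sum>\<alpha> | (\<forall>i\<ge>n. \<alpha> i = 0) \<and> (\<Sum>i<n. \<alpha> i) = j. \<Prod>i<n. xvar i ^ \<alpha> i)"
proof -
  have "p_complete (\<lambda>k. \<Sum>i<n. xvar i ^ Suc k) j = x_complete n j"
  proof (induction j rule: less_induct)
    case (less j)
    show ?case
    proof (cases "j = 0")
      case True
      have "weak_comps n 0 = {\<lambda>_. 0}"
      proof -
        have "\<alpha> i = 0" if "\<forall>i\<ge>n. \<alpha> i = 0" "\<forall>i\<in>{..<n}. \<alpha> i = 0" for \<alpha> :: "nat \<Rightarrow> nat" and i
          using that by (cases "i < n") auto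
        then show ?thesis by (auto simp: weak_comps_def fun_eq_iff)
      qed
      then show ?thesis
        by (simp add: True p_complete_def p_weight_eq_0_iff x_complete_def p_prod_def z_factor_def Const_1)
    next
      case False
      show ?thesis
        by (rule xpoly_of_nat_cancel[of j]) (use False less in \<open>auto simp: p_complete_rec x_complete_rec intro!: sum.cong\<close>)
    qed
  qed
  then show ?thesis
    by (simp only: pleth_complete_sym p_pleth_Xalph x_complete_def weak_comps_def)
qed

end

theory Submission
  imports Defs
begin

text \<open>Write \<open>g\<^sub>r = S\<^sub>r[X\<^sup>t\<^sup>q]\<close> and \<open>g\<^sub>\<nu> = \<Prod>\<^sub>i g\<^bsub>\<nu>\<^sub>i\<^esub>\<close>. The \<open>g\<^sub>\<nu>\<close> are dual to the monomial symmetric functions, with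
  kernel \<open>\<Pi> = \<Prod>\<^sub>i\<^sub>j \<Psi>(x\<^sub>i y\<^sub>j)\<close>, \<open>\<Psi>(z) = (t z; q)\<^sub>\<infinity> / (z; q)\<^sub>\<infinity>\<close>. Let \<open>D(u)\<close> be Macdonald's operator in the \<open>x\<^sub>i\<close>. Up to the
  Vandermonde determinant of the \<open>x\<^sub>i\<close>, \<open>D(u) \<Pi>\<close> is the determinant of the matrix
  \<open>x\<^sub>i\<^bsup>n-j\<^esup> (A\<^sub>i + u t\<^bsup>n-j\<^esup> A'\<^sub>i)\<close> with \<open>A\<^sub>i = \<Prod>\<^sub>j \<Psi>(x\<^sub>i y\<^sub>j)\<close>, \<open>A'\<^sub>i = \<Prod>\<^sub>j \<Psi>(q x\<^sub>i y\<^sub>j)\<close>. Multiplying it by a matrix in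
  the \<open>y\<^sub>j\<close> turns it into \<open>1/(1 - x\<^sub>i y\<^sub>j) + u/(1 - t x\<^sub>i y\<^sub>j)\<close> up to scalars, which is symmetric in \<open>x\<close> and \<open>y\<close>.
  Hence \<open>D(u)\<close> is self-adjoint; and since
  \<open>1/(1 - z) - 1/(1 - t z) = z (1/(1 - z) - t/(1 - t z))\<close>, also
  \<open>D(-1) \<Pi> = x\<^sub>1\<cdots>x\<^sub>n y\<^sub>1\<cdots>y\<^sub>n D(-t) \<Pi>\<close>.

  On \<open>S\<^sub>\<mu>[X\<^sup>t\<^sup>q]\<close> the operator acts triangularly through \<open>\<epsilon>(\<mu>, \<alpha>)\<close>, so the cofactors of the first row of the
  determinant combine the \<open>S\<^sub>\<mu>[X\<^sup>t\<^sup>q]\<close> to an eigenvector for \<open>[|\<lambda>|]\<close>. It is supported on \<open>g\<^sub>\<nu>\<close> with \<open>\<nu> \<ge> \<lambda>\<close>, and by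
  self-adjointness on \<open>m\<^sub>\<kappa>\<close> with \<open>\<kappa> \<le> \<lambda>\<close>; these two properties single out \<open>P\<^sub>\<lambda>\<close> up to a factor. The factor is the
  coefficient of \<open>g\<^sub>\<lambda>\<close> in \<open>P\<^sub>\<lambda>\<close>, equal to \<open>c\<^bsub>\<lambda>'\<^esub>(t,q) / c\<^sub>\<lambda>(q,t)\<close>: the identity for \<open>D(-1)\<close> relates \<open>\<lambda>\<close> to the
  partition obtained by deleting its first column.\<close>

section \<open>Power series in several variables\<close>

text \<open>The operator D(u) itself never appears, since it would require division by the
  Vandermonde determinant. Only coefficients of the antisymmetrized kernel are compared, and there
  D(u) just multiplies each term by a product of factors 1 + u t^(n-j) q^\<alpha>_j.

  \<open>macdonald_P\<close> is a definite description in the ring of power sums, so existence and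
  uniqueness of the family belong to the proof. The cofactor vector serves here too: taken with as
  many variables as the degree d, where the g_\<nu> have a nondegenerate Gram matrix, it produces
  the family.

  Two opposite supports determine P_\<lambda> because the Gram matrix of the g_\<nu> is symmetric:
  pairing two such functions in either order leaves a single term.

  The values u = -t and u = -1 are forced by the hooks. For \<lambda> with n parts and \<kappa>
  obtained by deleting the first column, the D(-t)-eigenvalue of \<kappa> is the first-column part
  of c_\<lambda>(q,t), and the D(-1)-eigenvalue of \<lambda> is that of c_\<lambda>'(t,q). So the
  shift identity is a recursion for the quotient of the two.\<close>

abbreviation "lookup \<equiv> Poly_Mapping.lookup"
abbreviation "keys \<equiv> Poly_Mapping.keys"
abbreviation "single \<equiv> Poly_Mapping.single"

type_synonym 'a mpol = "(nat \<Rightarrow>\<^sub>0 nat) \<Rightarrow>\<^sub>0 'a"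

text \<open>Exponents are handled as plain functions; this is the bridge to the keys of polynomials.
  Values from \<open>n\<close> on are ignored.\<close>

definition mkey :: "nat \<Rightarrow> (nat \<Rightarrow> nat) \<Rightarrow> nat \<Rightarrow>\<^sub>0 nat" where
  "mkey n \<alpha> = (\<Sum>i<n. single i (\<alpha> i))"

lemma lookup_mkey: "lookup (mkey n \<alpha>) i = (if i < n then \<alpha> i else 0)"
proof -
  have "lookup (mkey n \<alpha>) i = (\<Sum>j<n. if j = i then \<alpha> i else 0)"
    unfolding mkey_def lookup_sum by (intro sum.cong) (auto simp: lookup_single when_def)
  then show ?thesis by simp
qed

lemma mkey_eq_iff: "mkey n \<alpha> = mkey n \<beta> \<longleftrightarrow> (\<forall>i<n. \<alpha> i = \<beta> i)"
  by (auto simp: poly_mapping_eq_iff fun_eq_iff lookup_mkey)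

lemma mkey_cong: "(\<And>i. i < n \<Longrightarrow> \<alpha> i = \<beta> i) \<Longrightarrow> mkey n \<alpha> = mkey n \<beta>"
  by (simp add: mkey_eq_iff)

lemma mkey_Suc: "mkey (Suc n) \<alpha> = mkey n \<alpha> + single n (\<alpha> n)"
  by (simp add: mkey_def)

definition cst :: "'a::comm_ring_1 \<Rightarrow> 'a mpol" where
  "cst c = single 0 c"

lemma cst_hom: "cst (a + b) = cst a + cst b" "cst (a * b) = cst a * cst b" "cst 0 = 0" "cst 1 = 1"
  "cst (- a) = - cst a" "cst (a - b) = cst a - cst b"
  by (simp_all add: cst_def single_add mult_single single_uminus single_diff)

lemma cst_power: "cst (a ^ k) = cst a ^ k"
  by (induction k) (simp_all add: cst_hom)

lemma lookup_cst_mult: "lookup (cst c * f) e = c * lookup f e"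
proof -
  have "cst c * f = Poly_Mapping.map ((*) c) f"
    by (simp only: cst_def mult_map_scale_conv_mult)
  then show ?thesis by (simp add: Poly_Mapping.map.rep_eq when_def)
qed

text \<open>A power series in variables \<open>z\<^sub>0, z\<^sub>1, \<dots>\<close> is represented by a power series in one variable \<open>w\<close>, which records
  the total degree, over the polynomials in the \<open>z\<^sub>i\<close>: \<open>fps_at i f\<close> is \<open>f(w z\<^sub>i)\<close>.\<close>

definition fps_at :: "nat \<Rightarrow> 'a::comm_ring_1 fps \<Rightarrow> 'a mpol fps" where
  "fps_at i f = Abs_fps (\<lambda>r. single (single i r) (fps_nth f r))"

lemma fps_at_nth [simp]:
  "fps_nth (fps_at i f) r = single (single i r) (fps_nth f r)"
  by (simp add: fps_at_def)

lemma fps_at_add: "fps_at i (f + g) = fps_at i f + fps_at i g"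
  by (rule fps_ext) (simp add: single_add)

lemma fps_at_diff: "fps_at i (f - g) = fps_at i f - fps_at i g"
  by (rule fps_ext) (simp add: single_diff)

lemma fps_at_const: "fps_at i (fps_const c) = fps_const (cst c)"
  by (rule fps_ext) (simp add: cst_def fps_nth_fps_const)

lemma fps_at_1: "fps_at i 1 = 1"
  using fps_at_const[of i 1] by (simp add: cst_hom)

lemma single_sum: "single k (sum f A) = (\<Sum>a\<in>A. single k (f a))"
  by (induction A rule: infinite_finite_induct) (simp_all add: single_add)

lemma fps_at_mult: "fps_at i (f * g) = fps_at i f * fps_at i g"
proof (rule fps_ext)
  fix r
  show "fps_nth (fps_at i (f * g)) r = fps_nth (fps_at i f * fps_at i g) r"
    by (auto simp: fps_mult_nth mult_single single_sum single_add [symmetric] intro!: sum.cong)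
qed

lemma fps_at_prod: "fps_at i (prod f A) = (\<Prod>a\<in>A. fps_at i (f a))"
  by (induction A rule: infinite_finite_induct) (simp_all add: fps_at_mult fps_at_1)

lemma fps_at_power: "fps_at i (f ^ k) = fps_at i f ^ k"
  by (induction k) (simp_all add: fps_at_mult fps_at_1)

lemma weak_comps_0: "weak_comps 0 d = (if d = 0 then {\<lambda>_. 0} else {})"
  by (auto simp: weak_comps_def fun_eq_iff)

text \<open>The factors live in separate variables, so each composition of \<open>d\<close> gives a
  monomial of its own and no terms are merged.\<close>

lemma fps_nth_prod_at:
  "fps_nth (\<Prod>i<n. fps_at i (a i)) d =
     (\<Sum>\<alpha>\<in>weak_comps n d. single (mkey n \<alpha>) (\<Prod>i<n. fps_nth (a i) (\<alpha> i)))"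
proof (induction n arbitrary: d)
  case 0
  then show ?case by (simp add: weak_comps_0 mkey_def)
next
  case (Suc n)
  let ?c = "\<lambda>n \<alpha>. single (mkey n \<alpha>) (\<Prod>i<n. fps_nth (a i) (\<alpha> i))"
  have "fps_nth (\<Prod>i<Suc n. fps_at i (a i)) d
      = (\<Sum>k=0..d. \<Sum>\<alpha>\<in>weak_comps n k. ?c n \<alpha> * fps_nth (fps_at n (a n)) (d - k))"
    by (simp add: fps_mult_nth Suc.IH sum_distrib_right del: fps_at_nth)
  also have "\<dots> = (\<Sum>k=0..d. \<Sum>\<alpha>\<in>weak_comps n k. ?c (Suc n) (\<alpha>(n := d - k)))"
  proof (intro sum.cong refl)
    fix k \<alpha>
    have "mkey n (\<alpha>(n := d - k)) = mkey n \<alpha>" by (rule mkey_cong) simp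
    then show "?c n \<alpha> * fps_nth (fps_at n (a n)) (d - k) = ?c (Suc n) (\<alpha>(n := d - k))"
      by (simp add: mult_single mkey_Suc)
  qed
  also have "\<dots> = (\<Sum>(k, \<alpha>)\<in>(SIGMA k:{0..d}. weak_comps n k). ?c (Suc n) (\<alpha>(n := d - k)))"
    by (rule sum.Sigma) (auto simp: finite_weak_comps)
  also have "\<dots> = (\<Sum>\<alpha>\<in>weak_comps (Suc n) d. ?c (Suc n) \<alpha>)"
  proof (rule sum.reindex_bij_witness[where j = "\<lambda>(k, \<alpha>). \<alpha>(n := d - k)"
        and i = "\<lambda>\<alpha>. (\<Sum>i<n. \<alpha> i, \<alpha>(n := 0))"], goal_cases)
    case (1 x)
    then obtain k \<alpha> where x: "x = (k, \<alpha>)" "k \<le> d" "\<alpha> \<in> weak_comps n k" by auto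
    have "(\<Sum>i<n. (\<alpha>(n := d - k)) i) = k" using x(3) by (auto simp: weak_comps_def)
    moreover have "\<alpha>(n := 0) = \<alpha>" using x(3) by (auto simp: weak_comps_def)
    ultimately show ?case by (simp add: x)
  next
    case (2 x)
    then obtain k \<alpha> where x: "x = (k, \<alpha>)" "k \<le> d" "\<alpha> \<in> weak_comps n k" by auto
    have "(\<Sum>i<n. (\<alpha>(n := d - k)) i) = k" using x(3) by (auto simp: weak_comps_def)
    then show ?case using x by (auto simp: weak_comps_def)
  next
    case (3 \<alpha>)
    then show ?case by (auto simp: weak_comps_def fun_eq_iff)
  next
    case (4 \<alpha>)
    have "(\<Sum>i<n. (\<alpha>(n := 0)) i) = (\<Sum>i<n. \<alpha> i)" by (intro sum.cong) auto
    then show ?case using 4 by (auto simp: weak_comps_def)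
  next
    case (5 x)
    then show ?case by auto
  qed
  finally show ?case .
qed

lemma lookup_sum_mkey:
  assumes "finite A" "A \<subseteq> {\<alpha>. \<forall>i\<ge>n. \<alpha> i = 0}" "\<forall>i\<ge>n. \<beta> i = 0"
  shows "lookup (\<Sum>\<alpha>\<in>A. single (mkey n \<alpha>) (c \<alpha>)) (mkey n \<beta>) =
    (if \<beta> \<in> A then c \<beta> else 0)"
proof -
  have "mkey n \<alpha> = mkey n \<beta> \<longleftrightarrow> \<alpha> = \<beta>" if "\<alpha> \<in> A" for \<alpha>
    using assms(2,3) that unfolding mkey_eq_iff fun_eq_iff
    by (metis (mono_tags, lifting) mem_Collect_eq not_le subsetD)
  then have "lookup (\<Sum>\<alpha>\<in>A. single (mkey n \<alpha>) (c \<alpha>)) (mkey n \<beta>)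
     = (\<Sum>\<alpha>\<in>A. if \<alpha> = \<beta> then c \<beta> else 0)"
    unfolding lookup_sum by (intro sum.cong) (auto simp: lookup_single when_def)
  then show ?thesis using assms(1) by simp
qed

lemma lookup_prod_at:
  assumes "\<forall>i\<ge>n. \<beta> i = 0"
  shows "lookup (fps_nth (\<Prod>i<n. fps_at i (a i)) d) (mkey n \<beta>) =
    (if d = (\<Sum>i<n. \<beta> i) then \<Prod>i<n. fps_nth (a i) (\<beta> i) else 0)"
proof -
  have "\<beta> \<in> weak_comps n d \<longleftrightarrow> d = (\<Sum>i<n. \<beta> i)"
    using assms by (auto simp: weak_comps_def)
  then show ?thesis
    unfolding fps_nth_prod_at
    by (subst lookup_sum_mkey) (use assms in \<open>auto simp: weak_comps_def intro: finite_weak_comps [unfolded weak_comps_def]\<close>)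
qed

text \<open>The Euler operator \<open>z d/dz\<close>. A power series \<open>f\<close> with constant term \<open>1\<close> is determined by its
  logarithmic Euler derivative, which turns products into sums.\<close>

definition euler :: "'a::comm_ring_1 fps \<Rightarrow> 'a fps" where
  "euler f = Abs_fps (\<lambda>r. of_nat r * fps_nth f r)"

lemma euler_nth [simp]: "fps_nth (euler f) r = of_nat r * fps_nth f r"
  by (simp add: euler_def)

lemma euler_mult: "euler (f * g) = euler f * g + f * euler g"
proof (rule fps_ext)
  fix r
  have "of_nat r * (fps_nth f k * fps_nth g (r - k)) =
      of_nat k * fps_nth f k * fps_nth g (r - k) + fps_nth f k * (of_nat (r - k) * fps_nth g (r - k))"
    if "k \<le> r" for k
  proof -
    have "(of_nat r :: 'a) = of_nat k + of_nat (r - k)" using that by (simp flip: of_nat_add)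
    then show ?thesis by (simp only: algebra_simps)
  qed
  then show "fps_nth (euler (f * g)) r = fps_nth (euler f * g + f * euler g) r"
    by (simp add: fps_mult_nth sum_distrib_left sum.distrib [symmetric])
qed

lemma euler_prod:
  assumes "finite A" "\<And>a. a \<in> A \<Longrightarrow> euler (f a) = f a * l a"
  shows "euler (prod f A) = prod f A * sum l A"
  using assms
proof (induction A rule: finite_induct)
  case empty
  then show ?case by (simp add: fps_eq_iff)
next
  case (insert a A)
  then show ?case by (simp add: euler_mult algebra_simps)
qed

lemma euler_fps_at: "euler (fps_at i f) = fps_at i (euler f)"
proof (rule fps_ext)
  fix r
  have "of_nat r * single k c = single k (of_nat r * c)" for k and c :: 'a
    by (induction r) (simp_all add: algebra_simps single_add)
  then show "fps_nth (euler (fps_at i f)) r = fps_nth (fps_at i (euler f)) r" by simp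
qed

text \<open>Since \<open>l\<close> has no constant term, the equation expresses r f_r by earlier
  coefficients; characteristic zero allows the division by r.\<close>

lemma euler_unique:
  fixes f g :: "'a::{idom, ring_char_0} fps"
  assumes "euler f = f * l" "euler g = g * l" "fps_nth f 0 = fps_nth g 0" "fps_nth l 0 = 0"
  shows "f = g"
proof (rule fps_ext)
  fix r
  show "fps_nth f r = fps_nth g r"
  proof (induction r rule: less_induct)
    case (less r)
    show ?case
    proof (cases "r = 0")
      case True
      then show ?thesis by (simp add: assms(3))
    next
      case False
      have e: "of_nat r * fps_nth h r = (\<Sum>k=0..<r. fps_nth h k * fps_nth l (r - k))"
        if "euler h = h * l" for h
      proof -
        have "of_nat r * fps_nth h r = fps_nth (h * l) r"
          using that by (metis euler_nth)
        also have "\<dots> = (\<Sum>k=0..<r. fps_nth h k * fps_nth l (r - k)) + fps_nth h r * fps_nth l 0"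
          unfolding fps_mult_nth by (simp add: atLeastLessThanSuc_atLeastAtMost [symmetric])
        finally show ?thesis by (simp add: assms(4))
      qed
      have "of_nat r * fps_nth f r = of_nat r * fps_nth g r"
        unfolding e[OF assms(1)] e[OF assms(2)] using less by (intro sum.cong) auto
      then show ?thesis using False by simp
    qed
  qed
qed

section \<open>Determinants of Cauchy type\<close>

definition alt_mat :: "nat \<Rightarrow> (nat \<Rightarrow> 'a::comm_ring_1) \<Rightarrow> (nat \<Rightarrow> 'a) \<Rightarrow> (nat \<Rightarrow> 'a) \<Rightarrow> 'a \<Rightarrow> 'a \<Rightarrow> 'a mat" where
  "alt_mat n X A A' t u = mat n n (\<lambda>(i, j). X i ^ (n - Suc j) * (A i + u * t ^ (n - Suc j) * A' i))"

definition vandermonde :: "nat \<Rightarrow> (nat \<Rightarrow> 'a::comm_ring_1) \<Rightarrow> 'a mat" where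
  "vandermonde n X = mat n n (\<lambda>(i, j). X i ^ (n - Suc j))"

definition omit_poly :: "nat \<Rightarrow> (nat \<Rightarrow> 'a::comm_ring_1) \<Rightarrow> nat \<Rightarrow> 'a poly" where
  "omit_poly n Y j = (\<Prod>k\<in>{..<n} - {j}. [:1, - Y k:])"

definition omit_mat :: "nat \<Rightarrow> (nat \<Rightarrow> 'a::comm_ring_1) \<Rightarrow> 'a mat" where
  "omit_mat n Y = mat n n (\<lambda>(m, j). poly.coeff (omit_poly n Y j) (n - Suc m))"

lemma mat_dims [simp]:
  "alt_mat n X A A' t u \<in> carrier_mat n n" "vandermonde n X \<in> carrier_mat n n"
  "omit_mat n X \<in> carrier_mat n n"
  by (simp_all add: alt_mat_def vandermonde_def omit_mat_def)

lemma degree_linear_le: "degree [:a, b:] \<le> 1"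
  by simp

lemma degree_omit_poly: "j < n \<Longrightarrow> degree (omit_poly n Y j :: 'a::idom poly) \<le> n - 1"
proof -
  assume j: "j < n"
  have "degree (omit_poly n Y j) \<le> (\<Sum>k\<in>{..<n} - {j}. 1)"
    unfolding omit_poly_def by (rule order_trans[OF degree_prod_sum_le]) (simp_all only: degree_linear_le sum_mono finite_Diff finite_lessThan o_def)
  then show ?thesis using j by simp
qed

lemma poly_as_sum_desc:
  fixes p :: "'a::idom poly"
  assumes "degree p \<le> n - 1" "n > 0"
  shows "poly p x = (\<Sum>m<n. poly.coeff p (n - Suc m) * x ^ (n - Suc m))"
proof -
  have "poly p x = (\<Sum>i<n. poly.coeff p i * x ^ i)"
    unfolding poly_altdef using assms
    by (intro sum.mono_neutral_left) (auto simp: coeff_eq_0)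
  also have "\<dots> = (\<Sum>m<n. poly.coeff p (n - Suc m) * x ^ (n - Suc m))"
    by (rule sum.nat_diff_reindex [symmetric])
  finally show ?thesis .
qed

lemma poly_omit: "poly (omit_poly n Y j) x = (\<Prod>k\<in>{..<n} - {j}. 1 - x * Y k)"
  by (simp add: omit_poly_def poly_prod)

text \<open>Multiplying by a column of polynomial coefficients is evaluation of the polynomial. As
  t^(n-Suc j) accompanies X_i^(n-Suc j), the second summand of the row evaluates it at t X_i instead
  of X_i.\<close>

lemma mult_omit_mat:
  fixes X Y :: "nat \<Rightarrow> 'a::idom"
  shows "alt_mat n X A A' t u * omit_mat n Y = mat n n (\<lambda>(i, j).
    A i * (\<Prod>k\<in>{..<n} - {j}. 1 - X i * Y k) + u * A' i * (\<Prod>k\<in>{..<n} - {j}. 1 - t * X i * Y k))"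
proof (rule eq_matI)
  fix i j assume ij: "i < dim_row (mat n n (\<lambda>(i, j).
    A i * (\<Prod>k\<in>{..<n} - {j}. 1 - X i * Y k) + u * A' i * (\<Prod>k\<in>{..<n} - {j}. 1 - t * X i * Y k)))"
    "j < dim_col (mat n n (\<lambda>(i, j).
    A i * (\<Prod>k\<in>{..<n} - {j}. 1 - X i * Y k) + u * A' i * (\<Prod>k\<in>{..<n} - {j}. 1 - t * X i * Y k)))"
  then have ij: "i < n" "j < n" by auto
  let ?p = "omit_poly n Y j"
  have "(alt_mat n X A A' t u * omit_mat n Y) $$ (i, j)
    = (\<Sum>m<n. X i ^ (n - Suc m) * (A i + u * t ^ (n - Suc m) * A' i) * poly.coeff ?p (n - Suc m))"
    using ij by (simp add: alt_mat_def omit_mat_def scalar_prod_def atLeast0LessThan)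
  also have "\<dots> = (\<Sum>m<n. A i * (poly.coeff ?p (n - Suc m) * X i ^ (n - Suc m))
      + u * A' i * (poly.coeff ?p (n - Suc m) * (t * X i) ^ (n - Suc m)))"
    by (intro sum.cong) (auto simp: algebra_simps power_mult_distrib)
  also have "\<dots> = A i * poly ?p (X i) + u * A' i * poly ?p (t * X i)"
    using ij by (simp add: poly_as_sum_desc[OF degree_omit_poly] sum.distrib sum_distrib_left)
  finally show "(alt_mat n X A A' t u * omit_mat n Y) $$ (i, j) = mat n n (\<lambda>(i, j).
    A i * (\<Prod>k\<in>{..<n} - {j}. 1 - X i * Y k) + u * A' i * (\<Prod>k\<in>{..<n} - {j}. 1 - t * X i * Y k)) $$ (i, j)"
    using ij by (simp add: poly_omit)
qed (auto simp: alt_mat_def omit_mat_def)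

text \<open>The reciprocal polynomials of the columns of \<open>omit_mat\<close> vanish at all points but one, so that
  \<open>omit_mat\<close> is, up to a diagonal factor, inverse to a Vandermonde matrix.\<close>

lemma det_omit_mat_nonzero:
  fixes X :: "nat \<Rightarrow> 'a::idom"
  assumes "inj_on X {..<n}"
  shows "det (omit_mat n X) \<noteq> 0"
proof -
  let ?R = "mat n n (\<lambda>(i, m). X i ^ m)"
  have desc: "(\<Sum>m<n. poly.coeff (omit_poly n X j) (n - Suc m) * x ^ m) = (\<Prod>k\<in>{..<n} - {j}. x - X k)"
    if j: "j < n" for j x
  proof -
    \<comment> \<open>Reading coefficients backwards turns \<Prod>(1 - x X_k) into \<Prod>(x - X_k).
      The degree bound is carried along because the next step needs the coefficient beyond
      \<open>card A\<close> to vanish.\<close>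
    have aux: "(\<Sum>m\<le>card A. poly.coeff (\<Prod>k\<in>A. [:1, - X k:]) (card A - m) * x ^ m) = (\<Prod>k\<in>A. x - X k)
        \<and> degree (\<Prod>k\<in>A. [:1, - X k:]) \<le> card A"
      if "finite A" for A
      using that
    proof (induction A rule: finite_induct)
      case empty
      then show ?case by simp
    next
      case (insert a A)
      let ?p = "\<Prod>k\<in>A. [:1, - X k:]" and ?c = "card A"
      have d: "degree ?p \<le> ?c" using insert by simp
      have co: "poly.coeff ([:1, - X a:] * ?p) r = poly.coeff ?p r - X a * (if r = 0 then 0 else poly.coeff ?p (r - 1))"
        for r by (cases r) (simp_all add: mult_pCons_left)
      have "(\<Sum>m\<le>Suc ?c. poly.coeff ([:1, - X a:] * ?p) (Suc ?c - m) * x ^ m)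
        = (\<Sum>m\<le>Suc ?c. poly.coeff ?p (Suc ?c - m) * x ^ m)
        - X a * (\<Sum>m\<le>Suc ?c. (if Suc ?c - m = 0 then 0 else poly.coeff ?p (Suc ?c - m - 1)) * x ^ m)"
        unfolding co by (simp add: algebra_simps sum_subtractf sum_distrib_left)
      also have "(\<Sum>m\<le>Suc ?c. poly.coeff ?p (Suc ?c - m) * x ^ m) = x * (\<Prod>k\<in>A. x - X k)"
      proof -
        have IH: "(\<Sum>m\<le>?c. poly.coeff ?p (?c - m) * x ^ m) = (\<Prod>k\<in>A. x - X k)"
          using insert.IH by blast
        have "poly.coeff ?p (Suc ?c) = 0" using d by (simp add: coeff_eq_0)
        then have "(\<Sum>m\<le>Suc ?c. poly.coeff ?p (Suc ?c - m) * x ^ m)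
            = (\<Sum>m\<le>?c. poly.coeff ?p (?c - m) * x ^ Suc m)"
          unfolding sum.atMost_Suc_shift by simp
        also have "\<dots> = x * (\<Sum>m\<le>?c. poly.coeff ?p (?c - m) * x ^ m)"
          unfolding sum_distrib_left by (intro sum.cong) auto
        finally show ?thesis unfolding IH .
      qed
      also have "(\<Sum>m\<le>Suc ?c. (if Suc ?c - m = 0 then 0 else poly.coeff ?p (Suc ?c - m - 1)) * x ^ m)
          = (\<Sum>m\<le>?c. poly.coeff ?p (?c - m) * x ^ m)"
        by (simp add: Suc_diff_le)
      finally have "(\<Sum>m\<le>Suc ?c. poly.coeff ([:1, - X a:] * ?p) (Suc ?c - m) * x ^ m)
        = (x - X a) * (\<Prod>k\<in>A. x - X k)" using insert.IH by (simp add: left_diff_distrib)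
      moreover have "degree ([:1, - X a:] * ?p) \<le> Suc ?c"
        using d degree_mult_le[of "[:1, - X a:]" ?p] degree_linear_le[of 1 "- X a"] by linarith
      ultimately show ?case
        using insert by (simp del: mult_pCons_left)
    qed
    obtain n' where n': "n = Suc n'" using j by (cases n) auto
    have "card ({..<n} - {j}) = n'" using j n' by simp
    then show ?thesis
      using aux[of "{..<n} - {j}"] by (simp add: omit_poly_def n' lessThan_Suc_atMost)
  qed
  have "?R * omit_mat n X = mat n n (\<lambda>(i, j). if i = j then \<Prod>k\<in>{..<n} - {j}. X j - X k else 0)"
  proof (rule eq_matI)
    fix i j
    assume "i < dim_row (mat n n (\<lambda>(i, j). if i = j then \<Prod>k\<in>{..<n} - {j}. X j - X k else 0))"
      "j < dim_col (mat n n (\<lambda>(i, j). if i = j then \<Prod>k\<in>{..<n} - {j}. X j - X k else 0))"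
    then have ij: "i < n" "j < n" by auto
    have "(?R * omit_mat n X) $$ (i, j) = (\<Prod>k\<in>{..<n} - {j}. X i - X k)"
      using ij desc[OF ij(2), of "X i"]
      by (simp add: omit_mat_def scalar_prod_def atLeast0LessThan mult.commute)
    also have "\<dots> = (if i = j then \<Prod>k\<in>{..<n} - {j}. X j - X k else 0)"
      using ij by auto
    finally show "(?R * omit_mat n X) $$ (i, j) =
        mat n n (\<lambda>(i, j). if i = j then \<Prod>k\<in>{..<n} - {j}. X j - X k else 0) $$ (i, j)"
      using ij by simp
  qed (auto simp: omit_mat_def)
  moreover have "det (mat n n (\<lambda>(i, j). if i = j then \<Prod>k\<in>{..<n} - {j}. X j - X k else 0))
     = (\<Prod>j<n. \<Prod>k\<in>{..<n} - {j}. X j - X k)" (is "det ?D = _")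
  proof -
    have "det ?D = prod_list (diag_mat ?D)"
      by (rule det_upper_triangular[of _ n]) auto
    also have "\<dots> = (\<Prod>j<n. \<Prod>k\<in>{..<n} - {j}. X j - X k)"
      by (simp add: prod_list_diag_prod atLeast0LessThan)
    finally show ?thesis .
  qed
  moreover have "(\<Prod>j<n. \<Prod>k\<in>{..<n} - {j}. X j - X k) \<noteq> 0"
    using assms by (auto simp: inj_on_def)
  moreover have "det (?R * omit_mat n X) = det ?R * det (omit_mat n X)"
    by (rule det_mult[of _ n]) auto
  ultimately show ?thesis by auto
qed

lemma det_scale_rows_cols:
  fixes a :: "nat \<Rightarrow> 'a::comm_ring_1"
  shows "det (mat n n (\<lambda>(i, j). a i * c i j * b j)) = (\<Prod>i<n. a i) * (\<Prod>j<n. b j) * det (mat n n (\<lambda>(i, j). c i j))"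
proof -
  have "(\<Prod>i = 0..<n. a i * c i (p i) * b (p i)) = (\<Prod>i<n. a i) * (\<Prod>j<n. b j) * (\<Prod>i = 0..<n. c i (p i))"
    if "p permutes {0..<n}" for p
    using prod.permute[OF that, of b] by (simp add: prod.distrib atLeast0LessThan algebra_simps)
  moreover have "p i < n" if "p permutes {0..<n}" "i < n" for p i
    using that permutes_in_image[OF that(1), of i] by simp
  ultimately show ?thesis
    by (auto simp: det_def sum_distrib_left algebra_simps intro!: sum.cong)
qed

lemma det_transposed: "det (mat n n (\<lambda>(i, j). c j i)) = det (mat n n (\<lambda>(i, j). c i j))"
proof -
  have "mat n n (\<lambda>(i, j). c j i) = transpose_mat (mat n n (\<lambda>(i, j). c i j))"
    by (rule eq_matI) auto
  then show ?thesis by (simp add: det_transpose[of _ n])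
qed

text \<open>\<open>r\<close> and \<open>s\<close> play 1/(1 - X_i Y_j) and 1/(1 - t X_i Y_j), and
  \<open>Psi'\<close> plays \<Psi>(q X_i Y_j). Stated as equations they need neither division nor
  infinite products, and the setting stays symmetric in \<open>X\<close> and
  \<open>Y\<close>.\<close>

locale cauchy_kernel =
  fixes n :: nat and X Y :: "nat \<Rightarrow> 'a::idom" and t :: 'a and Psi Psi' r s :: "nat \<Rightarrow> nat \<Rightarrow> 'a"
  assumes r: "\<And>i j. i < n \<Longrightarrow> j < n \<Longrightarrow> r i j * (1 - X i * Y j) = 1"
    and s: "\<And>i j. i < n \<Longrightarrow> j < n \<Longrightarrow> s i j * (1 - t * X i * Y j) = 1"
    and Psi': "\<And>i j. i < n \<Longrightarrow> j < n \<Longrightarrow> Psi' i j * (1 - t * X i * Y j) = Psi i j * (1 - X i * Y j)"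
    and injX: "inj_on X {..<n}" and injY: "inj_on Y {..<n}"
begin

abbreviation "N u \<equiv> alt_mat n X (\<lambda>i. \<Prod>j<n. Psi i j) (\<lambda>i. \<Prod>j<n. Psi' i j) t u"

text \<open>Completing the product that omits \<open>j\<close> costs the factor \<open>r i j\<close>
  in the first summand and \<open>s i j\<close> in the second. By the functional equation of \<Psi>
  both summands then share the same row factor \<open>?a i\<close>, which leaves the
  determinant.\<close>

lemma det_alt_mat_omit:
  "det (N u) * det (omit_mat n Y) =
     (\<Prod>i<n. \<Prod>j<n. Psi i j * (1 - X i * Y j)) * det (mat n n (\<lambda>(i, j). r i j + u * s i j))"
proof -
  let ?a = "\<lambda>i. \<Prod>j<n. Psi i j * (1 - X i * Y j)"
  have omit: "(\<Prod>k\<in>{..<n} - {j}. f k) = (\<Prod>k<n. f k) * g" if "j < n" "g * f j = 1" for f :: "nat \<Rightarrow> 'a" and g j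
    using prod.remove[of "{..<n}" j f] that by (simp add: algebra_simps)
  have "N u * omit_mat n Y = mat n n (\<lambda>(i, j). ?a i * (r i j + u * s i j) * 1)"
    unfolding mult_omit_mat
  proof (rule cong_mat, simp_all, goal_cases)
    case (1 i j)
    have "(\<Prod>j<n. Psi' i j) * (\<Prod>k<n. 1 - t * X i * Y k) = ?a i"
      unfolding prod.distrib [symmetric] using 1 by (intro prod.cong) (auto simp: Psi')
    moreover have "(\<Prod>j<n. Psi i j) * (\<Prod>k<n. 1 - X i * Y k) = ?a i"
      by (simp add: prod.distrib)
    ultimately show ?case
      unfolding omit[of j "r i j" "\<lambda>k. 1 - X i * Y k", OF 1(2) r[OF 1]]
        omit[of j "s i j" "\<lambda>k. 1 - t * X i * Y k", OF 1(2) s[OF 1]]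
      by (simp add: algebra_simps)
  qed
  then have "det (N u * omit_mat n Y) = (\<Prod>i<n. ?a i) * det (mat n n (\<lambda>(i, j). r i j + u * s i j))"
    by (simp only: det_scale_rows_cols) simp
  then show ?thesis by (simp add: det_mult[of _ n])
qed

lemma flip: "cauchy_kernel n Y X t (\<lambda>i j. Psi j i) (\<lambda>i j. Psi' j i) (\<lambda>i j. r j i) (\<lambda>i j. s j i)"
  by unfold_locales (simp_all only: mult.assoc mult.commute[of "Y _" "X _"] r [unfolded mult.assoc] s [unfolded mult.assoc] Psi' [unfolded mult.assoc] injX injY)

text \<open>The instance t = 1, \<Psi> = \<Psi>' = 1, u = 0 of the same identity, where
  \<open>r\<close> serves as both inverses.\<close>

lemma det_vandermonde_omit:
  "det (vandermonde n X) * det (omit_mat n Y) =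
     (\<Prod>i<n. \<Prod>j<n. 1 - X i * Y j) * det (mat n n (\<lambda>(i, j). r i j))"
proof -
  interpret one: cauchy_kernel n X Y 1 "\<lambda>_ _. 1" "\<lambda>_ _. 1" r r
    by unfold_locales (use r injX injY in auto)
  have "vandermonde n X = one.N 0"
    by (simp add: vandermonde_def alt_mat_def)
  then show ?thesis using one.det_alt_mat_omit[of 0] by simp
qed

text \<open>After multiplication by the \<open>omit_mat\<close> of the other alphabet, both
  determinants become one expression symmetric in the alphabets. The Vandermonde determinants
  satisfy the same relation, so the factors from \<open>omit_mat\<close> cancel crosswise.\<close>

theorem det_alt_mat_symmetric:
  "det (N u) * det (vandermonde n Y) =
   det (alt_mat n Y (\<lambda>j. \<Prod>i<n. Psi i j) (\<lambda>j. \<Prod>i<n. Psi' i j) t u) * det (vandermonde n X)"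
proof -
  interpret fl: cauchy_kernel n Y X t "\<lambda>i j. Psi j i" "\<lambda>i j. Psi' j i" "\<lambda>i j. r j i" "\<lambda>i j. s j i"
    by (rule flip)
  have swap: "(\<Prod>j<n. \<Prod>i<n. f i j) = (\<Prod>i<n. \<Prod>j<n. f i j)" for f :: "nat \<Rightarrow> nat \<Rightarrow> 'a"
    by (rule prod.swap)
  have A: "det (N u) * det (omit_mat n Y) = det (fl.N u) * det (omit_mat n X)"
    unfolding det_alt_mat_omit fl.det_alt_mat_omit
    unfolding det_transposed[of n "\<lambda>i j. r i j + u * s i j"] by (subst (2) swap) (simp only: mult.commute[of "Y _" "X _"])
  have B: "det (vandermonde n X) * det (omit_mat n Y) = det (vandermonde n Y) * det (omit_mat n X)"
    unfolding det_vandermonde_omit fl.det_vandermonde_omit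
    unfolding det_transposed[of n r] by (subst (2) swap) (simp only: mult.commute[of "Y _" "X _"])
  have "(det (N u) * det (vandermonde n Y)) * det (omit_mat n X)
     = (det (fl.N u) * det (vandermonde n X)) * det (omit_mat n X)"
    using arg_cong[OF A, of "\<lambda>x. x * det (vandermonde n X)"] arg_cong[OF B, of "\<lambda>x. x * det (N u)"]
    by (simp only: mult_ac)
  then show ?thesis using det_omit_mat_nonzero[OF injX] by simp
qed

text \<open>The prefactor z = X_i Y_j in the identity between 1/(1 - z) and 1/(1 - t z) splits
  between row \<open>i\<close> and column \<open>j\<close>, so the identity passes from the entries
  to the determinant.\<close>

theorem det_alt_mat_shift:
  "det (N (- 1)) = (\<Prod>i<n. X i) * (\<Prod>j<n. Y j) * det (N (- t))"
proof -
  have "r i j - s i j = X i * (r i j - t * s i j) * Y j" if "i < n" "j < n" for i j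
  proof -
    have "r i j - s i j = r i j * (s i j * (1 - t * X i * Y j)) - s i j * (r i j * (1 - X i * Y j))"
      unfolding r[OF that] s[OF that] by (simp only: mult_1_right)
    also have "\<dots> = X i * Y j * (r i j * (s i j * (1 - t * X i * Y j)) - t * s i j * (r i j * (1 - X i * Y j)))"
      by (simp add: algebra_simps)
    also have "\<dots> = X i * Y j * (r i j - t * s i j)"
      unfolding r[OF that] s[OF that] by (simp only: mult_1_right)
    finally show ?thesis by (simp only: mult_ac)
  qed
  then have "mat n n (\<lambda>(i, j). r i j + - 1 * s i j) = mat n n (\<lambda>(i, j). X i * (r i j + - t * s i j) * Y j)"
    by (intro cong_mat) (simp_all only: prod.case mult_minus_left mult_1_left add_uminus_conv_diff)
  then have "det (mat n n (\<lambda>(i, j). r i j + - 1 * s i j)) =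
      det (mat n n (\<lambda>(i, j). X i * (r i j + - t * s i j) * Y j))"
    by (rule arg_cong)
  also have "\<dots> = (\<Prod>i<n. X i) * (\<Prod>j<n. Y j) * det (mat n n (\<lambda>(i, j). r i j + - t * s i j))"
    by (rule det_scale_rows_cols)
  finally have "det (N (- 1)) * det (omit_mat n Y) = ((\<Prod>i<n. X i) * (\<Prod>j<n. Y j) * det (N (- t))) * det (omit_mat n Y)"
    unfolding mult.assoc det_alt_mat_omit by (simp only: mult.left_commute)
  then show ?thesis using det_omit_mat_nonzero[OF injY] mult_right_cancel by blast
qed

end

section \<open>The series \<open>\<Psi>\<close> and the functions \<open>g\<^sub>r\<close>\<close>

lemma to_fract_eq_iff: "to_fract a = to_fract b \<longleftrightarrow> a = b"
  by (simp add: to_fract_def eq_fract)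

text \<open>Reduces the comparison of monomials in q and t to their exponents. The nonvanishing of 1
  - q^k and 1 - t^k and the separation of the eigenvalues rest on it.\<close>

lemma qt_monom: "qpar ^ a * tpar ^ b = to_fract (Polynomial.monom (Polynomial.monom 1 a) b)"
proof -
  have "[:[:0, 1:]:] ^ a = [:[:0, 1 :: rat:] ^ a:]"
    by (simp add: poly_const_pow)
  then have "[:[:0, 1:]:] ^ a * [:0, 1:] ^ b = Polynomial.monom (Polynomial.monom (1::rat) a) b"
    by (simp add: monom_altdef)
  then show ?thesis
    unfolding qpar_def tpar_def to_fract_power [symmetric] by (metis to_fract_mult)
qed

lemma qt_monom_eq_iff: "qpar ^ a * tpar ^ b = qpar ^ c * tpar ^ d \<longleftrightarrow> a = c \<and> b = d"
  unfolding qt_monom to_fract_eq_iff by (auto simp: monom_eq_iff')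

lemma qt_monom_eq_1_iff: "qpar ^ a * tpar ^ b = 1 \<longleftrightarrow> a = 0 \<and> b = 0"
  using qt_monom_eq_iff[of a b 0 0] by simp

lemma qpar_power_neq_1: "k > 0 \<Longrightarrow> qpar ^ k \<noteq> 1"
  using qt_monom_eq_1_iff[of k 0] by simp

lemma tpar_power_neq_1: "k > 0 \<Longrightarrow> tpar ^ k \<noteq> 1"
  using qt_monom_eq_1_iff[of 0 k] by simp

definition fps_scale :: "'a::comm_ring_1 \<Rightarrow> 'a fps \<Rightarrow> 'a fps" where
  "fps_scale c f = Abs_fps (\<lambda>r. c ^ r * fps_nth f r)"

lemma fps_scale_nth [simp]: "fps_nth (fps_scale c f) r = c ^ r * fps_nth f r"
  by (simp add: fps_scale_def)

lemma fps_scale_mult: "fps_scale c (f * g) = fps_scale c f * fps_scale c g"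
proof (rule fps_ext)
  fix r
  show "fps_nth (fps_scale c (f * g)) r = fps_nth (fps_scale c f * fps_scale c g) r"
    unfolding fps_scale_nth fps_mult_nth sum_distrib_left
  proof (rule sum.cong[OF refl])
    fix i assume "i \<in> {0..r}"
    then have "c ^ r = c ^ i * c ^ (r - i)" by (simp flip: power_add)
    then show "c ^ r * (fps_nth f i * fps_nth g (r - i)) =
        c ^ i * fps_nth f i * (c ^ (r - i) * fps_nth g (r - i))" by (simp only: mult_ac)
  qed
qed

lemma fps_scale_1: "fps_scale c 1 = 1"
  by (rule fps_ext) simp

lemma fps_scale_prod: "fps_scale c (prod f A) = (\<Prod>a\<in>A. fps_scale c (f a))"
  by (induction A rule: infinite_finite_induct) (simp_all add: fps_scale_1 fps_scale_mult)

lemma fps_scale_diff: "fps_scale c (f - g) = fps_scale c f - fps_scale c g"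
  by (rule fps_ext) (simp add: algebra_simps)

lemma euler_scale: "euler (fps_scale c f) = fps_scale c (euler f)"
  by (rule fps_ext) (simp add: algebra_simps)

lemma euler_diff: "euler (f - g) = euler f - euler g"
  by (rule fps_ext) (simp add: algebra_simps)

lemma euler_X: "euler fps_X = fps_X"
  by (rule fps_ext) simp

lemma euler_const: "euler (fps_const c) = 0"
  by (rule fps_ext) simp

lemma euler_1: "euler 1 = 0"
  by (rule fps_ext) simp

lemma fps_at_scale: "fps_at i (fps_scale c f) = fps_scale (cst c) (fps_at i f)"
proof (rule fps_ext)
  fix r
  have "cst c ^ r = cst (c ^ r)" by (rule cst_power [symmetric])
  then show "fps_nth (fps_at i (fps_scale c f)) r = fps_nth (fps_scale (cst c) (fps_at i f)) r"
    by (simp add: cst_def mult_single)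
qed

lemma fps_geometric: "Abs_fps (\<lambda>k. c ^ k) * (1 - fps_const c * fps_X) = (1 :: 'a::comm_ring_1 fps)"
proof (rule fps_ext)
  fix k
  have "Abs_fps (\<lambda>k. c ^ k) * (1 - fps_const c * fps_X) =
      Abs_fps (\<lambda>k. c ^ k) - fps_const c * (Abs_fps (\<lambda>k. c ^ k) * fps_X)"
    by (simp only: right_diff_distrib mult_1_right mult.left_commute)
  then show "fps_nth (Abs_fps (\<lambda>k. c ^ k) * (1 - fps_const c * fps_X)) k = fps_nth 1 k"
    by (cases k) simp_all
qed

text \<open>The factor between p_k[X^tq] and p_k[X].\<close>

definition pw :: "nat \<Rightarrow> qt_field" where
  "pw k = (tpar ^ k - 1) / (qpar ^ k - 1)"

definition pw_fps :: "qt_field fps" where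
  "pw_fps = Abs_fps (\<lambda>k. if k = 0 then 0 else pw k)"

text \<open>\<open>\<Psi>(z) = (t z; q)\<^sub>\<infinity> / (z; q)\<^sub>\<infinity>\<close>, characterized by \<open>\<Psi>(q z) (1 - t z) = \<Psi>(z) (1 - z)\<close>.\<close>

primrec psi :: "nat \<Rightarrow> qt_field" where
  "psi 0 = 1"
| "psi (Suc r) = psi r * (1 - tpar * qpar ^ r) / (1 - qpar ^ Suc r)"

definition Psi :: "qt_field fps" where "Psi = Abs_fps psi"

text \<open>Coefficient by coefficient this is the two-term recursion defining
  \<open>psi\<close>.\<close>

lemma Psi_scale: "fps_scale qpar Psi * (1 - fps_const tpar * fps_X) = Psi * (1 - fps_X)"
proof (rule fps_ext)
  fix r
  have *: "qpar ^ Suc k * psi (Suc k) - tpar * (qpar ^ k * psi k) = psi (Suc k) - psi k" for k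
  proof -
    have "(1 - qpar ^ Suc k) * psi (Suc k) = psi k * (1 - tpar * qpar ^ k)"
    proof -
      have "1 - qpar ^ Suc k \<noteq> 0" using qpar_power_neq_1[of "Suc k"] by simp
      then show ?thesis unfolding psi.simps by (metis nonzero_mult_div_cancel_left times_divide_eq_right)
    qed
    moreover have "(qpar ^ Suc k * psi (Suc k) - tpar * (qpar ^ k * psi k)) - (psi (Suc k) - psi k) =
        psi k * (1 - tpar * qpar ^ k) - (1 - qpar ^ Suc k) * psi (Suc k)"
      by (simp only: algebra_simps)
    ultimately show ?thesis by simp
  qed
  have l: "fps_scale qpar Psi * (1 - fps_const tpar * fps_X) =
      fps_scale qpar Psi - fps_const tpar * (fps_scale qpar Psi * fps_X)"
    by (simp add: algebra_simps)
  have r: "Psi * (1 - fps_X) = Psi - Psi * fps_X"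
    by (simp add: algebra_simps)
  show "fps_nth (fps_scale qpar Psi * (1 - fps_const tpar * fps_X)) r = fps_nth (Psi * (1 - fps_X)) r"
    unfolding l r using *[of "r - 1"] by (cases r) (simp_all add: Psi_def del: psi.simps(2))
qed

text \<open>Elimination for \<open>euler_Psi\<close>, with x = z, y = t z, the letters
  \<open>e\<close>, \<open>p\<close>, \<open>l\<close> for euler \<Psi>, \<Psi>, the candidate
  logarithmic derivative, and the prefix \<open>s\<close> for z -> q z: the defect e - p l obeys the
  functional equation of \<Psi>, up to one common factor 1 - y.\<close>

lemma log_derivative_step:
  fixes e se p sp l sl x y :: "'a::comm_ring_1"
  assumes "sp * (1 - y) = p * (1 - x)" "se * (1 - y) - y * sp = e * (1 - x) - x * p"
    and "(1 - x) * (1 - y) * (l - sl) = x - y"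
  shows "(se - sp * sl) * (1 - y) * (1 - y) = (e - p * l) * (1 - x) * (1 - y)"
proof -
  have "(se - sp * sl) * (1 - y) * (1 - y) - (e - p * l) * (1 - x) * (1 - y) =
      (1 - y) * ((se * (1 - y) - y * sp) - (e * (1 - x) - x * p)) +
      (y - (1 - y) * sl) * (sp * (1 - y) - p * (1 - x)) +
      p * ((1 - x) * (1 - y) * (l - sl) - (x - y))"
    by (simp add: algebra_simps)
  then show ?thesis using assms by simp
qed

text \<open>The defect W of the claimed equation satisfies W(q z)(1 - t z) = W(z)(1 - z) and has no
  constant term. Inductively (q^r - 1) W_r = 0, so W = 0.\<close>

lemma euler_Psi: "euler Psi = Psi * pw_fps"
proof -
  let ?S = "fps_scale qpar" and ?T = "fps_const tpar :: qt_field fps" and ?X = "fps_X :: qt_field fps"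
  define W where "W = euler Psi - Psi * pw_fps"
  \<comment> \<open>Because (1 - q^k) \<open>pw k\<close> = 1 - t^k, the difference on the left is
    1/(1 - z) - 1/(1 - t z).\<close>
  have L: "(1 - ?X) * (1 - ?T * ?X) * (pw_fps - ?S pw_fps) = ?X - ?T * ?X"
  proof -
    let ?G = "Abs_fps (\<lambda>_. 1) :: qt_field fps" and ?Gt = "Abs_fps (\<lambda>k. tpar ^ k)"
    have geo: "(1 - fps_const c * ?X) * Abs_fps (\<lambda>k. c ^ k) = 1" for c
      by (subst mult.commute) (rule fps_geometric)
    have G: "(1 - ?X) * ?G = 1" using geo[of 1] by simp
    have Gt: "(1 - ?T * ?X) * ?Gt = 1" by (rule geo)
    have "pw k - qpar ^ k * pw k = 1 - tpar ^ k" if "k > 0" for k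
    proof -
      have "pw k - qpar ^ k * pw k = (1 - qpar ^ k) * pw k" by (simp add: algebra_simps)
      also have "\<dots> = 1 - tpar ^ k"
        using qpar_power_neq_1[OF that] by (simp add: pw_def divide_simps) (simp add: algebra_simps)
      finally show ?thesis .
    qed
    then have "pw_fps - ?S pw_fps = ?G - ?Gt"
      by (intro fps_ext) (simp add: pw_fps_def)
    moreover have "(1 - x) * (1 - y) * (g - h) = (1 - y) * ((1 - x) * g) - (1 - x) * ((1 - y) * h)"
      for x y g h :: "qt_field fps" by (simp add: algebra_simps)
    ultimately have "(1 - ?X) * (1 - ?T * ?X) * (pw_fps - ?S pw_fps) =
        (1 - ?T * ?X) * ((1 - ?X) * ?G) - (1 - ?X) * ((1 - ?T * ?X) * ?Gt)"
      by (simp only:)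
    also have "\<dots> = ?X - ?T * ?X" unfolding G Gt by simp
    finally show ?thesis .
  qed
  have E: "?S (euler Psi) * (1 - ?T * ?X) - ?T * ?X * ?S Psi = euler Psi * (1 - ?X) - ?X * Psi"
  proof -
    have e: "euler (f * (1 - g)) = euler f * (1 - g) - g * f" if "euler g = g" for f g :: "qt_field fps"
      using that by (simp add: euler_mult euler_diff euler_1)
    have "euler (?T * ?X) = ?T * ?X" by (simp add: euler_mult euler_X euler_const)
    then show ?thesis
      using arg_cong[OF Psi_scale, of euler] by (simp only: e euler_X euler_scale)
  qed
  have "?S W * (1 - ?T * ?X) * (1 - ?T * ?X) = W * (1 - ?X) * (1 - ?T * ?X)"
    unfolding W_def fps_scale_diff fps_scale_mult by (rule log_derivative_step[OF Psi_scale E L])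
  moreover have "1 - ?T * ?X \<noteq> 0"
  proof
    assume "1 - ?T * ?X = 0"
    then have "fps_nth (1 - ?T * ?X) 0 = 0" by (simp only: fps_zero_nth)
    then show False by simp
  qed
  ultimately have "?S W * (1 - ?T * ?X) = W * (1 - ?X)" by simp
  then have W: "?S W - ?T * (?S W * ?X) = W - W * ?X"
    by (simp only: right_diff_distrib mult_1_right mult.left_commute)
  have "fps_nth W r = 0" for r
  proof (induction r)
    case 0
    then show ?case by (simp add: W_def pw_fps_def)
  next
    case (Suc r)
    have "qpar ^ Suc r * fps_nth W (Suc r) = fps_nth W (Suc r)"
      using arg_cong[OF W, of "\<lambda>f. fps_nth f (Suc r)"] Suc by simp
    then show ?case using qpar_power_neq_1[of "Suc r"] by simp
  qed
  then have "W = 0" by (intro fps_ext) simp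
  then show ?thesis by (simp add: W_def)
qed

section \<open>Product formula for the generating function of the g_r\<close>

definition gsym :: "nat \<Rightarrow> nat \<Rightarrow> xpoly" where
  "gsym n r = pleth (complete_sym (int r)) (Xtq n)"

definition gfps :: "nat \<Rightarrow> xpoly fps" where
  "gfps n = Abs_fps (gsym n)"

lemma Const_eq_cst: "Const c = cst c"
  by (simp add: Const_def cst_def)

lemma hom_Const: "comm_ring_hom Const"
  by unfold_locales (simp_all add: Const_add Const_mult Const_0 Const_1)

interpretation Const: comm_ring_hom Const
  by (rule hom_Const)

definition power_fps :: "nat \<Rightarrow> xpoly fps" where
  "power_fps n = Abs_fps (\<lambda>k. if k = 0 then 0 else (\<Sum>j<n. xvar j ^ k) * Const (pw k))"

lemma gsym_eq: "gsym n r = p_complete (\<lambda>k. (\<Sum>j<n. xvar j ^ Suc k) * Const (pw (Suc k))) r"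
  unfolding gsym_def pleth_complete_sym pw_def by (subst p_pleth_Xtq) auto

lemma euler_gfps: "euler (gfps n) = gfps n * power_fps n"
proof (rule fps_ext)
  fix r
  let ?P = "\<lambda>k. (\<Sum>j<n. xvar j ^ Suc k) * Const (pw (Suc k))"
  have "fps_nth (gfps n * power_fps n) r = (\<Sum>k=0..r. fps_nth (power_fps n) k * gsym n (r - k))"
    by (subst mult.commute) (simp add: fps_mult_nth gfps_def)
  also have "\<dots> = (\<Sum>k<r. ?P k * gsym n (r - Suc k))"
    unfolding atLeast0AtMost
    by (subst sum.atMost_shift) (simp add: power_fps_def)
  also have "\<dots> = of_nat r * gsym n r"
    unfolding gsym_eq p_complete_rec ..
  finally show "fps_nth (euler (gfps n)) r = fps_nth (gfps n * power_fps n) r"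
    by (simp add: gfps_def)
qed

lemma gsym_0: "gsym n 0 = 1"
  unfolding gsym_eq by (simp add: p_complete_def p_weight_eq_0_iff p_prod_def z_factor_def Const_1)

text \<open>Both sides have the logarithmic Euler derivative \<Sum> p_k[X^tq] w^k: the left one by
  Newton's recursion, the right one because logarithmic derivatives add over the factors.\<close>

lemma gfps_eq_prod: "gfps n = (\<Prod>j<n. fps_at j Psi)"
proof (rule euler_unique)
  show "euler (gfps n) = gfps n * power_fps n" by (rule euler_gfps)
  have "euler (\<Prod>j<n. fps_at j Psi) = (\<Prod>j<n. fps_at j Psi) * (\<Sum>j<n. fps_at j pw_fps)"
    by (rule euler_prod) (simp_all add: euler_fps_at euler_Psi fps_at_mult)
  also have "(\<Sum>j<n. fps_at j pw_fps) = power_fps n"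
    by (rule fps_ext) (auto simp: power_fps_def pw_fps_def fps_sum_nth xvar_power Const_def sum_distrib_right mult_single)
  finally show "euler (\<Prod>j<n. fps_at j Psi) = (\<Prod>j<n. fps_at j Psi) * power_fps n" .
  have "fps_nth (\<Prod>j<n. fps_at j Psi) 0 = (\<Prod>j<n. fps_nth (fps_at j Psi) 0)"
    by (induction n) simp_all
  then show "fps_nth (gfps n) 0 = fps_nth (\<Prod>j<n. fps_at j Psi) 0"
    by (simp add: gfps_def gsym_0 Psi_def)
  show "fps_nth (power_fps n) 0 = 0" by (simp add: power_fps_def)
qed

section \<open>Coefficient extraction and partial q-shifts\<close>

lemma poly_mapping_sum_singles: "f = (\<Sum>k\<in>keys f. single k (lookup f k))"
proof (rule poly_mapping_eqI)
  fix k
  have "lookup (\<Sum>k\<in>keys f. single k (lookup f k)) k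
      = (\<Sum>l\<in>keys f. if l = k then lookup f k else 0)"
    unfolding lookup_sum by (intro sum.cong) (auto simp: lookup_single when_def)
  then show "lookup f k =
      lookup (\<Sum>k\<in>keys f. single k (lookup f k)) k"
    by (simp add: in_keys_iff)
qed

lemma lookup_monom_mult:
  fixes f :: "'a::comm_ring_1 mpol"
  shows "lookup (single (mkey n a) c * f) (mkey n \<gamma>) =
    (if \<forall>i<n. a i \<le> \<gamma> i then c * lookup f (mkey n (\<lambda>i. \<gamma> i - a i)) else 0)"
proof -
  let ?L = "lookup f"
  have k: "mkey n a + k = mkey n \<gamma> \<longleftrightarrow> (\<forall>i<n. a i \<le> \<gamma> i) \<and> k = mkey n (\<lambda>i. \<gamma> i - a i)" for k
    by (auto simp: poly_mapping_eq_iff fun_eq_iff lookup_add lookup_mkey split: if_splits)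
  have "single (mkey n a) c * f =
      (\<Sum>k\<in>keys f. single (mkey n a + k) (c * ?L k))"
    by (subst (1) poly_mapping_sum_singles[of f]) (simp add: sum_distrib_left mult_single)
  then have "lookup (single (mkey n a) c * f) (mkey n \<gamma>) =
      (\<Sum>k\<in>keys f. if mkey n a + k = mkey n \<gamma> then c * ?L k else 0)"
    unfolding lookup_sum by (simp add: lookup_sum lookup_single when_def)
  also have "\<dots> = (\<Sum>k\<in>keys f. if k = mkey n (\<lambda>i. \<gamma> i - a i) then
      (if \<forall>i<n. a i \<le> \<gamma> i then c * ?L k else 0) else 0)"
    by (intro sum.cong) (auto simp: k)
  finally show ?thesis by (simp add: in_keys_iff)
qed

lemma prod_xvar: "(\<Prod>i<n. xvar i ^ \<alpha> i) = single (mkey n \<alpha>) 1"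
  by (induction n) (simp_all add: mkey_def mult_single xvar_power)

text \<open>The substitution x_j -> q x_j for j in \<open>J\<close>, carried out on monomials.
  Macdonald's operator in the x_j is a combination of these over all subsets
  \<open>J\<close>.\<close>

definition qshift :: "nat set \<Rightarrow> xpoly \<Rightarrow> xpoly" where
  "qshift J f = (\<Sum>e\<in>keys f. single e
     (qpar ^ (\<Sum>j\<in>J. lookup e j) * lookup f e))"

lemma lookup_qshift:
  "lookup (qshift J f) e = qpar ^ (\<Sum>j\<in>J. lookup e j) * lookup f e"
proof -
  have "lookup (qshift J f) e = (\<Sum>k\<in>keys f.
      if k = e then qpar ^ (\<Sum>j\<in>J. lookup e j) * lookup f e else 0)"
    unfolding qshift_def lookup_sum by (intro sum.cong) (auto simp: lookup_single when_def)
  then show ?thesis by (simp add: in_keys_iff)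
qed

lemma qshift_sum: "qshift J (sum f A) = (\<Sum>a\<in>A. qshift J (f a))"
  by (rule poly_mapping_eqI) (simp add: lookup_qshift lookup_sum sum_distrib_left)

lemma qshift_single: "qshift J (single e c) =
    single e (qpar ^ (\<Sum>j\<in>J. lookup e j) * c)"
  by (rule poly_mapping_eqI) (simp add: lookup_qshift lookup_single when_def)

lemma qshift_mult: "qshift J (f * g) = qshift J f * qshift J g"
proof -
  let ?s = "\<lambda>f k. single k (lookup f k)"
  have s: "qshift J (single e c * single e' c') =
      qshift J (single e c) * qshift J (single e' c')" for e c e' c'
    by (simp add: qshift_single mult_single lookup_add sum.distrib power_add mult_ac)
  have "qshift J (f * g) = (\<Sum>k\<in>keys f. \<Sum>l\<in>keys g. qshift J (?s f k * ?s g l))"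
    by (subst (1) poly_mapping_sum_singles[of f], subst (1) poly_mapping_sum_singles[of g])
      (simp only: sum_product qshift_sum)
  also have "\<dots> = qshift J (\<Sum>k\<in>keys f. ?s f k) * qshift J (\<Sum>l\<in>keys g. ?s g l)"
    unfolding s qshift_sum sum_product ..
  finally show ?thesis by (simp only: poly_mapping_sum_singles [symmetric])
qed

lemma qshift_1: "qshift J 1 = 1"
  using qshift_single[of J 0 1] by simp

lemma qshift_prod: "qshift J (prod f A) = (\<Prod>a\<in>A. qshift J (f a))"
  by (induction A rule: infinite_finite_induct) (simp_all add: qshift_1 qshift_mult)

definition qshift_fps :: "nat set \<Rightarrow> xpoly fps \<Rightarrow> xpoly fps" where
  "qshift_fps J F = Abs_fps (\<lambda>r. qshift J (fps_nth F r))"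

lemma qshift_fps_mult: "qshift_fps J (F * G) = qshift_fps J F * qshift_fps J G"
  by (rule fps_ext) (simp add: qshift_fps_def fps_mult_nth qshift_sum qshift_mult)

lemma qshift_fps_1: "qshift_fps J 1 = 1"
  by (rule fps_ext) (simp add: qshift_fps_def qshift_1 qshift_single[of J 0 0, simplified])

lemma qshift_fps_prod: "qshift_fps J (prod f A) = (\<Prod>a\<in>A. qshift_fps J (f a))"
  by (induction A rule: infinite_finite_induct) (simp_all add: qshift_fps_1 qshift_fps_mult)

lemma qshift_gfps:
  assumes "J \<subseteq> {..<n}"
  shows "qshift_fps J (gfps n) = (\<Prod>j<n. fps_at j (if j \<in> J then fps_scale qpar Psi else Psi))"
proof -
  have "finite J" using assms finite_subset by blast
  then have "(\<Sum>l\<in>J. lookup (single j r) l) = (if j \<in> J then r else 0)" for j and r :: nat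
    by (simp add: lookup_single when_def)
  then have "qshift_fps J (fps_at j Psi) = fps_at j (if j \<in> J then fps_scale qpar Psi else Psi)" for j
    by (intro fps_ext) (simp add: qshift_fps_def qshift_single)
  then show ?thesis unfolding gfps_eq_prod qshift_fps_prod by simp
qed

section \<open>The kernel\<close>

text \<open>One alphabet, the \<open>z\<^sub>i\<close>, enters through \<open>fps_at\<close>; the other one, the \<open>x\<^sub>j\<close>, lives in the coefficients.\<close>

type_synonym kernel_ring = "xpoly mpol fps"

definition embed :: "xpoly \<Rightarrow> kernel_ring" where "embed c = fps_const (cst c)"

lemma embed_hom: "embed (a + b) = embed a + embed b" "embed (a * b) = embed a * embed b"
  "embed 0 = 0" "embed 1 = 1" "embed (- a) = - embed a" "embed (a - b) = embed a - embed b"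
  by (simp_all add: embed_def cst_hom fps_const_add[symmetric] fps_const_mult[symmetric]
      fps_const_neg[symmetric] fps_const_sub[symmetric] del: fps_const_add fps_const_mult fps_const_neg fps_const_sub)

interpretation embed: comm_ring_hom embed
  by unfold_locales (simp_all add: embed_hom)

lemma lookup_embed_mult:
  "lookup (fps_nth (embed c * F) d) e = c * lookup (fps_nth F d) e"
  by (simp add: embed_def lookup_cst_mult)

lemma embed_eq_at: "embed c = fps_at i (fps_const c)"
  by (simp add: embed_def fps_at_const)

lemma lookup_signed:
  fixes F :: "'a::comm_ring_1 mpol fps"
  shows "lookup (fps_nth (of_int (sign p) * F) d) e = of_int (sign p) * lookup (fps_nth F d) e"
  by (simp add: sign_def)

lemma lookup_signed': "lookup (of_int (sign p) * (f :: 'a::comm_ring_1 mpol)) e = of_int (sign p) * lookup f e"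
  by (simp add: sign_def)

definition kX :: "nat \<Rightarrow> kernel_ring" where "kX i = fps_at i fps_X"
definition kY :: "nat \<Rightarrow> kernel_ring" where "kY j = embed (xvar j)"
definition kPsi :: "nat \<Rightarrow> nat \<Rightarrow> kernel_ring" where "kPsi i j = fps_at i (fps_at j Psi)"
definition kPsi' :: "nat \<Rightarrow> nat \<Rightarrow> kernel_ring" where
  "kPsi' i j = fps_at i (fps_at j (fps_scale qpar Psi))"
definition kgeo :: "qt_field \<Rightarrow> nat \<Rightarrow> nat \<Rightarrow> kernel_ring" where
  "kgeo c i j = fps_at i (fps_at j (Abs_fps (\<lambda>r. c ^ r)))"

abbreviation kt :: kernel_ring where "kt \<equiv> embed (Const tpar)"

lemma kXY: "kX i * kY j = fps_at i (fps_at j fps_X)"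
proof -
  have "fps_at j fps_X = fps_X * fps_const (xvar j)"
  proof (rule fps_ext)
    fix r show "fps_nth (fps_at j fps_X) r = fps_nth (fps_X * fps_const (xvar j)) r"
      by (cases "r = 1") (auto simp: xvar_def fps_X_nth)
  qed
  then show ?thesis by (simp add: kX_def kY_def embed_eq_at[of _ i] fps_at_mult)
qed

lemma ktXY: "kt * kX i * kY j = fps_at i (fps_at j (fps_const tpar * fps_X))"
  by (simp add: mult.assoc kXY embed_eq_at[of _ i] fps_at_mult fps_at_const Const_eq_cst)

lemma inj_xvar: "inj_on xvar A"
proof (rule inj_onI)
  fix i j assume "xvar i = xvar j"
  moreover have "(1 :: qt_field) \<noteq> 0" by (rule one_neq_zero)
  ultimately have "single i (1::nat) = single j 1"
    unfolding xvar_def by (metis keys_single singleton_inject)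
  then show "i = j" by (metis keys_single singleton_inject one_neq_zero)
qed

interpretation kernel: cauchy_kernel n kX kY kt kPsi kPsi' "kgeo 1" "kgeo tpar" for n
proof
  fix i j
  have X: "1 - kX i * kY j = fps_at i (fps_at j (1 - fps_const 1 * fps_X))"
    by (simp add: kXY fps_at_diff fps_at_1)
  have T: "1 - kt * kX i * kY j = fps_at i (fps_at j (1 - fps_const tpar * fps_X))"
    by (simp only: ktXY fps_at_diff fps_at_1)
  show "kgeo 1 i j * (1 - kX i * kY j) = 1"
    unfolding X kgeo_def fps_at_mult [symmetric] fps_geometric fps_at_1 ..
  show "kgeo tpar i j * (1 - kt * kX i * kY j) = 1"
    unfolding T kgeo_def fps_at_mult [symmetric] fps_geometric fps_at_1 ..
  show "kPsi' i j * (1 - kt * kX i * kY j) = kPsi i j * (1 - kX i * kY j)"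
    unfolding T X kPsi_def kPsi'_def fps_at_mult [symmetric] Psi_scale by simp
next
  show "inj_on kX {..<n}"
  proof (rule inj_onI)
    fix i j assume "kX i = kX j"
    then have "fps_nth (kX i) 1 = fps_nth (kX j) 1" by simp
    then have "keys (single (single i (Suc 0)) (1::xpoly)) =
      keys (single (single j (Suc 0)) (1::xpoly))"
      by (simp add: kX_def)
    then have "keys (single i (Suc 0)) = keys (single j (Suc 0))"
      by simp
    then show "i = j" by simp
  qed
  show "inj_on kY {..<n}"
  proof (rule inj_onI)
    fix i j assume "kY i = kY j"
    then have "lookup (fps_nth (kY i) 0) 0 = lookup (fps_nth (kY j) 0) 0" by simp
    then have "xvar i = xvar j" by (simp add: kY_def embed_def cst_def)
    then show "i = j" using inj_xvar[of UNIV] by (simp add: inj_on_def)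
  qed
qed

section \<open>The kernel determinant and its coefficients in the z_i\<close>

lemma det_permutes: "det (mat n n f) = (\<Sum>p | p permutes {..<n}. of_int (sign p) * (\<Prod>i<n. f (i, p i)))"
proof -
  have "p i < n" if "p permutes {..<n}" "i < n" for p i
    using that permutes_in_image[OF that(1), of i] by simp
  then show ?thesis
    unfolding det_def by (auto simp: atLeast0LessThan intro!: sum.cong prod.cong)
qed

text \<open>\<open>desc n p i\<close> is the exponent of the \<open>i\<close>-th variable in the term of \<open>p\<close> in the Vandermonde determinant. Below,
  \<open>\<beta> i - desc n p i\<close> is a truncated subtraction, meaningful only if \<open>fits n p \<beta>\<close>.\<close>

abbreviation "desc n p i \<equiv> n - Suc (p i)"

definition fits :: "nat \<Rightarrow> (nat \<Rightarrow> nat) \<Rightarrow> (nat \<Rightarrow> nat) \<Rightarrow> bool" where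
  "fits n p \<beta> \<longleftrightarrow> (\<forall>i<n. desc n p i \<le> \<beta> i)"

text \<open>With g the generating series of the g_r, this is z^m (g(z) + u t^m g(q z)), the entry of
  the kernel matrix as a series in the variable of its row.\<close>

definition krow :: "nat \<Rightarrow> qt_field \<Rightarrow> nat \<Rightarrow> xpoly fps" where
  "krow n u m = fps_X ^ m * (gfps n + fps_const (Const (u * tpar ^ m)) * fps_scale (Const qpar) (gfps n))"

lemma krow_nth: "fps_nth (krow n u m) r =
    (if r < m then 0 else Const (1 + u * tpar ^ m * qpar ^ (r - m)) * gsym n (r - m))"
  unfolding krow_def fps_X_power_mult_nth
  by (simp add: gfps_def Const_add Const_1 Const_mult Const.hom_power distrib_right mult.assoc)

text \<open>The coefficient of z^\<beta> in the kernel determinant. For u = 0 and \<beta> =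
  \<open>stair n \<mu>\<close> it is the Jacobi-Trudi determinant of S_\<mu>[X^tq]; for other u it
  plays the image of that function under D(u).\<close>

definition gdet :: "nat \<Rightarrow> qt_field \<Rightarrow> (nat \<Rightarrow> nat) \<Rightarrow> xpoly" where
  "gdet n u \<beta> = (\<Sum>p | p permutes {..<n}. of_int (sign p) * (\<Prod>i<n. fps_nth (krow n u (desc n p i)) (\<beta> i)))"

lemma kPsi_prod: "(\<Prod>j<n. kPsi i j) = fps_at i (gfps n)"
  by (simp add: kPsi_def gfps_eq_prod fps_at_prod)

lemma kPsi'_prod: "(\<Prod>j<n. kPsi' i j) = fps_at i (fps_scale (Const qpar) (gfps n))"
  by (simp add: kPsi'_def gfps_eq_prod fps_at_prod fps_scale_prod fps_at_scale Const_eq_cst)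

lemma kernel_row: "kX i ^ m * ((\<Prod>j<n. kPsi i j) + embed (Const u) * kt ^ m * (\<Prod>j<n. kPsi' i j)) =
    fps_at i (krow n u m)"
  unfolding kPsi_prod kPsi'_prod krow_def
  by (simp add: kX_def embed_eq_at[of _ i] fps_at_mult fps_at_add fps_at_power Const_mult Const.hom_power
      flip: fps_const_mult fps_const_power)

lemma det_kernel: "det (kernel.N n (embed (Const u))) =
    (\<Sum>p | p permutes {..<n}. of_int (sign p) * (\<Prod>i<n. fps_at i (krow n u (desc n p i))))"
  by (simp add: alt_mat_def det_permutes kernel_row)

lemma lookup_det_kernel:
  assumes "\<forall>i\<ge>n. \<beta> i = 0"
  shows "lookup (fps_nth (det (kernel.N n (embed (Const u)))) (\<Sum>i<n. \<beta> i)) (mkey n \<beta>) = gdet n u \<beta>"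
  unfolding det_kernel gdet_def fps_sum_nth lookup_sum lookup_signed lookup_prod_at[OF assms] by simp

lemma lookup_shift_det_kernel:
  assumes "\<forall>i\<ge>n. \<beta> i = 0"
  shows "lookup (fps_nth ((\<Prod>i<n. kX i) * det (kernel.N n (embed (Const u)))) (\<Sum>i<n. Suc (\<beta> i)))
     (mkey n (\<lambda>i. if i < n then Suc (\<beta> i) else 0)) = gdet n u \<beta>"
proof -
  let ?b = "\<lambda>i. if i < n then Suc (\<beta> i) else 0"
  have b: "\<forall>i\<ge>n. ?b i = 0" "(\<Sum>i<n. Suc (\<beta> i)) = (\<Sum>i<n. ?b i)" by (auto intro!: sum.cong)
  have "(\<Prod>i<n. kX i) * det (kernel.N n (embed (Const u))) =
      (\<Sum>p | p permutes {..<n}. of_int (sign p) * (\<Prod>i<n. fps_at i (fps_X * krow n u (desc n p i))))"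
    unfolding det_kernel sum_distrib_left
    by (intro sum.cong) (simp_all add: fps_at_mult prod.distrib kX_def mult_ac)
  then have "lookup (fps_nth ((\<Prod>i<n. kX i) * det (kernel.N n (embed (Const u)))) (\<Sum>i<n. ?b i)) (mkey n ?b) =
      (\<Sum>p | p permutes {..<n}. of_int (sign p) * (\<Prod>i<n. fps_nth (fps_X * krow n u (desc n p i)) (?b i)))"
    by (simp only: fps_sum_nth lookup_sum lookup_signed lookup_prod_at[OF b(1)]) simp
  also have "\<dots> = gdet n u \<beta>"
    unfolding gdet_def by (intro sum.cong arg_cong2[where f = "(*)"] prod.cong) auto
  finally show ?thesis unfolding b(2) .
qed

text \<open>In \<open>det_alt_mat_shift\<close> the product of the \<open>kX i\<close> raises every
  z-exponent by one, while the \<open>kY i\<close> remain as the visible factor.\<close>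

theorem gdet_shift:
  assumes "\<forall>i\<ge>n. \<beta> i = 0"
  shows "gdet n (- 1) (\<lambda>i. if i < n then Suc (\<beta> i) else 0) = (\<Prod>i<n. xvar i) * gdet n (- tpar) \<beta>"
proof -
  let ?b = "\<lambda>i. if i < n then Suc (\<beta> i) else 0"
  have b: "\<forall>i\<ge>n. ?b i = 0" "(\<Sum>i<n. ?b i) = (\<Sum>i<n. Suc (\<beta> i))" by (auto intro!: sum.cong)
  have c: "embed (Const (- 1)) = - 1" "embed (Const (- tpar)) = - kt"
    by (simp_all add: Const_eq_cst cst_hom embed_hom)
  have "det (kernel.N n (embed (Const (- 1)))) =
      embed (\<Prod>i<n. xvar i) * ((\<Prod>i<n. kX i) * det (kernel.N n (embed (Const (- tpar)))))"
    unfolding c kernel.det_alt_mat_shift by (simp add: kY_def embed.hom_prod mult_ac)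
  then have "gdet n (- 1) ?b = (\<Prod>i<n. xvar i) *
     lookup (fps_nth ((\<Prod>i<n. kX i) * det (kernel.N n (embed (Const (- tpar))))) (\<Sum>i<n. Suc (\<beta> i))) (mkey n ?b)"
    using lookup_det_kernel[OF b(1), of "- 1"] unfolding b(2) by (simp only: lookup_embed_mult)
  then show ?thesis unfolding lookup_shift_det_kernel[OF assms] .
qed

section \<open>The antisymmetrized kernel expanded in both alphabets\<close>

definition gcoef :: "nat \<Rightarrow> (nat \<Rightarrow> nat) \<Rightarrow> (nat \<Rightarrow> nat) \<Rightarrow> qt_field" where
  "gcoef n \<alpha> \<gamma> = lookup (\<Prod>i<n. gsym n (\<alpha> i)) (mkey n \<gamma>)"

lemma gdet_eq:
  "gdet n u \<beta> = (\<Sum>p | p permutes {..<n}. if fits n p \<beta> then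
     Const (of_int (sign p) * (\<Prod>i<n. 1 + u * tpar ^ desc n p i * qpar ^ (\<beta> i - desc n p i))) *
       (\<Prod>i<n. gsym n (\<beta> i - desc n p i)) else 0)"
proof -
  have s: "Const (of_int (sign p)) = of_int (sign p)" for p :: "nat \<Rightarrow> nat"
    by (simp add: sign_def Const_eq_cst cst_hom)
  have "(\<Prod>i<n. fps_nth (krow n u (desc n p i)) (\<beta> i)) = (if fits n p \<beta> then
     Const (\<Prod>i<n. 1 + u * tpar ^ desc n p i * qpar ^ (\<beta> i - desc n p i)) *
       (\<Prod>i<n. gsym n (\<beta> i - desc n p i)) else 0)" for p
  proof (cases "fits n p \<beta>")
    case True
    have "(\<Prod>i<n. fps_nth (krow n u (desc n p i)) (\<beta> i)) =
       (\<Prod>i<n. Const (1 + u * tpar ^ desc n p i * qpar ^ (\<beta> i - desc n p i)) * gsym n (\<beta> i - desc n p i))"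
      using True by (intro prod.cong) (auto simp: krow_nth not_less fits_def)
    then show ?thesis using True by (simp add: prod.distrib Const.hom_prod)
  next
    case False
    then obtain i where i: "i < n" "\<beta> i < desc n p i" by (auto simp: fits_def not_le)
    then have "fps_nth (krow n u (desc n p i)) (\<beta> i) = 0" by (simp add: krow_nth)
    then show ?thesis using False i by auto
  qed
  then show ?thesis
    unfolding gdet_def by (intro sum.cong) (auto simp: Const_mult s)
qed

lemma lookup_Const_mult: "lookup (Const c * f) e = c * lookup f e"
  unfolding Const_eq_cst by (rule lookup_cst_mult)

lemma lookup_monom_1_mult:
  fixes f :: "'a::comm_ring_1 mpol"
  shows "lookup (single (mkey n a) 1 * f) (mkey n \<gamma>) =
    (if \<forall>i<n. a i \<le> \<gamma> i then lookup f (mkey n (\<lambda>i. \<gamma> i - a i)) else 0)"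
  by (simp add: lookup_monom_mult cong: if_cong)

lemma det_vandermonde_xvar: "det (vandermonde n xvar) =
    (\<Sum>p | p permutes {..<n}. of_int (sign p) * single (mkey n (desc n p)) 1)"
  by (simp add: vandermonde_def det_permutes prod_xvar)

lemma det_vandermonde_kY: "det (vandermonde n kY) = embed (det (vandermonde n xvar))"
proof -
  have "vandermonde n kY = map_mat embed (vandermonde n xvar)"
    by (rule eq_matI) (auto simp: vandermonde_def kY_def embed.hom_power)
  then show ?thesis by (simp only: embed.hom_det)
qed

abbreviation "pcell n p \<gamma> \<equiv> (\<lambda>i. \<gamma> i - desc n p i)"

text \<open>Here D(u) acts in the z_i: \<open>v\<close> comes from the kernel determinant and
  carries the weights in u, while \<open>p\<close> comes from the Vandermonde determinant of the
  x_j.\<close>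

lemma coeff_kernel_left:
  assumes "\<forall>i\<ge>n. \<beta> i = 0"
  shows "lookup (lookup (fps_nth
      (det (kernel.N n (embed (Const u))) * det (vandermonde n kY)) (\<Sum>i<n. \<beta> i)) (mkey n \<beta>)) (mkey n \<gamma>) =
    (\<Sum>p | p permutes {..<n}. \<Sum>v | v permutes {..<n}.
      if fits n v \<beta> \<and> fits n p \<gamma> then
        of_int (sign p) * of_int (sign v) * gcoef n (pcell n v \<beta>) (pcell n p \<gamma>) *
        (\<Prod>i<n. 1 + u * tpar ^ desc n v i * qpar ^ (\<beta> i - desc n v i)) else 0)"
proof -
  have L: "lookup (fps_nth
      (det (kernel.N n (embed (Const u))) * det (vandermonde n kY)) (\<Sum>i<n. \<beta> i)) (mkey n \<beta>) =
      det (vandermonde n xvar) * gdet n u \<beta>"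
    by (subst mult.commute) (simp only: det_vandermonde_kY lookup_embed_mult lookup_det_kernel[OF assms])
  have "lookup (det (vandermonde n xvar) * gdet n u \<beta>) (mkey n \<gamma>) = (\<Sum>p | p permutes {..<n}. of_int (sign p) *
      (if fits n p \<gamma> then lookup (gdet n u \<beta>) (mkey n (pcell n p \<gamma>)) else 0))"
    unfolding det_vandermonde_xvar sum_distrib_right lookup_sum mult.assoc lookup_signed' lookup_monom_1_mult fits_def by (rule refl)
  also have "\<dots> = (\<Sum>p | p permutes {..<n}. \<Sum>v | v permutes {..<n}.
      if fits n v \<beta> \<and> fits n p \<gamma> then
        of_int (sign p) * of_int (sign v) * gcoef n (pcell n v \<beta>) (pcell n p \<gamma>) *
        (\<Prod>i<n. 1 + u * tpar ^ desc n v i * qpar ^ (\<beta> i - desc n v i)) else 0)"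
  proof (intro sum.cong refl)
    fix p assume "p \<in> {p. p permutes {..<n}}"
    show "of_int (sign p) * (if fits n p \<gamma> then lookup (gdet n u \<beta>) (mkey n (pcell n p \<gamma>)) else 0)
      = (\<Sum>v | v permutes {..<n}.
      if fits n v \<beta> \<and> fits n p \<gamma> then
        of_int (sign p) * of_int (sign v) * gcoef n (pcell n v \<beta>) (pcell n p \<gamma>) *
        (\<Prod>i<n. 1 + u * tpar ^ desc n v i * qpar ^ (\<beta> i - desc n v i)) else 0)"
    proof (cases "fits n p \<gamma>")
      case True
      then show ?thesis
        unfolding gdet_eq lookup_sum sum_distrib_left
        by (auto simp: gcoef_def lookup_Const_mult sum_distrib_left intro!: sum.cong)
    qed simp
  qed
  finally show ?thesis unfolding L .
qed

text \<open>Each factor involves all z_i, so no coefficient can be read off directly. Multiplying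
  out over the set \<open>J\<close> of those x_j for which the shifted factor is chosen, the double
  product regroups by \<open>i\<close> into q-shifted copies of \<open>gfps n\<close>.\<close>

lemma kernel_expand:
  "(\<Prod>j<n. kY j ^ desc n p j * ((\<Prod>i<n. kPsi i j) + embed (Const u) * kt ^ desc n p j * (\<Prod>i<n. kPsi' i j))) =
   (\<Sum>J\<in>Pow {..<n}. embed (single (mkey n (desc n p)) 1 * Const (\<Prod>j\<in>J. u * tpar ^ desc n p j)) *
      (\<Prod>i<n. fps_at i (qshift_fps J (gfps n))))"
proof -
  let ?B = "\<lambda>j. \<Prod>i<n. kPsi i j" and ?B' = "\<lambda>j. \<Prod>i<n. kPsi' i j"
  let ?c = "\<lambda>j. embed (Const (u * tpar ^ desc n p j))"
  have "(\<Prod>j<n. kY j ^ desc n p j * (?B j + embed (Const u) * kt ^ desc n p j * ?B' j)) =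
      embed (\<Prod>j<n. xvar j ^ desc n p j) * (\<Prod>j<n. ?c j * ?B' j + ?B j)"
    by (simp add: prod.distrib kY_def embed.hom_prod embed.hom_power Const_mult Const.hom_power embed_hom add.commute)
  also have "(\<Prod>j<n. ?c j * ?B' j + ?B j) =
      (\<Sum>J\<in>Pow {..<n}. (\<Prod>j\<in>J. ?c j * ?B' j) * (\<Prod>j\<in>{..<n} - J. ?B j))"
    by (rule prod_add) simp
  also have "\<dots> = (\<Sum>J\<in>Pow {..<n}. embed (Const (\<Prod>j\<in>J. u * tpar ^ desc n p j)) *
      (\<Prod>i<n. fps_at i (qshift_fps J (gfps n))))"
  proof (rule sum.cong[OF refl])
    fix J assume "J \<in> Pow {..<n}"
    then have J: "J \<subseteq> {..<n}" by simp
    have "(\<Prod>j\<in>J. ?B' j) * (\<Prod>j\<in>{..<n} - J. ?B j) =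
        (\<Prod>j\<in>J. if j \<in> J then ?B' j else ?B j) * (\<Prod>j\<in>{..<n} - J. if j \<in> J then ?B' j else ?B j)"
      by (intro arg_cong2[where f = "(*)"] prod.cong) auto
    also have "\<dots> = (\<Prod>j<n. if j \<in> J then ?B' j else ?B j)"
      using prod.subset_diff[OF J, of "\<lambda>j. if j \<in> J then ?B' j else ?B j"] by (simp add: mult.commute)
    also have "\<dots> = (\<Prod>j<n. \<Prod>i<n. fps_at i (fps_at j (if j \<in> J then fps_scale qpar Psi else Psi)))"
      by (intro prod.cong) (auto simp: kPsi_def kPsi'_def)
    also have "\<dots> = (\<Prod>i<n. fps_at i (qshift_fps J (gfps n)))"
      unfolding qshift_gfps[OF J] fps_at_prod by (rule prod.swap)
    finally show "(\<Prod>j\<in>J. ?c j * ?B' j) * (\<Prod>j\<in>{..<n} - J. ?B j) = embed (Const (\<Prod>j\<in>J. u * tpar ^ desc n p j)) *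
      (\<Prod>i<n. fps_at i (qshift_fps J (gfps n)))"
      by (simp only: prod.distrib[of ?c ?B' J] Const.hom_prod[of "\<lambda>j. u * tpar ^ desc n p j" J] embed.hom_prod mult.assoc)
  qed
  finally show ?thesis
    by (simp add: sum_distrib_left prod_xvar embed_hom mult.assoc)
qed

text \<open>The counterpart with D(u) acting in the x_j: now \<open>p\<close> comes from the kernel
  determinant, so the weights in u sit on \<gamma>, and \<open>v\<close> comes from the Vandermonde
  determinant of the z_i.\<close>

lemma coeff_kernel_right:
  assumes "\<forall>i\<ge>n. \<beta> i = 0"
  shows "lookup (lookup (fps_nth
      (det (alt_mat n kY (\<lambda>j. \<Prod>i<n. kPsi i j) (\<lambda>j. \<Prod>i<n. kPsi' i j) kt (embed (Const u))) *
       det (vandermonde n kX)) (\<Sum>i<n. \<beta> i)) (mkey n \<beta>)) (mkey n \<gamma>) =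
    (\<Sum>p | p permutes {..<n}. \<Sum>v | v permutes {..<n}.
      if fits n v \<beta> \<and> fits n p \<gamma> then
        of_int (sign p) * of_int (sign v) * gcoef n (pcell n v \<beta>) (pcell n p \<gamma>) *
        (\<Prod>i<n. 1 + u * tpar ^ desc n p i * qpar ^ (\<gamma> i - desc n p i)) else 0)"
proof -
  let ?m = "\<lambda>p. single (mkey n (desc n p)) (1 :: qt_field)"
  let ?c = "\<lambda>p J. \<Prod>j\<in>J. u * tpar ^ desc n p j"
  let ?G = "\<lambda>v. if fits n v \<beta> then \<Prod>i<n. gsym n (\<beta> i - desc n v i) else 0"
  have row: "lookup (fps_nth ((\<Prod>i<n. fps_at i (qshift_fps J (gfps n))) * (\<Prod>i<n. kX i ^ desc n v i))
      (\<Sum>i<n. \<beta> i)) (mkey n \<beta>) = qshift J (?G v)" for J v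
  proof -
    have "(\<Prod>i<n. fps_at i (qshift_fps J (gfps n))) * (\<Prod>i<n. kX i ^ desc n v i) =
        (\<Prod>i<n. fps_at i (fps_X ^ desc n v i * qshift_fps J (gfps n)))"
      by (simp add: prod.distrib fps_at_mult fps_at_power kX_def mult.commute)
    then have "lookup (fps_nth ((\<Prod>i<n. fps_at i (qshift_fps J (gfps n))) * (\<Prod>i<n. kX i ^ desc n v i))
      (\<Sum>i<n. \<beta> i)) (mkey n \<beta>) = (\<Prod>i<n. if \<beta> i < desc n v i then 0 else qshift J (gsym n (\<beta> i - desc n v i)))"
      by (simp add: lookup_prod_at[OF assms] fps_X_power_mult_nth qshift_fps_def gfps_def cong: if_cong)
    also have "\<dots> = (if fits n v \<beta> then \<Prod>i<n. qshift J (gsym n (\<beta> i - desc n v i)) else 0)"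
      by (auto simp: fits_def not_le intro!: prod.cong)
    finally show ?thesis by (simp add: qshift_prod qshift_single[of J 0 0, simplified])
  qed
  have dV: "det (vandermonde n kX) = (\<Sum>v | v permutes {..<n}. of_int (sign v) * (\<Prod>i<n. kX i ^ desc n v i))"
    by (simp add: vandermonde_def det_permutes)
  have dA: "det (alt_mat n kY (\<lambda>j. \<Prod>i<n. kPsi i j) (\<lambda>j. \<Prod>i<n. kPsi' i j) kt (embed (Const u))) =
    (\<Sum>p | p permutes {..<n}. of_int (sign p) * (\<Sum>J\<in>Pow {..<n}. embed (?m p * Const (?c p J)) *
      (\<Prod>i<n. fps_at i (qshift_fps J (gfps n)))))"
    by (simp add: alt_mat_def det_permutes kernel_expand)
  have "det (alt_mat n kY (\<lambda>j. \<Prod>i<n. kPsi i j) (\<lambda>j. \<Prod>i<n. kPsi' i j) kt (embed (Const u))) *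
       det (vandermonde n kX) =
     (\<Sum>p | p permutes {..<n}. \<Sum>v | v permutes {..<n}. of_int (sign p) * (of_int (sign v) *
       (\<Sum>J\<in>Pow {..<n}. embed (?m p * Const (?c p J)) *
         ((\<Prod>i<n. fps_at i (qshift_fps J (gfps n))) * (\<Prod>i<n. kX i ^ desc n v i)))))"
    unfolding dV dA sum_product
    by (intro sum.cong refl) (simp add: sum_distrib_left sum_distrib_right mult_ac)
  then have L: "lookup (fps_nth
      (det (alt_mat n kY (\<lambda>j. \<Prod>i<n. kPsi i j) (\<lambda>j. \<Prod>i<n. kPsi' i j) kt (embed (Const u))) *
       det (vandermonde n kX)) (\<Sum>i<n. \<beta> i)) (mkey n \<beta>) =
     (\<Sum>p | p permutes {..<n}. \<Sum>v | v permutes {..<n}. of_int (sign p) * (of_int (sign v) *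
       (\<Sum>J\<in>Pow {..<n}. ?m p * Const (?c p J) * qshift J (?G v))))"
    by (simp only: fps_sum_nth lookup_sum lookup_signed lookup_embed_mult row)
  have "lookup (\<Sum>p | p permutes {..<n}. \<Sum>v | v permutes {..<n}. of_int (sign p) * (of_int (sign v) *
       (\<Sum>J\<in>Pow {..<n}. ?m p * Const (?c p J) * qshift J (?G v)))) (mkey n \<gamma>) = (\<Sum>p | p permutes {..<n}. \<Sum>v | v permutes {..<n}.
      of_int (sign p) * (of_int (sign v) * (\<Sum>J\<in>Pow {..<n}. if fits n p \<gamma> then
        ?c p J * (qpar ^ (\<Sum>j\<in>J. \<gamma> j - desc n p j) * lookup (?G v) (mkey n (pcell n p \<gamma>))) else 0)))"
  proof -
    have "(\<Sum>j\<in>J. if j < n then a j else 0) = (\<Sum>j\<in>J. a j)" if "J \<in> Pow {..<n}" for J and a :: "nat \<Rightarrow> nat"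
      using that by (intro sum.cong) auto
    then show ?thesis
      unfolding lookup_sum lookup_signed' mult.assoc[of "?m _"] lookup_monom_1_mult lookup_Const_mult lookup_qshift lookup_mkey fits_def [symmetric]
      by (intro sum.cong refl arg_cong2[where f = "(*)"]) simp
  qed
  also have "\<dots> = (\<Sum>p | p permutes {..<n}. \<Sum>v | v permutes {..<n}.
      if fits n v \<beta> \<and> fits n p \<gamma> then
        of_int (sign p) * of_int (sign v) * gcoef n (pcell n v \<beta>) (pcell n p \<gamma>) *
        (\<Prod>i<n. 1 + u * tpar ^ desc n p i * qpar ^ (\<gamma> i - desc n p i)) else 0)"
  proof (intro sum.cong refl)
    fix p v
    \<comment> \<open>The subsets \<open>J\<close> are summed up again: \<open>qshift J\<close> has
      contributed q to the sum of the exponents in \<open>J\<close>, the matching term of the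
      expanded product.\<close>
    have "(\<Prod>i<n. 1 + u * tpar ^ desc n p i * qpar ^ (\<gamma> i - desc n p i)) =
       (\<Sum>J\<in>Pow {..<n}. ?c p J * qpar ^ (\<Sum>j\<in>J. \<gamma> j - desc n p j))"
      using prod_add[of "{..<n}" "\<lambda>i. u * tpar ^ desc n p i * qpar ^ (\<gamma> i - desc n p i)" "\<lambda>_. 1"]
      by (simp add: add.commute prod.distrib power_sum)
    then show "of_int (sign p) * (of_int (sign v) * (\<Sum>J\<in>Pow {..<n}. if fits n p \<gamma> then
        ?c p J * (qpar ^ (\<Sum>j\<in>J. \<gamma> j - desc n p j) * lookup (?G v) (mkey n (pcell n p \<gamma>))) else 0)) =
      (if fits n v \<beta> \<and> fits n p \<gamma> then
        of_int (sign p) * of_int (sign v) * gcoef n (pcell n v \<beta>) (pcell n p \<gamma>) *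
        (\<Prod>i<n. 1 + u * tpar ^ desc n p i * qpar ^ (\<gamma> i - desc n p i)) else 0)"
      by (simp add: gcoef_def sum_distrib_left sum_distrib_right mult_ac cong: if_cong)
  qed
  finally show ?thesis unfolding L .
qed

text \<open>Self-adjointness of the Macdonald operator \<open>D\<^sub>n(u)\<close> with respect to the kernel
  \<open>\<Prod>\<^sub>i\<^sub>j \<Psi>(x\<^sub>i y\<^sub>j)\<close>, read off on the coefficients of the antisymmetrized kernel.\<close>

theorem kernel_self_adjoint:
  assumes "\<forall>i\<ge>n. \<beta> i = 0"
  shows "(\<Sum>p | p permutes {..<n}. \<Sum>v | v permutes {..<n}.
      if fits n v \<beta> \<and> fits n p \<gamma> then
        of_int (sign p) * of_int (sign v) * gcoef n (pcell n v \<beta>) (pcell n p \<gamma>) *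
        (\<Prod>i<n. 1 + u * tpar ^ desc n v i * qpar ^ (\<beta> i - desc n v i)) else 0) =
   (\<Sum>p | p permutes {..<n}. \<Sum>v | v permutes {..<n}.
      if fits n v \<beta> \<and> fits n p \<gamma> then
        of_int (sign p) * of_int (sign v) * gcoef n (pcell n v \<beta>) (pcell n p \<gamma>) *
        (\<Prod>i<n. 1 + u * tpar ^ desc n p i * qpar ^ (\<gamma> i - desc n p i)) else 0)"
  unfolding coeff_kernel_left[OF assms, symmetric] coeff_kernel_right[OF assms, symmetric]
    kernel.det_alt_mat_symmetric ..

section \<open>Partitions and compositions\<close>

lemma supp_less: "\<forall>i\<ge>n. \<alpha> i = 0 \<Longrightarrow> \<alpha> i \<noteq> 0 \<Longrightarrow> i < n" for i n :: nat
  by (metis not_le)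

lemma down_closed_eq_lessThan:
  assumes "finite A" "\<And>i j. j \<in> A \<Longrightarrow> i \<le> j \<Longrightarrow> i \<in> A"
  shows "A = {..<card A}"
proof -
  have "A = {..<Suc (Max A)}" if "A \<noteq> {}"
  proof (intro equalityI subsetI)
    show "i \<in> {..<Suc (Max A)}" if "i \<in> A" for i
      using Max_ge[OF assms(1) that] by simp
    show "i \<in> A" if "i \<in> {..<Suc (Max A)}" for i
      using assms(2)[OF Max_in[OF assms(1) \<open>A \<noteq> {}\<close>], of i] that by simp
  qed
  then show ?thesis by (metis card.empty card_lessThan lessThan_0)
qed

lemma partition_ge_set:
  assumes "is_partition \<nu>" "j \<ge> 1"
  shows "{i. j \<le> \<nu> i} = {..<card {i. j \<le> \<nu> i}}"
proof (rule down_closed_eq_lessThan)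
  show "finite {i. j \<le> \<nu> i}"
  proof (rule finite_subset)
    show "{i. j \<le> \<nu> i} \<subseteq> {i. \<nu> i \<noteq> 0}" using assms(2) by auto
    show "finite {i. \<nu> i \<noteq> 0}" using assms(1) by (simp add: is_partition_def)
  qed
  show "i \<in> {i. j \<le> \<nu> i}" if "k \<in> {i. j \<le> \<nu> i}" "i \<le> k" for i k
  proof -
    have "antimono \<nu>" using assms(1) by (simp add: is_partition_def)
    then have "\<nu> k \<le> \<nu> i" using that(2) by (rule antimonoD)
    then show ?thesis using that(1) by simp
  qed
qed

lemma partition_nonzero: "is_partition \<nu> \<Longrightarrow> {i. \<nu> i \<noteq> 0} = {..<num_parts \<nu>}"
proof -
  have "{i. \<nu> i \<noteq> 0} = {i. 1 \<le> \<nu> i}" by auto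
  then show "is_partition \<nu> \<Longrightarrow> {i. \<nu> i \<noteq> 0} = {..<num_parts \<nu>}"
    using partition_ge_set[of \<nu> 1] by (simp add: num_parts_def)
qed

lemma partition_zero_iff: "is_partition \<nu> \<Longrightarrow> \<nu> i = 0 \<longleftrightarrow> num_parts \<nu> \<le> i"
proof -
  assume p: "is_partition \<nu>"
  have "i \<in> {i. \<nu> i \<noteq> 0} \<longleftrightarrow> i \<in> {..<num_parts \<nu>}" by (simp only: partition_nonzero[OF p])
  then show ?thesis by auto
qed

lemma num_parts_le_iff: "is_partition \<nu> \<Longrightarrow> num_parts \<nu> \<le> n \<longleftrightarrow> (\<forall>i\<ge>n. \<nu> i = 0)"
  by (auto simp: partition_zero_iff)

lemma psize_eq: "(\<forall>i\<ge>n. \<nu> i = 0) \<Longrightarrow> psize \<nu> = (\<Sum>i<n. \<nu> i)"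
  unfolding psize_def by (rule sum.mono_neutral_left) (auto dest: supp_less)

lemma num_parts_le_psize: "is_partition \<nu> \<Longrightarrow> num_parts \<nu> \<le> psize \<nu>"
proof -
  assume p: "is_partition \<nu>"
  have "num_parts \<nu> = (\<Sum>i | \<nu> i \<noteq> 0. 1)" by (simp add: num_parts_def)
  also have "\<dots> \<le> psize \<nu>" unfolding psize_def by (intro sum_mono) auto
  finally show ?thesis .
qed

lemma partition_antimono: "is_partition \<nu> \<Longrightarrow> i \<le> j \<Longrightarrow> \<nu> j \<le> \<nu> i"
  by (auto simp: is_partition_def dest: antimonoD)

text \<open>A partition is determined by its column lengths.\<close>

lemma partition_eqI:
  assumes "is_partition \<nu>" "is_partition \<nu>'" "\<And>j. j \<ge> 1 \<Longrightarrow> card {i. j \<le> \<nu> i} = card {i. j \<le> \<nu>' i}"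
  shows "\<nu> = \<nu>'"
proof
  fix i
  have "j \<le> \<nu> i \<longleftrightarrow> j \<le> \<nu>' i" if "j \<ge> 1" for j
    using partition_ge_set[OF assms(1) that] partition_ge_set[OF assms(2) that] assms(3)[OF that]
    by (metis mem_Collect_eq)
  then have "j \<le> \<nu> i \<longleftrightarrow> j \<le> \<nu>' i" for j by (cases "j = 0") auto
  then show "\<nu> i = \<nu>' i" by (metis order_refl order_antisym)
qed

section \<open>Compositions as rearrangements of partitions\<close>

definition parts :: "nat \<Rightarrow> nat \<Rightarrow> (nat \<Rightarrow> nat) set" where
  "parts n d = {\<nu>. is_partition \<nu> \<and> num_parts \<nu> \<le> n \<and> psize \<nu> = d}"

lemma parts_subset: "parts n d \<subseteq> weak_comps n d"
  unfolding parts_def weak_comps_def using num_parts_le_iff psize_eq by fastforce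

lemma finite_parts: "finite (parts n d)"
  using parts_subset finite_weak_comps by (rule finite_subset)

lemma parts_iff: "\<nu> \<in> parts n d \<longleftrightarrow> antimono \<nu> \<and> \<nu> \<in> weak_comps n d"
proof (intro iffI conjI)
  assume "\<nu> \<in> parts n d"
  then show "antimono \<nu>" "\<nu> \<in> weak_comps n d"
    using parts_subset by (auto simp: parts_def is_partition_def)
next
  assume a: "antimono \<nu> \<and> \<nu> \<in> weak_comps n d"
  then have z: "\<forall>i\<ge>n. \<nu> i = 0" by (simp add: weak_comps_def)
  have "{i. \<nu> i \<noteq> 0} \<subseteq> {..<n}" using supp_less[OF z] by auto
  then have "finite {i. \<nu> i \<noteq> 0}" by (rule finite_subset) simp
  then have p: "is_partition \<nu>" using a by (simp add: is_partition_def)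
  then show "\<nu> \<in> parts n d"
    using a num_parts_le_iff[OF p, of n] psize_eq[OF z] z by (simp add: parts_def weak_comps_def)
qed

lemma partsD:
  assumes "\<nu> \<in> parts n d"
  shows "is_partition \<nu>" "\<forall>i\<ge>n. \<nu> i = 0" "(\<Sum>i<n. \<nu> i) = d" "psize \<nu> = d" "\<nu> \<in> weak_comps n d"
  using assms parts_subset[of n d] num_parts_le_iff[of \<nu> n] by (auto simp: parts_def weak_comps_def)

lemma weak_comps_permute:
  assumes "\<pi> permutes {..<n}" "\<alpha> \<in> weak_comps n d"
  shows "\<alpha> \<circ> \<pi> \<in> weak_comps n d"
proof -
  have "(\<Sum>i<n. (\<alpha> \<circ> \<pi>) i) = (\<Sum>i<n. \<alpha> i)"
    using sum.permute[OF assms(1), of \<alpha>] by simp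
  moreover have "(\<alpha> \<circ> \<pi>) i = 0" if "i \<ge> n" for i
    using that assms permutes_not_in[OF assms(1), of i] by (auto simp: weak_comps_def)
  ultimately show ?thesis using assms(2) by (simp add: weak_comps_def)
qed

lemma sort_weak_comp:
  assumes "\<alpha> \<in> weak_comps n d"
  obtains \<nu> \<pi> where "\<nu> \<in> parts n d" "\<pi> permutes {..<n}" "\<alpha> = \<nu> \<circ> \<pi>"
proof -
  define xs where "xs = map \<alpha> [0..<n]"
  define ys where "ys = rev (sort xs)"
  have l: "length xs = n" "length ys = n" by (simp_all add: xs_def ys_def)
  have "mset xs = mset ys" by (simp add: ys_def)
  then obtain p where p: "p permutes {..<length ys}" "permute_list p ys = xs"
    by (rule mset_eq_permutation)
  have pn: "p permutes {..<n}" using p(1) l by simp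
  define \<nu> where "\<nu> = (\<lambda>i. if i < n then ys ! i else 0)"
  have a: "\<alpha> i = ys ! p i" if "i < n" for i
  proof -
    have "xs ! i = ys ! p i" using p that l by (metis permute_list_nth)
    then show ?thesis using that by (simp add: xs_def)
  qed
  have e: "\<alpha> = \<nu> \<circ> p"
  proof
    fix i show "\<alpha> i = (\<nu> \<circ> p) i"
      using a[of i] permutes_in_image[OF pn, of i] permutes_not_in[OF pn, of i] assms
      by (cases "i < n") (auto simp: \<nu>_def weak_comps_def)
  qed
  have "antimono \<nu>"
  proof (rule antimonoI)
    fix i j :: nat assume "i \<le> j"
    have "ys ! j \<le> ys ! i" if "j < n"
    proof -
      have "sorted (rev ys)" by (simp add: ys_def)
      then show ?thesis using sorted_rev_nth_mono[of ys i j] that l(2) \<open>i \<le> j\<close> by simp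
    qed
    then show "\<nu> j \<le> \<nu> i" using \<open>i \<le> j\<close> by (auto simp: \<nu>_def)
  qed
  moreover have "\<nu> \<in> weak_comps n d"
  proof -
    have "\<nu> = \<alpha> \<circ> inv_into UNIV p" unfolding e comp_assoc permutes_inv_o(1)[OF pn] by simp
    then show ?thesis using weak_comps_permute[OF permutes_inv[OF pn] assms] by simp
  qed
  ultimately show ?thesis using that pn e parts_iff by blast
qed

lemma permuted_partition_unique:
  assumes "is_partition \<nu>" "is_partition \<nu>'" "\<pi> permutes {..<n}" "\<nu> = \<nu>' \<circ> \<pi>"
  shows "\<nu> = \<nu>'"
proof (rule partition_eqI[OF assms(1,2)])
  fix j
  have "bij \<pi>" using assms(3) by (rule permutes_bij)
  then have "\<pi> ` {i. j \<le> \<nu> i} = {i. j \<le> \<nu>' i}"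
    unfolding assms(4) by (auto simp: bij_def surj_def image_iff)
  then show "card {i. j \<le> \<nu> i} = card {i. j \<le> \<nu>' i}"
    using card_image[OF inj_on_subset[OF bij_is_inj[OF \<open>bij \<pi>\<close>] subset_UNIV], of "{i. j \<le> \<nu> i}"] by simp
qed

lemma distinct_perms_iff: "\<alpha> \<in> distinct_perms n \<nu> \<longleftrightarrow> (\<exists>\<pi>. \<pi> permutes {..<n} \<and> \<alpha> = \<nu> \<circ> \<pi>)"
  by (auto simp: distinct_perms_def)

lemma distinct_perms_subset: "\<nu> \<in> weak_comps n d \<Longrightarrow> distinct_perms n \<nu> \<subseteq> weak_comps n d"
  by (auto simp: distinct_perms_iff intro: weak_comps_permute)

lemma distinct_perms_disjoint:
  assumes "is_partition \<nu>" "is_partition \<nu>'" "\<alpha> \<in> distinct_perms n \<nu>" "\<alpha> \<in> distinct_perms n \<nu>'"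
  shows "\<nu> = \<nu>'"
proof -
  obtain p p' where p: "p permutes {..<n}" "p' permutes {..<n}" "\<nu> \<circ> p = \<nu>' \<circ> p'"
    using assms(3,4) by (auto simp: distinct_perms_iff)
  have "\<nu> = \<nu> \<circ> p \<circ> inv_into UNIV p" unfolding comp_assoc permutes_inv_o(1)[OF p(1)] by simp
  also have "\<dots> = \<nu>' \<circ> (p' \<circ> inv_into UNIV p)" unfolding p(3) by (simp add: comp_assoc)
  finally show ?thesis
    using permuted_partition_unique[OF assms(1,2)] permutes_compose[OF permutes_inv[OF p(1)] p(2)] by blast
qed

lemma sum_weak_comps:
  fixes f :: "(nat \<Rightarrow> nat) \<Rightarrow> 'a::comm_monoid_add"
  shows "(\<Sum>\<alpha>\<in>weak_comps n d. f \<alpha>) = (\<Sum>\<nu>\<in>parts n d. \<Sum>\<alpha>\<in>distinct_perms n \<nu>. f \<alpha>)"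
proof -
  have "weak_comps n d = (\<Union>\<nu>\<in>parts n d. distinct_perms n \<nu>)"
  proof (intro equalityI subsetI)
    fix \<alpha> assume "\<alpha> \<in> weak_comps n d"
    then show "\<alpha> \<in> (\<Union>\<nu>\<in>parts n d. distinct_perms n \<nu>)"
      by (rule sort_weak_comp) (auto simp: distinct_perms_iff)
  next
    fix \<alpha> assume "\<alpha> \<in> (\<Union>\<nu>\<in>parts n d. distinct_perms n \<nu>)"
    then show "\<alpha> \<in> weak_comps n d" using distinct_perms_subset parts_subset by blast
  qed
  moreover have "finite (distinct_perms n \<nu>)" if "\<nu> \<in> parts n d" for \<nu>
    using that parts_subset distinct_perms_subset finite_weak_comps by (meson finite_subset subsetD)
  moreover have "distinct_perms n \<nu> \<inter> distinct_perms n \<nu>' = {}"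
    if "\<nu> \<in> parts n d" "\<nu>' \<in> parts n d" "\<nu> \<noteq> \<nu>'" for \<nu> \<nu>'
    using that distinct_perms_disjoint by (fastforce simp: parts_def)
  ultimately show ?thesis by (simp add: sum.UNION_disjoint finite_parts)
qed

section \<open>Monomial coefficients and the scalar product\<close>

text \<open>For \<open>P\<close> the power sums, the product p_m in the indexing of
  \<open>symfun\<close>: key k stands for p_(k+1).\<close>

definition pow_mset :: "(nat \<Rightarrow> 'a::comm_monoid_mult) \<Rightarrow> (nat \<Rightarrow>\<^sub>0 nat) \<Rightarrow> 'a" where
  "pow_mset P m = (\<Prod>k\<in>keys m. P k ^ lookup m k)"

lemma pow_mset_alt: "finite A \<Longrightarrow> keys m \<subseteq> A \<Longrightarrow> pow_mset P m = (\<Prod>k\<in>A. P k ^ lookup m k)"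
  unfolding pow_mset_def by (rule prod.mono_neutral_left) (auto simp: in_keys_iff)

lemma pow_mset_0: "pow_mset P 0 = 1" by (simp add: pow_mset_def)

lemma pow_mset_add: "pow_mset P (m + m') = pow_mset P m * pow_mset P m'"
proof -
  let ?A = "keys m \<union> keys m'"
  have "pow_mset P (m + m') = (\<Prod>k\<in>?A. P k ^ lookup (m + m') k)"
    "pow_mset P m = (\<Prod>k\<in>?A. P k ^ lookup m k)"
    "pow_mset P m' = (\<Prod>k\<in>?A. P k ^ lookup m' k)"
    by (rule pow_mset_alt; use keys_add[of m m'] in auto)+
  then show ?thesis by (simp add: lookup_add power_add prod.distrib)
qed

lemma pow_mset_unit: "pow_mset P (unit_exp k) = P k"
  by (simp add: pow_mset_def)

lemma pow_mset_mult: "pow_mset (\<lambda>k. P k * Q k) m = pow_mset P m * pow_mset Q m"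
  by (simp add: pow_mset_def power_mult_distrib prod.distrib)

definition mlen :: "(nat \<Rightarrow>\<^sub>0 nat) \<Rightarrow> nat" where
  "mlen m = (\<Sum>k\<in>keys m. lookup m k)"

lemma mlen_add: "mlen (m + m') = mlen m + mlen m'"
proof -
  let ?A = "keys m \<union> keys m'"
  have a: "mlen x = (\<Sum>k\<in>?A. lookup x k)" if "keys x \<subseteq> ?A" for x
    unfolding mlen_def using that by (intro sum.mono_neutral_left) (auto simp: in_keys_iff)
  show ?thesis using a[of m] a[of m'] a[of "m + m'"] keys_add[of m m'] by (simp add: lookup_add sum.distrib)
qed

lemma mlen_unit [simp]: "mlen (unit_exp k) = 1" by (simp add: mlen_def)
lemma mlen_0 [simp]: "mlen 0 = 0" by (simp add: mlen_def)

lemma minus_unit_exp: "k \<in> keys m \<Longrightarrow> m - unit_exp k + unit_exp k = m"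
  by (intro poly_mapping_eqI) (auto simp: lookup_add lookup_minus lookup_single when_def in_keys_iff)

lemma mset_exp_induct [case_names zero add]:
  assumes "P 0" "\<And>m k. P m \<Longrightarrow> P (m + unit_exp k)"
  shows "P m"
proof (induction "p_weight m" arbitrary: m rule: less_induct)
  case less
  show ?case
  proof (cases "m = 0")
    case False
    then obtain k where k: "k \<in> keys m" by (metis keys_eq_empty ex_in_conv)
    note e = minus_unit_exp[OF k]
    have "p_weight (m - unit_exp k) < p_weight m"
      using add_unit_exp(1)[of "m - unit_exp k" k] e by simp
    then show ?thesis using less assms(2)[of "m - unit_exp k" k] e by simp
  qed (simp add: assms(1))
qed

section \<open>Monomial coefficients of products of power sums\<close>

definition psum :: "nat \<Rightarrow> nat \<Rightarrow> 'a::comm_ring_1 mpol" where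
  "psum N k = (\<Sum>i<N. single (single i (Suc k)) 1)"

text \<open>Integers, so that the same numbers serve over every coefficient ring and positivity can
  exclude cancellation.\<close>

definition pcoef :: "nat \<Rightarrow> (nat \<Rightarrow> nat) \<Rightarrow> (nat \<Rightarrow>\<^sub>0 nat) \<Rightarrow> int" where
  "pcoef N \<alpha> m = lookup (pow_mset (psum N) m) (mkey N \<alpha>)"

text \<open>The added factor p_(k+1) places its whole exponent on a single variable. The facts on
  \<open>pcoef\<close> below are inductions along this recursion.\<close>

lemma lookup_pow_psum_add:
  "lookup (pow_mset (psum N) (m + unit_exp k) :: 'a::comm_ring_1 mpol) (mkey N \<alpha>) =
    (\<Sum>i<N. if Suc k \<le> \<alpha> i then lookup (pow_mset (psum N) m) (mkey N (\<alpha>(i := \<alpha> i - Suc k))) else 0)"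
proof -
  have u: "single i (Suc k) = mkey N (\<lambda>j. if j = i then Suc k else 0)" if "i < N" for i
    using that by (intro poly_mapping_eqI) (auto simp: lookup_mkey lookup_single when_def)
  have "pow_mset (psum N) (m + unit_exp k) =
      (\<Sum>i<N. single (mkey N (\<lambda>j. if j = i then Suc k else 0)) 1 * pow_mset (psum N) m :: 'a mpol)"
    unfolding pow_mset_add pow_mset_unit by (subst psum_def) (simp add: u sum_distrib_left mult.commute)
  moreover have "(\<lambda>j. \<alpha> j - (if j = i then Suc k else 0)) = \<alpha>(i := \<alpha> i - Suc k)" for i
    by auto
  moreover have "(\<forall>j<N. (if j = i then Suc k else 0) \<le> \<alpha> j) \<longleftrightarrow> Suc k \<le> \<alpha> i" if "i < N" for i
    using that by auto
  ultimately show ?thesis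
    by (auto simp: lookup_sum lookup_monom_1_mult simp del: Suc_le_eq intro!: sum.cong)
qed

lemma lookup_1_mkey: "lookup (1 :: 'a::comm_ring_1 mpol) (mkey N \<alpha>) = (if \<forall>i<N. \<alpha> i = 0 then 1 else 0)"
proof -
  have "mkey N \<alpha> = 0 \<longleftrightarrow> (\<forall>i<N. \<alpha> i = 0)"
    by (auto simp: poly_mapping_eq_iff fun_eq_iff lookup_mkey)
  then show ?thesis by (simp add: lookup_one when_def)
qed

lemma pcoef_0: "pcoef N \<alpha> 0 = (if \<forall>i<N. \<alpha> i = 0 then 1 else 0)"
  by (simp add: pcoef_def pow_mset_0 lookup_1_mkey)

lemma pcoef_add: "pcoef N \<alpha> (m + unit_exp k) =
    (\<Sum>i<N. if Suc k \<le> \<alpha> i then pcoef N (\<alpha>(i := \<alpha> i - Suc k)) m else 0)"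
  unfolding pcoef_def by (rule lookup_pow_psum_add)

lemma lookup_pow_psum:
  "lookup (pow_mset (psum N) m :: 'a::comm_ring_1 mpol) (mkey N \<alpha>) = of_int (pcoef N \<alpha> m)"
proof (induction m arbitrary: \<alpha> rule: mset_exp_induct)
  case zero
  then show ?case by (simp add: pow_mset_0 lookup_1_mkey pcoef_0)
next
  case (add m k)
  then show ?case unfolding lookup_pow_psum_add pcoef_add of_int_sum
    by (intro sum.cong) (simp_all only: of_int_0 if_distrib[of of_int])
qed

lemma pcoef_nonneg: "pcoef N \<alpha> m \<ge> 0"
proof (induction m arbitrary: \<alpha> rule: mset_exp_induct)
  case zero
  then show ?case by (simp add: pcoef_0)
next
  case (add m k)
  then show ?case unfolding pcoef_add by (intro sum_nonneg) auto
qed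

lemma pcoef_extend:
  assumes "\<forall>i\<ge>N. \<alpha> i = 0" "N \<le> N'"
  shows "pcoef N' \<alpha> m = pcoef N \<alpha> m"
  using assms(1)
proof (induction m arbitrary: \<alpha> rule: mset_exp_induct)
  case zero
  have "(\<forall>i<N'. \<alpha> i = 0) \<longleftrightarrow> (\<forall>i<N. \<alpha> i = 0)"
    using zero assms(2) by (meson less_le_trans not_le)
  then show ?case unfolding pcoef_0 by simp
next
  case (add m k)
  have "pcoef N' \<alpha> (m + unit_exp k) = (\<Sum>i<N. if Suc k \<le> \<alpha> i then pcoef N' (\<alpha>(i := \<alpha> i - Suc k)) m else 0)"
    unfolding pcoef_add using assms(2) add.prems by (intro sum.mono_neutral_right) auto
  also have "\<dots> = pcoef N \<alpha> (m + unit_exp k)"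
    unfolding pcoef_add
  proof (intro sum.cong refl if_cong)
    fix i assume "i \<in> {..<N}"
    then have "\<forall>l\<ge>N. (\<alpha>(i := \<alpha> i - Suc k)) l = 0" using add.prems by auto
    then show "pcoef N' (\<alpha>(i := \<alpha> i - Suc k)) m = pcoef N (\<alpha>(i := \<alpha> i - Suc k)) m" by (rule add.IH)
  qed
  finally show ?case .
qed

lemma pcoef_permute:
  assumes "\<pi> permutes {..<N}"
  shows "pcoef N (\<alpha> \<circ> \<pi>) m = pcoef N \<alpha> m"
proof (induction m arbitrary: \<alpha> rule: mset_exp_induct)
  case zero
  have "(\<forall>i<N. (\<alpha> \<circ> \<pi>) i = 0) \<longleftrightarrow> (\<forall>i<N. \<alpha> i = 0)"
  proof -
    have "(\<forall>i\<in>{..<N}. (\<alpha> \<circ> \<pi>) i = 0) \<longleftrightarrow> (\<forall>i\<in>\<pi> ` {..<N}. \<alpha> i = 0)" by simp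
    then show ?thesis unfolding permutes_image[OF assms] by (simp only: Ball_def lessThan_iff)
  qed
  then show ?case by (simp add: pcoef_0)
next
  case (add m k)
  have "(\<alpha> \<circ> \<pi>)(i := x) = \<alpha>(\<pi> i := x) \<circ> \<pi>" for i :: nat and x
    using permutes_inj[OF assms] by (auto simp: fun_eq_iff inj_def)
  then have "pcoef N (\<alpha> \<circ> \<pi>) (m + unit_exp k) =
      (\<Sum>i<N. if Suc k \<le> \<alpha> (\<pi> i) then pcoef N (\<alpha>(\<pi> i := \<alpha> (\<pi> i) - Suc k)) m else 0)"
    unfolding pcoef_add by (intro sum.cong) (simp_all only: add o_apply)
  also have "\<dots> = pcoef N \<alpha> (m + unit_exp k)"
    unfolding pcoef_add
    using sum.permute[OF assms, of "\<lambda>i. if Suc k \<le> \<alpha> i then pcoef N (\<alpha>(i := \<alpha> i - Suc k)) m else 0"]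
    by (simp add: o_def)
  finally show ?case .
qed

lemma sum_fun_upd_less:
  fixes i N r :: nat
  assumes "i < N" "r \<le> \<alpha> i"
  shows "(\<Sum>l<N. \<alpha> l) = (\<Sum>l<N. (\<alpha>(i := \<alpha> i - r)) l) + r"
proof -
  have "(\<alpha>(i := \<alpha> i - r))(i := (\<alpha>(i := \<alpha> i - r)) i + r) = \<alpha>" using assms(2) by auto
  then show ?thesis using sum_fun_upd_add[OF assms(1), of "\<alpha>(i := \<alpha> i - r)" r] by (simp only:)
qed

lemma pcoef_add_nonzero:
  assumes "pcoef N \<alpha> (m + unit_exp k) \<noteq> 0"
  obtains i where "i < N" "Suc k \<le> \<alpha> i" "pcoef N (\<alpha>(i := \<alpha> i - Suc k)) m \<noteq> 0"
proof -
  obtain i where i: "i \<in> {..<N}" "(if Suc k \<le> \<alpha> i then pcoef N (\<alpha>(i := \<alpha> i - Suc k)) m else 0) \<noteq> 0"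
    using assms unfolding pcoef_add by (rule sum.not_neutral_contains_not_neutral)
  have "Suc k \<le> \<alpha> i" using i(2) by (rule contrapos_np) (simp only: if_False)
  show thesis
  proof (rule that)
    show "i < N" using i(1) by simp
    show "Suc k \<le> \<alpha> i" by fact
    show "pcoef N (\<alpha>(i := \<alpha> i - Suc k)) m \<noteq> 0" using i(2) \<open>Suc k \<le> \<alpha> i\<close> by (simp only: if_True not_False_eq_True)
  qed
qed

lemma pcoef_weight: "pcoef N \<alpha> m \<noteq> 0 \<Longrightarrow> p_weight m = (\<Sum>i<N. \<alpha> i)"
proof (induction m arbitrary: \<alpha> rule: mset_exp_induct)
  case zero
  then show ?case by (auto simp: pcoef_0 p_weight_eq_0_iff split: if_splits)
next
  case (add m k)
  then obtain i where i: "i < N" "Suc k \<le> \<alpha> i" "pcoef N (\<alpha>(i := \<alpha> i - Suc k)) m \<noteq> 0"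
    by (elim pcoef_add_nonzero)
  show ?case using add.IH[OF i(3)] sum_fun_upd_less[of i N "Suc k" \<alpha>] i by (simp add: add_unit_exp)
qed

text \<open>The type of an exponent vector: the key of the product of the p_(\<alpha>_i), where the
  multiplicity of the value k + 1 stands at k.\<close>

definition mults :: "nat \<Rightarrow> (nat \<Rightarrow> nat) \<Rightarrow> nat \<Rightarrow>\<^sub>0 nat" where
  "mults N \<alpha> = (\<Sum>i | i < N \<and> \<alpha> i \<noteq> 0. unit_exp (\<alpha> i - 1))"

lemma mlen_mults: "mlen (mults N \<alpha>) = card {i. i < N \<and> \<alpha> i \<noteq> 0}"
proof -
  have "mlen (sum f A) = (\<Sum>a\<in>A. mlen (f a))" for f :: "nat \<Rightarrow> nat \<Rightarrow>\<^sub>0 nat" and A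
    by (induction A rule: infinite_finite_induct) (simp_all add: mlen_add)
  then show ?thesis by (simp add: mults_def)
qed

lemma supp_upd:
  assumes "i < N" "\<alpha> i = Suc k"
  shows "{l. l < N \<and> \<alpha> l \<noteq> 0} = insert i {l. l < N \<and> (\<alpha>(i := 0)) l \<noteq> 0}"
    and "mults N \<alpha> = mults N (\<alpha>(i := 0)) + unit_exp k"
proof -
  show s: "{l. l < N \<and> \<alpha> l \<noteq> 0} = insert i {l. l < N \<and> (\<alpha>(i := 0)) l \<noteq> 0}"
    using assms by auto
  define a where "a = \<alpha>(i := 0)"
  have a: "a i = 0" "\<And>l. l \<noteq> i \<Longrightarrow> a l = \<alpha> l" by (simp_all add: a_def)
  have "mults N \<alpha> = (\<Sum>l\<in>insert i {l. l < N \<and> a l \<noteq> 0}. unit_exp (\<alpha> l - 1))"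
    unfolding mults_def s a_def ..
  also have "\<dots> = unit_exp (\<alpha> i - 1) + (\<Sum>l | l < N \<and> a l \<noteq> 0. unit_exp (\<alpha> l - 1))"
    by (rule sum.insert) (simp_all add: a(1))
  also have "(\<Sum>l | l < N \<and> a l \<noteq> 0. unit_exp (\<alpha> l - 1)) = mults N a"
    unfolding mults_def
  proof (intro sum.cong refl)
    fix l assume "l \<in> {l. l < N \<and> a l \<noteq> 0}"
    then have "a l = \<alpha> l" using a by (cases "l = i") auto
    then show "unit_exp (\<alpha> l - 1) = unit_exp (a l - 1)" by simp
  qed
  finally show "mults N \<alpha> = mults N (\<alpha>(i := 0)) + unit_exp k"
    unfolding a_def assms(2) by (simp only: diff_Suc_1 add.commute)
qed

text \<open>Expanding a product of power sums, each factor contributes to one variable, so a monomial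
  involves at most as many variables as there are factors.\<close>

lemma pcoef_triangular:
  assumes "pcoef N \<alpha> m \<noteq> 0"
  shows "card {i. i < N \<and> \<alpha> i \<noteq> 0} \<le> mlen m"
    and "card {i. i < N \<and> \<alpha> i \<noteq> 0} = mlen m \<Longrightarrow> mults N \<alpha> = m"
proof -
  let ?s = "\<lambda>\<alpha>. {i. i < N \<and> \<alpha> i \<noteq> (0::nat)}"
  have "card (?s \<alpha>) \<le> mlen m \<and> (card (?s \<alpha>) = mlen m \<longrightarrow> mults N \<alpha> = m)"
    using assms
  proof (induction m arbitrary: \<alpha> rule: mset_exp_induct)
    case zero
    then have "?s \<alpha> = {}" by (auto simp: pcoef_0 split: if_splits)
    then show ?case unfolding mults_def by simp
  next
    case (add m k)
    then obtain i where i: "i < N" "Suc k \<le> \<alpha> i" "pcoef N (\<alpha>(i := \<alpha> i - Suc k)) m \<noteq> 0"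
      by (elim pcoef_add_nonzero)
    define a where "a = \<alpha>(i := \<alpha> i - Suc k)"
    have a: "a i = \<alpha> i - Suc k" "\<And>l. l \<noteq> i \<Longrightarrow> a l = \<alpha> l" by (simp_all add: a_def)
    note IH = add.IH[OF i(3), folded a_def]
    have s: "?s \<alpha> = insert i (?s a)"
    proof (intro equalityI subsetI)
      fix l assume "l \<in> ?s \<alpha>"
      then show "l \<in> insert i (?s a)" using a(2)[of l] by (cases "l = i") auto
    next
      fix l assume "l \<in> insert i (?s a)"
      then show "l \<in> ?s \<alpha>" using i(1,2) a(2)[of l] by (cases "l = i") auto
    qed
    have f: "finite (?s a)" by simp
    show ?case
    proof (cases "\<alpha> i = Suc k")
      case True
      have "i \<notin> ?s a" using True a(1) by simp
      then have c: "card (?s \<alpha>) = Suc (card (?s a))" unfolding s using f by (rule card_insert_disjoint[rotated])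
      have "mults N \<alpha> = mults N a + unit_exp k"
        using supp_upd(2)[of i N \<alpha> k, OF i(1) True] unfolding a_def True by (simp only: diff_self_eq_0)
      then show ?thesis using IH c by (simp add: mlen_add)
    next
      case False
      then have "i \<in> ?s a" using i(1,2) a(1) by simp
      then have "?s \<alpha> = ?s a" unfolding s by (rule insert_absorb)
      then show ?thesis using IH by (simp add: mlen_add)
    qed
  qed
  then show "card (?s \<alpha>) \<le> mlen m" "card (?s \<alpha>) = mlen m \<Longrightarrow> mults N \<alpha> = m" by auto
qed

lemma lookup_mults: "lookup (mults N \<alpha>) k = card {i. i < N \<and> \<alpha> i = Suc k}"
proof -
  have "lookup (mults N \<alpha>) k = (\<Sum>i | i < N \<and> \<alpha> i \<noteq> 0. if \<alpha> i = Suc k then 1 else 0)"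
    unfolding mults_def lookup_sum by (intro sum.cong) (auto simp: lookup_single when_def)
  also have "\<dots> = card ({i. i < N \<and> \<alpha> i \<noteq> 0} \<inter> {i. \<alpha> i = Suc k})"
    by (simp add: sum.If_cases)
  also have "{i. i < N \<and> \<alpha> i \<noteq> 0} \<inter> {i. \<alpha> i = Suc k} = {i. i < N \<and> \<alpha> i = Suc k}" by auto
  finally show ?thesis .
qed

text \<open>Matching each factor with an entry of its own size gives one positive contribution, and
  all the others are nonnegative.\<close>

lemma pcoef_mults_pos: "mults N \<alpha> = m \<Longrightarrow> pcoef N \<alpha> m > 0"
proof (induction m arbitrary: \<alpha> rule: mset_exp_induct)
  case zero
  then have "mlen (mults N \<alpha>) = 0" by simp
  then have "{i. i < N \<and> \<alpha> i \<noteq> 0} = {}" unfolding mlen_mults by simp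
  then show ?case by (auto simp: pcoef_0)
next
  case (add m k)
  then have "lookup (mults N \<alpha>) k > 0" by (simp add: lookup_add)
  then have "{i. i < N \<and> \<alpha> i = Suc k} \<noteq> {}" unfolding lookup_mults by (metis card.empty less_irrefl)
  then obtain i where i: "i < N" "\<alpha> i = Suc k" by auto
  have "mults N (\<alpha>(i := 0)) = m" using supp_upd(2)[of i N \<alpha> k, OF i] add.prems by (metis add_right_cancel)
  then have "pcoef N (\<alpha>(i := \<alpha> i - Suc k)) m > 0" unfolding i(2) diff_self_eq_0 by (rule add.IH)
  then have "0 < (if Suc k \<le> \<alpha> i then pcoef N (\<alpha>(i := \<alpha> i - Suc k)) m else 0)" using i by simp
  also have "\<dots> \<le> pcoef N \<alpha> (m + unit_exp k)"
    unfolding pcoef_add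
    by (rule member_le_sum[of i "{..<N}" "\<lambda>i. if Suc k \<le> \<alpha> i then pcoef N (\<alpha>(i := \<alpha> i - Suc k)) m else 0"])
      (use i(1) in \<open>simp_all add: pcoef_nonneg\<close>)
  finally show ?case .
qed

text \<open>The parts are written one by one into fresh positions and then sorted. There is room,
  since a product of power sums has at most as many factors as its weight.\<close>

lemma ex_parts_mults:
  obtains \<nu> where "\<nu> \<in> parts (p_weight m) (p_weight m)" "mults (p_weight m) \<nu> = m"
proof -
  have "\<exists>\<alpha>. (\<forall>i\<ge>mlen m. \<alpha> i = 0) \<and> mults (mlen m) \<alpha> = m"
  proof (induction m rule: mset_exp_induct)
    case zero
    then show ?case by (intro exI[of _ "\<lambda>_. 0"]) (simp add: mults_def)
  next
    case (add m k)
    then obtain \<alpha> where a: "\<forall>i\<ge>mlen m. \<alpha> i = 0" "mults (mlen m) \<alpha> = m" by blast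
    let ?a = "\<alpha>(mlen m := Suc k)"
    have "{i. i < mlen m \<and> \<alpha> i \<noteq> 0} = {i. i < Suc (mlen m) \<and> (?a(mlen m := 0)) i \<noteq> 0}"
      using a by auto
    then have "mults (Suc (mlen m)) (?a(mlen m := 0)) = mults (mlen m) \<alpha>"
      unfolding mults_def by (intro sum.cong) auto
    then have "mults (Suc (mlen m)) ?a = m + unit_exp k"
      using supp_upd(2)[of "mlen m" "Suc (mlen m)" ?a k] a(2) by (simp only: fun_upd_same lessI)
    moreover have "\<forall>i\<ge>Suc (mlen m). ?a i = 0" using a(1) by simp
    moreover have "mlen (m + unit_exp k) = Suc (mlen m)" by (simp add: mlen_add)
    ultimately show ?case by metis
  qed
  then obtain \<alpha> where a: "\<forall>i\<ge>mlen m. \<alpha> i = 0" "mults (mlen m) \<alpha> = m" by blast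
  have le: "mlen m \<le> p_weight m"
    unfolding mlen_def p_weight_def by (intro sum_mono) auto
  let ?N = "p_weight m"
  have "{i. i < mlen m \<and> \<alpha> i \<noteq> 0} = {i. i < ?N \<and> \<alpha> i \<noteq> 0}"
    using supp_less[OF a(1)] le by (auto intro: less_le_trans)
  then have m: "mults ?N \<alpha> = m" using a(2) by (simp add: mults_def)
  have "pcoef ?N \<alpha> m \<noteq> 0" using pcoef_mults_pos[OF m] by simp
  then have "\<alpha> \<in> weak_comps ?N ?N"
    using pcoef_weight[of ?N \<alpha> m] a le by (auto simp: weak_comps_def)
  then obtain \<nu> \<pi> where \<nu>: "\<nu> \<in> parts ?N ?N" "\<pi> permutes {..<?N}" "\<alpha> = \<nu> \<circ> \<pi>"
    by (rule sort_weak_comp)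
  have "mults ?N \<nu> = m"
  proof (rule poly_mapping_eqI)
    fix k
    have "\<pi> ` {i. i < ?N \<and> \<alpha> i = Suc k} = {i. i < ?N \<and> \<nu> i = Suc k}"
    proof (intro equalityI subsetI)
      fix i assume "i \<in> {i. i < ?N \<and> \<nu> i = Suc k}"
      moreover have "i \<in> \<pi> ` {..<?N}" using calculation unfolding permutes_image[OF \<nu>(2)] by simp
      then obtain j where "j < ?N" "i = \<pi> j" by auto
      ultimately show "i \<in> \<pi> ` {i. i < ?N \<and> \<alpha> i = Suc k}" by (auto simp: \<nu>(3))
    qed (use permutes_in_image[OF \<nu>(2)] in \<open>auto simp: \<nu>(3)\<close>)
    then have "card {i. i < ?N \<and> \<alpha> i = Suc k} = card {i. i < ?N \<and> \<nu> i = Suc k}"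
      using card_image[OF inj_on_subset[OF permutes_inj[OF \<nu>(2)] subset_UNIV], of "{i. i < ?N \<and> \<alpha> i = Suc k}"] by simp
    then show "lookup (mults ?N \<nu>) k = lookup m k"
      using lookup_mults[of ?N \<nu> k] lookup_mults[of ?N \<alpha> k] unfolding m by (simp only:)
  qed
  then show ?thesis using that \<nu>(1) by blast
qed

lemma parts_eq_if_mults_eq:
  assumes "\<nu> \<in> parts N d" "\<nu>' \<in> parts N d" "mults N \<nu> = mults N \<nu>'"
  shows "\<nu> = \<nu>'"
proof (rule partition_eqI)
  show "is_partition \<nu>" "is_partition \<nu>'" using assms by (auto simp: parts_def)
  fix j :: nat assume j: "j \<ge> 1"
  have c: "card {i. j \<le> \<alpha> i} = (\<Sum>k | k < d \<and> j \<le> Suc k. lookup (mults N \<alpha>) k)"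
    if "\<alpha> \<in> parts N d" for \<alpha>
  proof -
    have w: "\<alpha> \<in> weak_comps N d" using that parts_subset by blast
    have le: "\<alpha> i \<le> d" "i < N" if "\<alpha> i \<noteq> 0" for i
    proof -
      show "i < N" using that w supp_less[of N \<alpha> i] by (auto simp: weak_comps_def)
      then show "\<alpha> i \<le> d" using w member_le_sum[of i "{..<N}" \<alpha>] by (auto simp: weak_comps_def)
    qed
    have "{i. j \<le> \<alpha> i} = (\<Union>k\<in>{k. k < d \<and> j \<le> Suc k}. {i. i < N \<and> \<alpha> i = Suc k})"
    proof (intro equalityI subsetI)
      fix i assume "i \<in> {i. j \<le> \<alpha> i}"
      then show "i \<in> (\<Union>k\<in>{k. k < d \<and> j \<le> Suc k}. {i. i < N \<and> \<alpha> i = Suc k})"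
        using j le[of i] by (cases "\<alpha> i") auto
    qed auto
    also have "card \<dots> = (\<Sum>k | k < d \<and> j \<le> Suc k. card {i. i < N \<and> \<alpha> i = Suc k})"
      by (rule card_UN_disjoint) auto
    finally show ?thesis by (simp add: lookup_mults)
  qed
  show "card {i. j \<le> \<nu> i} = card {i. j \<le> \<nu>' i}"
    unfolding c[OF assms(1)] c[OF assms(2)] assms(3) ..
qed

section \<open>The Cauchy kernel in power sums\<close>

lemma sum_mset_exp:
  fixes F :: "(nat \<Rightarrow>\<^sub>0 nat) \<Rightarrow> nat \<Rightarrow> 'a::comm_monoid_add"
  shows "(\<Sum>m | p_weight m = d. \<Sum>k\<in>keys m. F m k) =
    (\<Sum>k<d. \<Sum>m | p_weight m = d - Suc k. F (m + unit_exp k) k)"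
proof -
  have "(\<Sum>m | p_weight m = d. \<Sum>k\<in>keys m. F m k) =
      (\<Sum>(m, k)\<in>(SIGMA m:{m. p_weight m = d}. keys m). F m k)"
    by (rule sum.Sigma) (auto simp: finite_p_weight)
  also have "\<dots> = (\<Sum>(k, m)\<in>(SIGMA k:{..<d}. {m. p_weight m = d - Suc k}). F (m + unit_exp k) k)"
  proof (rule sum.reindex_bij_witness[where j = "\<lambda>(m, k). (k, m - unit_exp k)" and i = "\<lambda>(k, m). (m + unit_exp k, k)"])
    fix a assume "a \<in> (SIGMA m:{m. p_weight m = d}. keys m)"
    then obtain m k where a: "a = (m, k)" "p_weight m = d" "k \<in> keys m" by auto
    note e = minus_unit_exp[OF a(3)]
    have "d = p_weight (m - unit_exp k) + Suc k"
      using add_unit_exp(1)[of "m - unit_exp k" k] e a(2) by simp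
    then show "(case case a of (m, k) \<Rightarrow> (k, m - unit_exp k) of (k, m) \<Rightarrow> (m + unit_exp k, k)) = a"
      "(case a of (m, k) \<Rightarrow> (k, m - unit_exp k)) \<in> (SIGMA k:{..<d}. {m. p_weight m = d - Suc k})"
      "(case case a of (m, k) \<Rightarrow> (k, m - unit_exp k) of (k, m) \<Rightarrow> F (m + unit_exp k) k) = (case a of (m, k) \<Rightarrow> F m k)"
      using e by (simp_all add: a(1))
  next
    fix b assume "b \<in> (SIGMA k:{..<d}. {m. p_weight m = d - Suc k})"
    then obtain k m where b: "b = (k, m)" "k < d" "p_weight m = d - Suc k" by auto
    then show "(case case b of (k, m) \<Rightarrow> (m + unit_exp k, k) of (m, k) \<Rightarrow> (k, m - unit_exp k)) = b"
      "(case b of (k, m) \<Rightarrow> (m + unit_exp k, k)) \<in> (SIGMA m:{m. p_weight m = d}. keys m)"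
      by (auto simp: add_unit_exp in_keys_iff lookup_add)
  qed
  also have "\<dots> = (\<Sum>k<d. \<Sum>m | p_weight m = d - Suc k. F (m + unit_exp k) k)"
    by (rule sum.Sigma[symmetric]) (auto simp: finite_p_weight)
  finally show ?thesis .
qed

text \<open>\<open>K\<close> is the exponential exp(\<Sum> Q_(k-1) w^k / k), summed over k \<ge> 1,
  with \<open>c m\<close> as 1/z_m. Its Euler derivative marks one part of \<open>m\<close>,
  weighted by its size; removing that part turns 1/z_m into the coefficient of the rest.\<close>

lemma euler_power_sum_expansion:
  fixes c :: "(nat \<Rightarrow>\<^sub>0 nat) \<Rightarrow> 'a::comm_ring_1" and Q :: "nat \<Rightarrow> 'a"
  assumes c: "\<And>m. of_nat (z_factor m) * c m = 1"
  defines "K \<equiv> Abs_fps (\<lambda>d. \<Sum>m | p_weight m = d. c m * pow_mset Q m)"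
  shows "euler K = K * Abs_fps (\<lambda>k. if k = 0 then 0 else Q (k - 1))"
proof (rule fps_ext)
  fix d
  let ?L = "Abs_fps (\<lambda>k. if k = 0 then 0 else Q (k - 1))"
  have cz: "of_nat (Suc k * Suc (lookup m k)) * c (m + unit_exp k) = c m" for m k
  proof -
    let ?x = "of_nat (Suc k * Suc (lookup m k)) :: 'a"
    have "of_nat (z_factor m) * ?x * c (m + unit_exp k) = 1"
      using c[of "m + unit_exp k"] unfolding add_unit_exp of_nat_mult .
    then have "c m * (of_nat (z_factor m) * ?x * c (m + unit_exp k)) = c m" by simp
    moreover have "c m * (of_nat (z_factor m) * ?x * c (m + unit_exp k)) =
        of_nat (z_factor m) * c m * (?x * c (m + unit_exp k))" by (simp only: mult_ac)
    ultimately show ?thesis unfolding c by simp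
  qed
  have "fps_nth (euler K) d = (\<Sum>m | p_weight m = d. \<Sum>k\<in>keys m.
      of_nat (Suc k * lookup m k) * c m * pow_mset Q m)"
  proof -
    have "of_nat d * (c m * pow_mset Q m) = (\<Sum>k\<in>keys m.
        of_nat (Suc k * lookup m k) * c m * pow_mset Q m)" if "p_weight m = d" for m
      unfolding that[symmetric] p_weight_def by (simp only: of_nat_sum sum_distrib_right mult.assoc)
    then show ?thesis unfolding K_def euler_nth fps_nth_Abs_fps sum_distrib_left by (intro sum.cong) auto
  qed
  also have "\<dots> = (\<Sum>k<d. \<Sum>m | p_weight m = d - Suc k. Q k * (c m * pow_mset Q m))"
    unfolding sum_mset_exp
  proof (intro sum.cong refl)
    fix k and m :: "nat \<Rightarrow>\<^sub>0 nat"
    have "lookup (m + unit_exp k) k = Suc (lookup m k)"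
      by (simp add: lookup_add)
    then show "of_nat (Suc k * lookup (m + unit_exp k) k) * c (m + unit_exp k) * pow_mset Q (m + unit_exp k)
        = Q k * (c m * pow_mset Q m)"
      unfolding pow_mset_add pow_mset_unit using cz[of k m] by (simp only: mult_ac)
  qed
  also have "\<dots> = (\<Sum>k<d. Q k * fps_nth K (d - Suc k))"
    by (simp add: K_def sum_distrib_left)
  also have "\<dots> = (\<Sum>k\<le>d. fps_nth ?L k * fps_nth K (d - k))"
    by (subst sum.atMost_shift) simp
  also have "\<dots> = fps_nth (K * ?L) d"
    by (subst mult.commute) (simp add: fps_mult_nth atLeast0AtMost)
  finally show "fps_nth (euler K) d = fps_nth (K * ?L) d" .
qed

lemma pow_mset_hom:
  assumes "\<And>a b. h (a * b) = h a * h b" "h 1 = 1"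
  shows "pow_mset (\<lambda>k. h (P k)) m = h (pow_mset P m)"
  by (induction m rule: mset_exp_induct) (simp_all add: pow_mset_0 pow_mset_add pow_mset_unit assms)

text \<open>The coefficient of p_m(x) p_m(y) in the kernel, and by \<open>theta_inverse\<close> the
  reciprocal of the squared norm of p_m.\<close>

definition theta :: "(nat \<Rightarrow>\<^sub>0 nat) \<Rightarrow> qt_field" where
  "theta m = pow_mset (\<lambda>k. pw (Suc k)) m / of_nat (z_factor m)"

definition px :: "nat \<Rightarrow> nat \<Rightarrow> xpoly" where "px n k = (\<Sum>j<n. xvar j ^ Suc k)"

lemma px_eq_psum: "px n = psum n"
  by (rule ext) (simp only: px_def psum_def xvar_power)

text \<open>The kernel in n variables x and \<open>N\<close> variables z is expanded twice, as a
  product of generating series over the z_i and as \<Sum> \<theta>_m p_m(x) p_m(z). Equal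
  logarithmic Euler derivatives identify the two, and the coefficient of z^\<alpha> is
  compared.\<close>

lemma prod_gsym:
  "(\<Prod>i<N. gsym n (\<alpha> i)) =
    (\<Sum>m | p_weight m = (\<Sum>i<N. \<alpha> i). Const (of_int (pcoef N \<alpha> m) * theta m) * pow_mset (px n) m)"
proof -
  define \<beta> where "\<beta> = (\<lambda>i. if i < N then \<alpha> i else 0)"
  have b: "\<forall>i\<ge>N. \<beta> i = 0" "(\<Sum>i<N. \<beta> i) = (\<Sum>i<N. \<alpha> i)" "mkey N \<beta> = mkey N \<alpha>"
    "(\<Prod>i<N. gsym n (\<beta> i)) = (\<Prod>i<N. gsym n (\<alpha> i))"
    by (auto simp: \<beta>_def mkey_eq_iff)
  define P where "P = (\<lambda>k. px n k * Const (pw (Suc k)))"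
  define Q where "Q = (\<lambda>k. cst (P k) * psum N k)"
  define c where "c = (\<lambda>m. cst (Const (1 / of_nat (z_factor m))))"
  define K where "K = Abs_fps (\<lambda>d. \<Sum>m | p_weight m = d. c m * pow_mset Q m)"
  have "of_nat j = cst (Const (of_nat j))" for j
    by (induction j) (simp_all add: cst_hom Const_add Const_0 Const_1)
  then have "of_nat (z_factor m) * c m = 1" for m
    using z_factor_pos[of m] by (simp add: c_def cst_hom(2)[symmetric] Const_mult[symmetric] cst_hom(4) Const_1 del: of_nat_mult)
  then have eK: "euler K = K * Abs_fps (\<lambda>k. if k = 0 then 0 else Q (k - 1))"
    unfolding K_def by (rule euler_power_sum_expansion)
  have eF: "euler (\<Prod>i<N. fps_at i (gfps n)) = (\<Prod>i<N. fps_at i (gfps n)) * (\<Sum>i<N. fps_at i (power_fps n))"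
    by (rule euler_prod) (simp_all add: euler_fps_at euler_gfps fps_at_mult)
  have L: "(\<Sum>i<N. fps_at i (power_fps n)) = Abs_fps (\<lambda>k. if k = 0 then 0 else Q (k - 1))"
  proof (rule fps_ext)
    fix k
    show "fps_nth (\<Sum>i<N. fps_at i (power_fps n)) k = fps_nth (Abs_fps (\<lambda>k. if k = 0 then 0 else Q (k - 1))) k"
    proof (cases k)
      case 0
      then show ?thesis by (simp add: fps_sum_nth power_fps_def)
    next
      case (Suc l)
      then have "fps_nth (\<Sum>i<N. fps_at i (power_fps n)) k = (\<Sum>i<N. single (single i (Suc l)) (P l))"
        by (simp add: fps_sum_nth power_fps_def P_def px_def)
      also have "\<dots> = Q l"
        unfolding Q_def psum_def cst_def sum_distrib_left by (simp add: mult_single)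
      finally show ?thesis using Suc by simp
    qed
  qed
  have "fps_nth (\<Prod>i<N. fps_at i (gfps n)) 0 = (\<Prod>i<N. fps_nth (fps_at i (gfps n)) 0)"
    by (induction N) simp_all
  then have "(\<Prod>i<N. fps_at i (gfps n)) = K"
    by (intro euler_unique[OF eF[unfolded L] eK])
      (simp_all add: gfps_def gsym_0 K_def p_weight_eq_0_iff pow_mset_0 c_def z_factor_def Const_1 cst_hom)
  then have "(\<Prod>i<N. gsym n (\<alpha> i)) = lookup (fps_nth K (\<Sum>i<N. \<alpha> i)) (mkey N \<alpha>)"
    using lookup_prod_at[OF b(1), of "\<lambda>_. gfps n" "\<Sum>i<N. \<alpha> i"] unfolding b by (simp add: gfps_def b)
  also have "\<dots> = (\<Sum>m | p_weight m = (\<Sum>i<N. \<alpha> i). Const (of_int (pcoef N \<alpha> m) * theta m) * pow_mset (px n) m)"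
  proof -
    have "lookup (c m * pow_mset Q m) (mkey N \<alpha>) = Const (of_int (pcoef N \<alpha> m) * theta m) * pow_mset (px n) m" for m
    proof -
      have I: "(of_int i :: xpoly) = Const (of_int i)" for i
      proof -
        have "(of_nat k :: xpoly) = Const (of_nat k)" for k
          by (induction k) (simp_all add: Const_add Const_0 Const_1)
        moreover have "Const (- a) = - Const a" for a by (simp add: Const_eq_cst cst_hom)
        ultimately show ?thesis by (cases i rule: int_cases2) simp_all
      qed
      have "pow_mset Q m = cst (pow_mset P m) * pow_mset (psum N) m"
        unfolding Q_def pow_mset_mult by (subst pow_mset_hom) (simp_all add: cst_hom)
      then have "lookup (c m * pow_mset Q m) (mkey N \<alpha>) =
          Const (1 / of_nat (z_factor m)) * (pow_mset P m * of_int (pcoef N \<alpha> m))"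
        by (simp only: c_def mult.assoc lookup_cst_mult lookup_pow_psum)
      also have "pow_mset P m = pow_mset (px n) m * Const (pow_mset (\<lambda>k. pw (Suc k)) m)"
        unfolding P_def pow_mset_mult by (subst pow_mset_hom) (simp_all add: Const_mult Const_1)
      finally show ?thesis
        by (simp only: I theta_def Const_mult divide_inverse mult_1_left mult_ac)
    qed
    then show ?thesis by (simp only: K_def fps_nth_Abs_fps lookup_sum)
  qed
  finally show ?thesis .
qed

text \<open>Lifts g_\<alpha> from polynomials in n variables to the ring of symmetric functions,
  where the scalar product and the characterization of P_\<lambda> live.\<close>

definition gfun :: "nat \<Rightarrow> (nat \<Rightarrow> nat) \<Rightarrow> symfun" where
  "gfun N \<alpha> = (\<Sum>m | p_weight m = (\<Sum>i<N. \<alpha> i). single m (of_int (pcoef N \<alpha> m) * theta m))"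

lemma lookup_gfun: "lookup (gfun N \<alpha>) m = of_int (pcoef N \<alpha> m) * theta m"
proof -
  have "lookup (gfun N \<alpha>) m = (\<Sum>m' | p_weight m' = (\<Sum>i<N. \<alpha> i).
      if m' = m then of_int (pcoef N \<alpha> m) * theta m else 0)"
    unfolding gfun_def lookup_sum by (intro sum.cong) (auto simp: lookup_single when_def)
  also have "\<dots> = (if p_weight m = (\<Sum>i<N. \<alpha> i) then of_int (pcoef N \<alpha> m) * theta m else 0)"
    by (simp add: finite_p_weight)
  also have "\<dots> = of_int (pcoef N \<alpha> m) * theta m"
    using pcoef_weight[of N \<alpha> m] by (cases "pcoef N \<alpha> m = 0") auto
  finally show ?thesis .
qed

lemma pleth_Xalph:
  assumes "finite A" "keys f \<subseteq> A"
  shows "pleth f (Xalph n) = (\<Sum>m\<in>A. Const (lookup f m) * pow_mset (px n) m)"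
proof -
  have "pleth f (Xalph n) = (\<Sum>m\<in>keys f. Const (lookup f m) * pow_mset (px n) m)"
    unfolding pleth_def pow_mset_def p_pleth_Xalph px_def ..
  also have "\<dots> = (\<Sum>m\<in>A. Const (lookup f m) * pow_mset (px n) m)"
    using assms by (intro sum.mono_neutral_left) (auto simp: in_keys_iff Const_0)
  finally show ?thesis .
qed

lemma keys_gfun: "keys (gfun N \<alpha>) \<subseteq> {m. p_weight m = (\<Sum>i<N. \<alpha> i)}"
  using pcoef_weight by (auto simp: in_keys_iff lookup_gfun)

lemma pleth_gfun: "pleth (gfun N \<alpha>) (Xalph n) = (\<Prod>i<N. gsym n (\<alpha> i))"
  unfolding pleth_Xalph[OF finite_p_weight keys_gfun] lookup_gfun prod_gsym ..

lemma pleth_add: "pleth (f + g) (Xalph n) = pleth f (Xalph n) + pleth g (Xalph n)"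
proof -
  let ?A = "keys f \<union> keys g"
  have A: "finite ?A" "keys f \<subseteq> ?A" "keys g \<subseteq> ?A" "keys (f + g) \<subseteq> ?A"
    using keys_add[of f g] by auto
  show ?thesis
    unfolding pleth_Xalph[OF A(1,2)] pleth_Xalph[OF A(1,3)] pleth_Xalph[OF A(1,4)]
    by (simp add: lookup_add Const_add distrib_right sum.distrib)
qed

lemma pleth_scale: "pleth (Const c * f) (Xalph n) = Const c * pleth f (Xalph n)"
proof -
  have k: "keys (Const c * f) \<subseteq> keys f"
    by (auto simp: in_keys_iff lookup_Const_mult)
  show ?thesis
    unfolding pleth_Xalph[OF finite_keys[of f] k] pleth_Xalph[OF finite_keys subset_refl, of f] lookup_Const_mult
    by (simp add: Const_mult sum_distrib_left mult.assoc)
qed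

definition mcoef :: "nat \<Rightarrow> (nat \<Rightarrow> nat) \<Rightarrow> symfun \<Rightarrow> qt_field" where
  "mcoef N \<gamma> f = (\<Sum>m\<in>keys f. lookup f m * of_int (pcoef N \<gamma> m))"

lemma lookup_pleth: "lookup (pleth f (Xalph n)) (mkey n \<gamma>) = mcoef n \<gamma> f"
  unfolding mcoef_def pleth_Xalph[OF finite_keys subset_refl] lookup_sum lookup_Const_mult px_eq_psum lookup_pow_psum ..

lemma mcoef_alt: "finite A \<Longrightarrow> keys f \<subseteq> A \<Longrightarrow>
    mcoef N \<gamma> f = (\<Sum>m\<in>A. lookup f m * of_int (pcoef N \<gamma> m))"
  unfolding mcoef_def by (rule sum.mono_neutral_left) (auto simp: in_keys_iff)

lemma mcoef_add: "mcoef N \<gamma> (f + g) = mcoef N \<gamma> f + mcoef N \<gamma> g"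
proof -
  let ?A = "keys f \<union> keys g"
  have A: "finite ?A" "keys f \<subseteq> ?A" "keys g \<subseteq> ?A" "keys (f + g) \<subseteq> ?A"
    using keys_add[of f g] by auto
  show ?thesis
    unfolding mcoef_alt[OF A(1,2)] mcoef_alt[OF A(1,3)] mcoef_alt[OF A(1,4)]
    by (simp add: lookup_add distrib_right sum.distrib)
qed

lemma mcoef_scale: "mcoef N \<gamma> (Const c * f) = c * mcoef N \<gamma> f"
proof -
  have k: "keys (Const c * f) \<subseteq> keys f"
    by (auto simp: in_keys_iff lookup_Const_mult)
  show ?thesis
    unfolding mcoef_alt[OF finite_keys[of f] k] mcoef_def[of _ _ f] lookup_Const_mult by (simp add: sum_distrib_left mult.assoc)
qed

lemma mcoef_extend: "\<forall>i\<ge>N. \<gamma> i = 0 \<Longrightarrow> N \<le> N' \<Longrightarrow> mcoef N' \<gamma> f = mcoef N \<gamma> f"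
  by (simp only: mcoef_def pcoef_extend[of N \<gamma> N'])

lemma mcoef_permute: "\<pi> permutes {..<N} \<Longrightarrow> mcoef N (\<gamma> \<circ> \<pi>) f = mcoef N \<gamma> f"
  by (simp add: mcoef_def pcoef_permute)

section \<open>The scalar product and the Gram matrix of the g_\<nu>\<close>

lemma theta_inverse:
  "theta m * (of_nat (z_factor m) * (\<Prod>k\<in>keys m. ((1 - qpar ^ Suc k) / (1 - tpar ^ Suc k)) ^ lookup m k)) = 1"
proof -
  have one: "pw (Suc k) * ((1 - qpar ^ Suc k) / (1 - tpar ^ Suc k)) = 1" for k
  proof -
    have "1 - qpar ^ Suc k \<noteq> 0" "1 - tpar ^ Suc k \<noteq> 0"
      using qpar_power_neq_1[of "Suc k"] tpar_power_neq_1[of "Suc k"] by auto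
    moreover have "pw (Suc k) = (1 - tpar ^ Suc k) / (1 - qpar ^ Suc k)"
      unfolding pw_def by (metis minus_diff_eq minus_divide_divide)
    ultimately show ?thesis by (simp del: power_Suc)
  qed
  then have "pow_mset (\<lambda>k. pw (Suc k) * ((1 - qpar ^ Suc k) / (1 - tpar ^ Suc k))) m = 1"
    by (simp only: pow_mset_def one power_one prod.neutral_const)
  then have e: "pow_mset (\<lambda>k. pw (Suc k)) m * (\<Prod>k\<in>keys m. ((1 - qpar ^ Suc k) / (1 - tpar ^ Suc k)) ^ lookup m k) = 1"
    unfolding pow_mset_mult by (simp only: pow_mset_def)
  have "of_nat (z_factor m) \<noteq> (0 :: qt_field)" using z_factor_pos[of m] by simp
  then show ?thesis using e unfolding theta_def by (simp only: times_divide_eq_left nonzero_mult_div_cancel_left mult.left_commute mult.assoc) simp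
qed

lemma theta_nonzero: "theta m \<noteq> 0"
  using theta_inverse[of m] by auto

lemma qt_inner_alt:
  assumes "finite A" "keys f \<subseteq> A \<or> keys g \<subseteq> A"
  shows "qt_inner f g = (\<Sum>m\<in>A. lookup f m * lookup g m / theta m)"
proof -
  have "qt_inner f g = (\<Sum>m\<in>keys f \<inter> keys g. lookup f m * lookup g m / theta m)"
    unfolding qt_inner_def
  proof (intro sum.cong refl)
    fix m
    have "of_nat (z_factor m) * (\<Prod>k\<in>keys m. ((1 - qpar ^ Suc k) / (1 - tpar ^ Suc k)) ^ lookup m k) = 1 / theta m"
      by (subst nonzero_eq_divide_eq[OF theta_nonzero], subst mult.commute, rule theta_inverse)
    then show "lookup f m * lookup g m * of_nat (z_factor m) *
     (\<Prod>k\<in>keys m. ((1 - qpar ^ Suc k) / (1 - tpar ^ Suc k)) ^ lookup m k) =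
     lookup f m * lookup g m / theta m" by (simp only: mult.assoc times_divide_eq_right mult_1_right)
  qed
  also have "\<dots> = (\<Sum>m\<in>A. lookup f m * lookup g m / theta m)"
    using assms by (intro sum.mono_neutral_left) (auto simp: in_keys_iff)
  finally show ?thesis .
qed

lemma qt_inner_sym: "qt_inner f g = qt_inner g f"
  using qt_inner_alt[of "keys f" f g] qt_inner_alt[of "keys f" g f]
  by (simp add: mult.commute)

text \<open>Duality of the g_\<alpha> and the monomial functions: \<open>theta m\<close> in the
  coefficient of g_\<alpha> cancels the squared norm of p_m and leaves the integer
  \<open>pcoef\<close>.\<close>

lemma qt_inner_gfun: "qt_inner (gfun N \<alpha>) f = mcoef N \<alpha> f"
  by (simp add: qt_inner_alt[of "keys f"] mcoef_def lookup_gfun theta_nonzero mult.commute)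

lemma qt_inner_add_left: "qt_inner (f + g) h = qt_inner f h + qt_inner g h"
  by (simp add: qt_inner_alt[of "keys h"] lookup_add distrib_right add_divide_distrib sum.distrib)

lemma qt_inner_scale_left: "qt_inner (Const c * f) h = c * qt_inner f h"
  by (simp add: qt_inner_alt[of "keys h"] lookup_Const_mult sum_distrib_left mult.assoc)

text \<open>By duality the coefficient of x^\<gamma> in g_\<alpha> is also the scalar product of
  g_\<alpha> and g_\<gamma>. Symmetry comes from the second reading.\<close>

definition gram :: "nat \<Rightarrow> (nat \<Rightarrow> nat) \<Rightarrow> (nat \<Rightarrow> nat) \<Rightarrow> qt_field" where
  "gram N \<alpha> \<gamma> = mcoef N \<gamma> (gfun N \<alpha>)"

lemma gram_sym: "gram N \<alpha> \<gamma> = gram N \<gamma> \<alpha>"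
  unfolding gram_def qt_inner_gfun[symmetric] by (rule qt_inner_sym)

lemma gcoef_eq_gram: "gcoef n \<alpha> \<gamma> = gram n \<alpha> \<gamma>"
  by (simp add: gcoef_def gram_def lookup_pleth[symmetric] pleth_gfun)

lemma gfun_permute: "\<pi> permutes {..<N} \<Longrightarrow> gfun N (\<alpha> \<circ> \<pi>) = gfun N \<alpha>"
  by (rule poly_mapping_eqI) (simp add: lookup_gfun pcoef_permute)

lemma gfun_extend: "\<forall>i\<ge>N. \<alpha> i = 0 \<Longrightarrow> N \<le> N' \<Longrightarrow> gfun N' \<alpha> = gfun N \<alpha>"
  by (rule poly_mapping_eqI) (simp only: lookup_gfun pcoef_extend[of N \<alpha> N'])

text \<open>Choose a power-sum product in \<open>f\<close> with the largest number of factors. By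
  \<open>pcoef_triangular\<close> no other product in \<open>f\<close> reaches the monomial of the
  same type, so its coefficient cannot vanish.\<close>

lemma mcoef_separates:
  assumes "\<And>d \<nu>. \<nu> \<in> parts d d \<Longrightarrow> mcoef d \<nu> f = 0"
  shows "f = 0"
proof (rule ccontr)
  assume "f \<noteq> 0"
  then have K: "keys f \<noteq> {}" "finite (keys f)" by simp_all
  then have "Max (mlen ` keys f) \<in> mlen ` keys f" by (intro Max_in) auto
  then obtain m where m: "m \<in> keys f" "mlen m = Max (mlen ` keys f)" by auto
  have mx: "mlen m' \<le> mlen m" if "m' \<in> keys f" for m'
    unfolding m(2) using that K by (intro Max_ge) auto
  obtain \<nu> where \<nu>: "\<nu> \<in> parts (p_weight m) (p_weight m)" "mults (p_weight m) \<nu> = m"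
    by (rule ex_parts_mults)
  let ?N = "p_weight m"
  have "pcoef ?N \<nu> m' = 0" if "m' \<in> keys f" "m' \<noteq> m" for m'
  proof (rule ccontr)
    assume nz: "pcoef ?N \<nu> m' \<noteq> 0"
    have "card {i. i < ?N \<and> \<nu> i \<noteq> 0} = mlen m" using mlen_mults[of ?N \<nu>] unfolding \<nu>(2) by simp
    then have "mults ?N \<nu> = m'" using pcoef_triangular[OF nz] mx[OF that(1)] by simp
    then show False using \<nu>(2) that(2) by simp
  qed
  then have "mcoef ?N \<nu> f = (\<Sum>m'\<in>keys f. if m' = m then lookup f m * of_int (pcoef ?N \<nu> m) else 0)"
    unfolding mcoef_def by (intro sum.cong) auto
  also have "\<dots> = lookup f m * of_int (pcoef ?N \<nu> m)"
    using m(1) by simp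
  also have "\<dots> \<noteq> 0" using pcoef_mults_pos[OF \<nu>(2)] m(1) by (simp add: in_keys_iff)
  finally show False using assms[OF \<nu>(1)] by simp
qed

text \<open>The mirror image of the previous argument: take \<mu> in the support with the fewest
  parts. In the column of its type no other element of the support contributes.\<close>

lemma gfun_independent:
  assumes "\<And>m. (\<Sum>\<nu>\<in>parts d d. F \<nu> * of_int (pcoef d \<nu> m)) = (0 :: qt_field)" "\<nu> \<in> parts d d"
  shows "F \<nu> = 0"
proof (rule ccontr)
  assume "F \<nu> \<noteq> 0"
  let ?c = "\<lambda>\<nu>. card {i. i < d \<and> \<nu> i \<noteq> (0::nat)}"
  define A where "A = {\<nu> \<in> parts d d. F \<nu> \<noteq> 0}"
  have A: "\<nu> \<in> A" "finite A" using assms(2) \<open>F \<nu> \<noteq> 0\<close> finite_parts by (simp_all add: A_def)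
  then have "Min (?c ` A) \<in> ?c ` A" by (intro Min_in) auto
  then obtain \<mu> where \<mu>: "\<mu> \<in> A" "?c \<mu> = Min (?c ` A)" by auto
  have mn: "?c \<mu> \<le> ?c \<nu>'" if "\<nu>' \<in> A" for \<nu>'
    unfolding \<mu>(2) using that A(2) by (intro Min_le) auto
  define m where "m = mults d \<mu>"
  have "F \<nu>' * of_int (pcoef d \<nu>' m) = 0" if "\<nu>' \<in> parts d d" "\<nu>' \<noteq> \<mu>" for \<nu>'
  proof (rule ccontr)
    assume "F \<nu>' * of_int (pcoef d \<nu>' m) \<noteq> 0"
    then have nz: "F \<nu>' \<noteq> 0" "pcoef d \<nu>' m \<noteq> 0" by auto
    then have "?c \<mu> \<le> ?c \<nu>'" using mn that(1) by (simp add: A_def)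
    moreover have "mlen m = ?c \<mu>" unfolding m_def by (rule mlen_mults)
    ultimately have "mults d \<nu>' = m" using pcoef_triangular[OF nz(2)] by simp
    then have "\<nu>' = \<mu>" using parts_eq_if_mults_eq[of \<nu>' d d \<mu>] that(1) \<mu>(1) by (simp add: m_def A_def)
    then show False using that(2) by simp
  qed
  then have "(\<Sum>\<nu>\<in>parts d d. F \<nu> * of_int (pcoef d \<nu> m)) = (\<Sum>\<nu>\<in>parts d d. if \<nu> = \<mu> then F \<mu> * of_int (pcoef d \<mu> m) else 0)"
    by (intro sum.cong) auto
  also have "\<dots> = F \<mu> * of_int (pcoef d \<mu> m)"
    using \<mu>(1) finite_parts by (simp add: A_def)
  also have "\<dots> \<noteq> 0" using \<mu>(1) pcoef_mults_pos[of d \<mu> m] by (simp add: m_def A_def)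
  finally show False using assms(1) by simp
qed

definition gcomb :: "nat \<Rightarrow> nat \<Rightarrow> ((nat \<Rightarrow> nat) \<Rightarrow> qt_field) \<Rightarrow> symfun" where
  "gcomb N d F = (\<Sum>\<nu>\<in>parts N d. Const (F \<nu>) * gfun N \<nu>)"

lemma pleth_0: "pleth 0 E = 0" by (simp add: pleth_def)

lemma pleth_sum: "pleth (sum f A) (Xalph n) = (\<Sum>a\<in>A. pleth (f a) (Xalph n))"
  by (induction A rule: infinite_finite_induct) (simp_all add: pleth_add pleth_0)

lemma pleth_gcomb: "pleth (gcomb N d F) (Xalph n) = (\<Sum>\<nu>\<in>parts N d. Const (F \<nu>) * (\<Prod>i<N. gsym n (\<nu> i)))"
  by (simp add: gcomb_def pleth_sum pleth_scale pleth_gfun)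

lemma mcoef_sum: "mcoef N \<gamma> (sum f A) = (\<Sum>a\<in>A. mcoef N \<gamma> (f a))"
  by (induction A rule: infinite_finite_induct) (simp_all add: mcoef_add, simp_all add: mcoef_def)

lemma mcoef_gcomb: "mcoef N \<gamma> (gcomb N d F) = (\<Sum>\<nu>\<in>parts N d. F \<nu> * gram N \<nu> \<gamma>)"
  by (simp add: gcomb_def mcoef_sum mcoef_scale gram_def)

lemma qt_inner_0: "qt_inner 0 f = 0" by (simp add: qt_inner_def)

lemma qt_inner_gcomb: "qt_inner (gcomb N d F) f = (\<Sum>\<nu>\<in>parts N d. F \<nu> * mcoef N \<nu> f)"
proof -
  have "qt_inner (sum g A) f = (\<Sum>a\<in>A. qt_inner (g a) f)" for g and A :: "(nat \<Rightarrow> nat) set"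
    by (induction A rule: infinite_finite_induct) (simp_all add: qt_inner_add_left qt_inner_0)
  then show ?thesis by (simp add: gcomb_def qt_inner_scale_left qt_inner_gfun)
qed

lemma lookup_gcomb: "lookup (gcomb N d F) m = (\<Sum>\<nu>\<in>parts N d. F \<nu> * of_int (pcoef N \<nu> m)) * theta m"
  by (simp add: gcomb_def lookup_sum lookup_Const_mult lookup_gfun sum_distrib_right mult.assoc)

lemma mcoef_weight:
  assumes "\<And>m. m \<in> keys f \<Longrightarrow> p_weight m = d" "(\<Sum>i<N. \<gamma> i) \<noteq> d"
  shows "mcoef N \<gamma> f = 0"
  unfolding mcoef_def
proof (rule sum.neutral, rule ballI)
  fix m assume "m \<in> keys f"
  then have "pcoef N \<gamma> m = 0" using assms pcoef_weight[of N \<gamma> m] by auto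
  then show "lookup f m * of_int (pcoef N \<gamma> m) = 0" by simp
qed

lemma keys_gcomb: "m \<in> keys (gcomb N d F) \<Longrightarrow> p_weight m = d"
proof (rule ccontr)
  assume m: "m \<in> keys (gcomb N d F)" "p_weight m \<noteq> d"
  have "pcoef N \<nu> m = 0" if "\<nu> \<in> parts N d" for \<nu>
  proof -
    have "(\<Sum>i<N. \<nu> i) = d" using that parts_subset[of N d] by (auto simp: weak_comps_def)
    then show ?thesis using pcoef_weight[of N \<nu> m] m(2) by auto
  qed
  then have "(\<Sum>\<nu>\<in>parts N d. F \<nu> * of_int (pcoef N \<nu> m)) = 0" by (intro sum.neutral) simp
  then show False using m(1) unfolding in_keys_iff lookup_gcomb by simp
qed

text \<open>A combination of the g_\<nu> without monomial coefficients is zero as a symmetric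
  function. With d variables every partition of d has room, so all these coefficients are
  visible.\<close>

lemma gram_nondegenerate:
  assumes "\<And>\<gamma>. \<gamma> \<in> parts d d \<Longrightarrow> (\<Sum>\<nu>\<in>parts d d. F \<nu> * gram d \<nu> \<gamma>) = 0" "\<nu> \<in> parts d d"
  shows "F \<nu> = 0"
proof -
  have "gcomb d d F = 0"
  proof (rule mcoef_separates)
    fix d' \<gamma> assume g: "\<gamma> \<in> parts d' d'"
    show "mcoef d' \<gamma> (gcomb d d F) = 0"
    proof (cases "d' = d")
      case True
      then show ?thesis using g assms(1) by (simp add: mcoef_gcomb)
    next
      case False
      then show ?thesis using keys_gcomb partsD(3)[OF g] by (intro mcoef_weight[of _ d]) auto
    qed
  qed
  then have "(\<Sum>\<nu>\<in>parts d d. F \<nu> * of_int (pcoef d \<nu> m)) * theta m = 0" for m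
    unfolding lookup_gcomb[symmetric] by simp
  then show ?thesis using theta_nonzero assms(2) by (intro gfun_independent[where F = F and d = d]) auto
qed

section \<open>The action on Schur functions\<close>

definition stair :: "nat \<Rightarrow> (nat \<Rightarrow> nat) \<Rightarrow> nat \<Rightarrow> nat" where
  "stair n \<mu> i = (if i < n then \<mu> i + (n - Suc i) else 0)"

text \<open>The truncated subtraction is meaningful only if \<open>admissible n \<mu> \<tau>\<close>.\<close>

definition straighten :: "nat \<Rightarrow> (nat \<Rightarrow> nat) \<Rightarrow> (nat \<Rightarrow> nat) \<Rightarrow> nat \<Rightarrow> nat" where
  "straighten n \<mu> \<tau> j = (if j < n then \<mu> (\<tau> j) + j - \<tau> j else 0)"

definition admissible :: "nat \<Rightarrow> (nat \<Rightarrow> nat) \<Rightarrow> (nat \<Rightarrow> nat) \<Rightarrow> bool" where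
  "admissible n \<mu> \<tau> \<longleftrightarrow> (\<forall>j<n. \<tau> j \<le> \<mu> (\<tau> j) + j)"

lemma permutes_less: "p permutes {..<n} \<Longrightarrow> i < n \<Longrightarrow> p i < n"
  using permutes_in_image[of p "{..<n}" i] by simp

lemma straighten_weak_comp:
  assumes "\<mu> \<in> weak_comps n d" "\<tau> permutes {..<n}" "admissible n \<mu> \<tau>"
  shows "straighten n \<mu> \<tau> \<in> weak_comps n d"
proof -
  have "(\<Sum>j<n. straighten n \<mu> \<tau> j) + (\<Sum>j<n. \<tau> j) = (\<Sum>j<n. \<mu> (\<tau> j)) + (\<Sum>j<n. j)"
    unfolding sum.distrib[symmetric] using assms(3)
    by (intro sum.cong) (auto simp: straighten_def admissible_def)
  moreover have "(\<Sum>j<n. \<tau> j) = (\<Sum>j<n. j)" "(\<Sum>j<n. \<mu> (\<tau> j)) = (\<Sum>j<n. \<mu> j)"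
    using sum.permute[OF assms(2), of "\<lambda>j. j"] sum.permute[OF assms(2), of \<mu>] by (simp_all add: o_def)
  ultimately show ?thesis using assms(1) by (simp add: weak_comps_def straighten_def)
qed

lemma straighten_eq_iff:
  assumes "\<alpha> \<in> weak_comps n d"
  shows "(\<forall>j<n. int (\<alpha> j) = int (\<mu> (\<tau> j)) - int (\<tau> j) + int j) \<longleftrightarrow> admissible n \<mu> \<tau> \<and> \<alpha> = straighten n \<mu> \<tau>"
proof -
  have z: "\<alpha> j = 0" if "\<not> j < n" for j using assms that by (simp add: weak_comps_def)
  have "int (\<alpha> j) = int (\<mu> (\<tau> j)) - int (\<tau> j) + int j \<longleftrightarrow> \<tau> j \<le> \<mu> (\<tau> j) + j \<and> \<alpha> j = \<mu> (\<tau> j) + j - \<tau> j" for j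
    by linarith
  then show ?thesis
    unfolding admissible_def straighten_def fun_eq_iff using z by auto
qed

lemma epsilon_eq:
  assumes "\<alpha> \<in> weak_comps n d"
  shows "epsilon n \<mu> \<alpha> = (\<Sum>\<tau> | \<tau> permutes {..<n}. if admissible n \<mu> \<tau> \<and> \<alpha> = straighten n \<mu> \<tau> then sign \<tau> else 0)"
proof -
  have "{\<tau>. \<tau> permutes {..<n} \<and> (\<forall>j<n. int (\<alpha> j) = int (\<mu> (\<tau> j)) - int (\<tau> j) + int j)}
     = {\<tau> \<in> {\<tau>. \<tau> permutes {..<n}}. admissible n \<mu> \<tau> \<and> \<alpha> = straighten n \<mu> \<tau>}"
    using straighten_eq_iff[OF assms] by auto
  then show ?thesis
    unfolding epsilon_def by (simp only:) (rule sum.inter_filter, simp add: finite_permutations)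
qed

lemma sum_epsilon:
  fixes X :: "(nat \<Rightarrow> nat) \<Rightarrow> 'a::comm_ring_1"
  assumes "\<mu> \<in> weak_comps n d"
  shows "(\<Sum>\<alpha>\<in>weak_comps n d. of_int (epsilon n \<mu> \<alpha>) * X \<alpha>) =
    (\<Sum>\<tau> | \<tau> permutes {..<n}. if admissible n \<mu> \<tau> then of_int (sign \<tau>) * X (straighten n \<mu> \<tau>) else 0)"
proof -
  have "(\<Sum>\<alpha>\<in>weak_comps n d. of_int (epsilon n \<mu> \<alpha>) * X \<alpha>) =
    (\<Sum>\<alpha>\<in>weak_comps n d. \<Sum>\<tau> | \<tau> permutes {..<n}. if \<alpha> = straighten n \<mu> \<tau> then (if admissible n \<mu> \<tau> then of_int (sign \<tau>) * X \<alpha> else 0) else 0)"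
  proof (intro sum.cong refl)
    fix \<alpha> assume "\<alpha> \<in> weak_comps n d"
    then show "of_int (epsilon n \<mu> \<alpha>) * X \<alpha> = (\<Sum>\<tau> | \<tau> permutes {..<n}. if \<alpha> = straighten n \<mu> \<tau> then (if admissible n \<mu> \<tau> then of_int (sign \<tau>) * X \<alpha> else 0) else 0)"
      unfolding epsilon_eq[OF \<open>\<alpha> \<in> weak_comps n d\<close>] of_int_sum sum_distrib_right by (intro sum.cong) auto
  qed
  also have "\<dots> = (\<Sum>\<tau> | \<tau> permutes {..<n}. \<Sum>\<alpha>\<in>weak_comps n d. if \<alpha> = straighten n \<mu> \<tau> then (if admissible n \<mu> \<tau> then of_int (sign \<tau>) * X \<alpha> else 0) else 0)"
    by (rule sum.swap)
  also have "\<dots> = (\<Sum>\<tau> | \<tau> permutes {..<n}. if admissible n \<mu> \<tau> then of_int (sign \<tau>) * X (straighten n \<mu> \<tau>) else 0)"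
  proof (intro sum.cong refl)
    fix \<tau> assume "\<tau> \<in> {\<tau>. \<tau> permutes {..<n}}"
    then show "(\<Sum>\<alpha>\<in>weak_comps n d. if \<alpha> = straighten n \<mu> \<tau> then (if admissible n \<mu> \<tau> then of_int (sign \<tau>) * X \<alpha> else 0) else 0) =
        (if admissible n \<mu> \<tau> then of_int (sign \<tau>) * X (straighten n \<mu> \<tau>) else 0)"
      using straighten_weak_comp[OF assms] by (simp add: finite_weak_comps)
  qed
  finally show ?thesis .
qed

definition eigen_poly :: "nat \<Rightarrow> qt_field \<Rightarrow> (nat \<Rightarrow> nat) \<Rightarrow> qt_field" where
  "eigen_poly n u \<alpha> = (\<Prod>j<n. 1 + u * tpar ^ (n - Suc j) * qpar ^ \<alpha> j)"

text \<open>For \<phi> = 1 these are the coefficients of S_\<mu>[X^tq] in the g_\<nu>, for \<phi> =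
  \<open>eigen_poly n u\<close> those of \<open>gdet n u (stair n \<mu>)\<close>, and for \<phi> =
  [|\<lambda>|] - [|\<alpha>|] the entries of the determinant.\<close>

definition dmat :: "nat \<Rightarrow> ((nat \<Rightarrow> nat) \<Rightarrow> qt_field) \<Rightarrow> (nat \<Rightarrow> nat) \<Rightarrow> (nat \<Rightarrow> nat) \<Rightarrow> qt_field" where
  "dmat n \<phi> \<mu> \<nu> = (\<Sum>\<alpha>\<in>distinct_perms n \<nu>. of_int (epsilon n \<mu> \<alpha>) * \<phi> \<alpha>)"

lemma sum_dmat:
  fixes X :: "(nat \<Rightarrow> nat) \<Rightarrow> 'a::comm_ring_1"
  assumes h: "comm_ring_hom h" and X: "\<And>\<pi> \<alpha>. \<pi> permutes {..<n} \<Longrightarrow> X (\<alpha> \<circ> \<pi>) = X \<alpha>"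
    and \<mu>: "\<mu> \<in> weak_comps n d"
  shows "(\<Sum>\<nu>\<in>parts n d. h (dmat n \<phi> \<mu> \<nu>) * X \<nu>) =
    (\<Sum>\<tau> | \<tau> permutes {..<n}. if admissible n \<mu> \<tau> then of_int (sign \<tau>) * h (\<phi> (straighten n \<mu> \<tau>)) * X (straighten n \<mu> \<tau>) else 0)"
proof -
  interpret comm_ring_hom h by (rule h)
  have "(\<Sum>\<nu>\<in>parts n d. h (dmat n \<phi> \<mu> \<nu>) * X \<nu>) =
      (\<Sum>\<nu>\<in>parts n d. \<Sum>\<alpha>\<in>distinct_perms n \<nu>. of_int (epsilon n \<mu> \<alpha>) * (h (\<phi> \<alpha>) * X \<alpha>))"
  proof (intro sum.cong refl)
    fix \<nu>
    have "X \<alpha> = X \<nu>" if "\<alpha> \<in> distinct_perms n \<nu>" for \<alpha>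
      using that X by (auto simp: distinct_perms_iff)
    then show "h (dmat n \<phi> \<mu> \<nu>) * X \<nu> = (\<Sum>\<alpha>\<in>distinct_perms n \<nu>. of_int (epsilon n \<mu> \<alpha>) * (h (\<phi> \<alpha>) * X \<alpha>))"
      unfolding dmat_def by (simp add: hom_sum hom_mult hom_of_int sum_distrib_right mult.assoc)
  qed
  also have "\<dots> = (\<Sum>\<alpha>\<in>weak_comps n d. of_int (epsilon n \<mu> \<alpha>) * (h (\<phi> \<alpha>) * X \<alpha>))"
    by (rule sum_weak_comps[symmetric])
  finally show ?thesis unfolding sum_epsilon[OF \<mu>] by (simp only: mult.assoc)
qed

text \<open>The Leibniz expansion indexes exponents by rows, \<epsilon> by columns, hence \<tau> is
  the inverse of \<open>p\<close>. The exponents in the two indexings differ by the permutation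
  \<open>p\<close>, which the symmetric function \<open>X\<close> does not see. The map
  \<open>h\<close> covers scalars and constants of \<open>xpoly\<close> at once.\<close>

lemma sum_stair:
  fixes X :: "(nat \<Rightarrow> nat) \<Rightarrow> 'a::comm_ring_1"
  assumes h: "comm_ring_hom h" and X: "\<And>\<pi> \<alpha>. \<pi> permutes {..<n} \<Longrightarrow> X (\<alpha> \<circ> \<pi>) = X \<alpha>"
    and \<mu>: "\<mu> \<in> weak_comps n d"
  shows "(\<Sum>p | p permutes {..<n}. if fits n p (stair n \<mu>) then of_int (sign p) *
      h (\<Prod>i<n. 1 + u * tpar ^ desc n p i * qpar ^ (stair n \<mu> i - desc n p i)) * X (pcell n p (stair n \<mu>)) else 0) =
    (\<Sum>\<nu>\<in>parts n d. h (dmat n (eigen_poly n u) \<mu> \<nu>) * X \<nu>)"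
proof -
  have "(\<Sum>p | p permutes {..<n}. if fits n p (stair n \<mu>) then of_int (sign p) *
        h (\<Prod>i<n. 1 + u * tpar ^ desc n p i * qpar ^ (stair n \<mu> i - desc n p i)) * X (pcell n p (stair n \<mu>)) else 0) =
      (\<Sum>\<tau> | \<tau> permutes {..<n}. if admissible n \<mu> \<tau> then of_int (sign \<tau>) * h (eigen_poly n u (straighten n \<mu> \<tau>)) * X (straighten n \<mu> \<tau>) else 0)"
  proof (rule sum.reindex_bij_witness[where i = "inv_into UNIV" and j = "inv_into UNIV"])
    fix p assume "p \<in> {p. p permutes {..<n}}"
    then have p: "p permutes {..<n}" by simp
    show "inv_into UNIV (inv_into UNIV p) = p" using p by (rule permutes_inv_inv)
    show ip: "inv_into UNIV p \<in> {p. p permutes {..<n}}" using permutes_inv[OF p] by simp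
    let ?\<tau> = "inv_into UNIV p"
    have tp: "?\<tau> (p i) = i" for i using permutes_inverses[OF p] by simp
    have pt: "p (?\<tau> j) = j" for j using permutes_inverses[OF p] by simp
    have cell: "stair n \<mu> i - desc n p i = \<mu> i + p i - i" if "i < n" for i
      using that permutes_less[OF p that] by (simp add: stair_def)
    have fits: "fits n p (stair n \<mu>) \<longleftrightarrow> admissible n \<mu> ?\<tau>"
    proof -
      have "fits n p (stair n \<mu>) \<longleftrightarrow> (\<forall>i<n. i \<le> \<mu> i + p i)"
        unfolding fits_def using permutes_less[OF p] by (intro all_cong) (auto simp: stair_def)
      also have "\<dots> \<longleftrightarrow> admissible n \<mu> ?\<tau>"
        unfolding admissible_def using permutes_less[OF p] permutes_less[OF permutes_inv[OF p]] tp pt by metis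
      
  finally show ?thesis .
  qed
  have cells: "pcell n p (stair n \<mu>) = straighten n \<mu> ?\<tau> \<circ> p"
  proof
    fix i show "pcell n p (stair n \<mu>) i = (straighten n \<mu> ?\<tau> \<circ> p) i"
    proof (cases "i < n")
      case True
      then show ?thesis using cell[OF True] permutes_less[OF p True] by (simp add: straighten_def tp)
    next
      case False
      then show ?thesis using permutes_not_in[OF p, of i] by (simp add: stair_def straighten_def)
    qed
  qed
  have "(\<Prod>i<n. 1 + u * tpar ^ desc n p i * qpar ^ (stair n \<mu> i - desc n p i)) =
      (\<Prod>i<n. ((\<lambda>j. 1 + u * tpar ^ (n - Suc j) * qpar ^ straighten n \<mu> ?\<tau> j) \<circ> p) i)"
  proof (intro prod.cong refl)
    fix i assume "i \<in> {..<n}"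
    show "1 + u * tpar ^ desc n p i * qpar ^ (stair n \<mu> i - desc n p i) =
        ((\<lambda>j. 1 + u * tpar ^ (n - Suc j) * qpar ^ straighten n \<mu> ?\<tau> j) \<circ> p) i"
      using fun_cong[OF cells, of i] by simp
  qed
  also have "\<dots> = eigen_poly n u (straighten n \<mu> ?\<tau>)"
    unfolding eigen_poly_def
    using prod.permute[OF p, of "\<lambda>j. 1 + u * tpar ^ (n - Suc j) * qpar ^ straighten n \<mu> ?\<tau> j"] by simp
  finally have wt: "(\<Prod>i<n. 1 + u * tpar ^ desc n p i * qpar ^ (stair n \<mu> i - desc n p i)) = eigen_poly n u (straighten n \<mu> ?\<tau>)" .
  have "permutation p" using p by (auto simp: permutation_permutes)
  then have "sign ?\<tau> = sign p" by (rule sign_inverse)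
  then show "(if admissible n \<mu> ?\<tau> then of_int (sign ?\<tau>) * h (eigen_poly n u (straighten n \<mu> ?\<tau>)) * X (straighten n \<mu> ?\<tau>) else 0) =
    (if fits n p (stair n \<mu>) then of_int (sign p) *
      h (\<Prod>i<n. 1 + u * tpar ^ desc n p i * qpar ^ (stair n \<mu> i - desc n p i)) * X (pcell n p (stair n \<mu>)) else 0)"
    unfolding wt fits cells X[OF p] by simp
next
  fix \<tau> assume "\<tau> \<in> {p. p permutes {..<n}}"
  then have t: "\<tau> permutes {..<n}" by simp
  show "inv_into UNIV (inv_into UNIV \<tau>) = \<tau>" using t by (rule permutes_inv_inv)
  show "inv_into UNIV \<tau> \<in> {p. p permutes {..<n}}" using permutes_inv[OF t] by simp
qed
also have "\<dots> = (\<Sum>\<nu>\<in>parts n d. h (dmat n (eigen_poly n u) \<mu> \<nu>) * X \<nu>)"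
  using sum_dmat[where X = X and h = h and \<phi> = "eigen_poly n u", OF h _ \<mu>] X by simp
finally show ?thesis .
qed

lemma hom_id: "comm_ring_hom (\<lambda>x::'a::comm_ring_1. x)"
  by unfold_locales simp_all

lemma gdet_stair:
  assumes "\<mu> \<in> weak_comps n d"
  shows "gdet n u (stair n \<mu>) = (\<Sum>\<nu>\<in>parts n d. Const (dmat n (eigen_poly n u) \<mu> \<nu>) * (\<Prod>i<n. gsym n (\<nu> i)))"
proof -
  have inv: "(\<Prod>i<n. gsym n ((\<alpha> \<circ> \<pi>) i)) = (\<Prod>i<n. gsym n (\<alpha> i))" if "\<pi> permutes {..<n}" for \<pi> \<alpha>
    using prod.permute[OF that, of "\<lambda>i. gsym n (\<alpha> i)"] by (simp add: o_def)
  have c: "Const (of_int (sign p) * x) = of_int (sign p) * Const x" for p :: "nat \<Rightarrow> nat" and x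
    by (simp add: sign_def Const_eq_cst cst_hom)
  show ?thesis
    unfolding gdet_eq c
    by (rule sum_stair[where X = "\<lambda>\<alpha>. \<Prod>i<n. gsym n (\<alpha> i)", OF hom_Const inv assms])
qed

lemma gram_permute1: "\<pi> permutes {..<n} \<Longrightarrow> gram n (\<alpha> \<circ> \<pi>) \<gamma> = gram n \<alpha> \<gamma>"
  by (simp add: gram_def gfun_permute)

lemma gram_permute2: "\<pi> permutes {..<n} \<Longrightarrow> gram n \<alpha> (\<gamma> \<circ> \<pi>) = gram n \<alpha> \<gamma>"
  by (simp add: gram_def mcoef_permute)

lemma eigen_poly_0: "eigen_poly n 0 \<alpha> = 1"
  by (simp add: eigen_poly_def)

text \<open>\<open>kernel_self_adjoint\<close> at the exponents \<mu> + \<delta> and \<kappa> +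
  \<delta>, with \<delta> the staircase. With G the Gram matrix and M_\<phi> =
  \<open>dmat n \<phi>\<close> it is the matrix identity M_\<phi> G M_1^T = M_1 G M_\<phi>^T for
  \<phi> = \<open>eigen_poly n u\<close>.\<close>

theorem dmat_self_adjoint_u:
  assumes "\<mu> \<in> weak_comps n d" "\<kappa> \<in> weak_comps n d"
  shows "(\<Sum>\<nu>\<in>parts n d. \<Sum>\<rho>\<in>parts n d. dmat n (eigen_poly n u) \<mu> \<nu> * dmat n (\<lambda>_. 1) \<kappa> \<rho> * gram n \<nu> \<rho>) =
    (\<Sum>\<nu>\<in>parts n d. \<Sum>\<rho>\<in>parts n d. dmat n (\<lambda>_. 1) \<mu> \<nu> * dmat n (eigen_poly n u) \<kappa> \<rho> * gram n \<nu> \<rho>)"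
proof -
  let ?w = "\<lambda>u \<mu> p. \<Prod>i<n. 1 + u * tpar ^ desc n p i * qpar ^ (stair n \<mu> i - desc n p i)"
  let ?S = "\<lambda>u \<mu> X. \<Sum>p | p permutes {..<n}. if fits n p (stair n \<mu>) then of_int (sign p) * ?w u \<mu> p * X (pcell n p (stair n \<mu>)) else 0"
  have one: "eigen_poly n 0 = (\<lambda>_. 1)" by (rule ext) (rule eigen_poly_0)
  have S: "?S u \<mu> X = (\<Sum>\<nu>\<in>parts n d. dmat n (eigen_poly n u) \<mu> \<nu> * X \<nu>)"
    if "\<mu> \<in> weak_comps n d" "\<And>\<pi> \<alpha>. \<pi> permutes {..<n} \<Longrightarrow> X (\<alpha> \<circ> \<pi>) = X \<alpha>"
    for u \<mu> and X :: "(nat \<Rightarrow> nat) \<Rightarrow> qt_field"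
    by (rule sum_stair[OF hom_id that(2,1)])
  \<comment> \<open>Two parameters are kept so that both sides are instances, with (a, b) = (u, 0)
    and (0, u).\<close>
  have D: "(\<Sum>p | p permutes {..<n}. \<Sum>v | v permutes {..<n}.
      if fits n v (stair n \<mu>) \<and> fits n p (stair n \<kappa>) then
        of_int (sign p) * of_int (sign v) * gcoef n (pcell n v (stair n \<mu>)) (pcell n p (stair n \<kappa>)) * (?w a \<mu> v * ?w b \<kappa> p) else 0) =
    (\<Sum>\<nu>\<in>parts n d. \<Sum>\<rho>\<in>parts n d. dmat n (eigen_poly n a) \<mu> \<nu> * dmat n (eigen_poly n b) \<kappa> \<rho> * gram n \<nu> \<rho>)" for a b
  proof -
    have "(\<Sum>p | p permutes {..<n}. \<Sum>v | v permutes {..<n}.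
      if fits n v (stair n \<mu>) \<and> fits n p (stair n \<kappa>) then
        of_int (sign p) * of_int (sign v) * gcoef n (pcell n v (stair n \<mu>)) (pcell n p (stair n \<kappa>)) * (?w a \<mu> v * ?w b \<kappa> p) else 0) =
      ?S b \<kappa> (\<lambda>\<gamma>. ?S a \<mu> (\<lambda>\<alpha>. gram n \<alpha> \<gamma>))"
      by (intro sum.cong refl) (auto simp: gcoef_eq_gram sum_distrib_left mult_ac intro!: sum.cong)
    also have "\<dots> = (\<Sum>\<rho>\<in>parts n d. dmat n (eigen_poly n b) \<kappa> \<rho> * (\<Sum>\<nu>\<in>parts n d. dmat n (eigen_poly n a) \<mu> \<nu> * gram n \<nu> \<rho>))"
    proof -
      have inner: "?S a \<mu> (\<lambda>\<alpha>. gram n \<alpha> \<gamma>) = (\<Sum>\<nu>\<in>parts n d. dmat n (eigen_poly n a) \<mu> \<nu> * gram n \<nu> \<gamma>)" for \<gamma>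
        by (rule S[where X = "\<lambda>\<alpha>. gram n \<alpha> \<gamma>", OF assms(1) gram_permute1])
      show ?thesis
        unfolding inner
        by (rule S[where X = "\<lambda>\<gamma>. \<Sum>\<nu>\<in>parts n d. dmat n (eigen_poly n a) \<mu> \<nu> * gram n \<nu> \<gamma>", OF assms(2)])
          (simp only: gram_permute2)
    qed
    also have "\<dots> = (\<Sum>\<rho>\<in>parts n d. \<Sum>\<nu>\<in>parts n d. dmat n (eigen_poly n a) \<mu> \<nu> * dmat n (eigen_poly n b) \<kappa> \<rho> * gram n \<nu> \<rho>)"
      by (simp add: sum_distrib_left mult_ac)
    also have "\<dots> = (\<Sum>\<nu>\<in>parts n d. \<Sum>\<rho>\<in>parts n d. dmat n (eigen_poly n a) \<mu> \<nu> * dmat n (eigen_poly n b) \<kappa> \<rho> * gram n \<nu> \<rho>)"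
      by (rule sum.swap)
    finally show ?thesis .
  qed
  have w0: "?w 0 \<mu> v = 1" for \<mu> v by simp
  have st: "\<forall>i\<ge>n. stair n \<mu> i = 0" by (simp add: stair_def)
  show ?thesis
    unfolding D[of u 0, unfolded w0 one mult_1_right, symmetric] D[of 0 u, unfolded w0 one mult_1_left, symmetric]
    by (rule kernel_self_adjoint[OF st])
qed

section \<open>Dominance order\<close>

lemma dominated_refl: "dominated \<mu> \<mu>"
  by (simp add: dominated_def)

lemma dominated_trans: "dominated \<mu> \<nu> \<Longrightarrow> dominated \<nu> \<rho> \<Longrightarrow> dominated \<mu> \<rho>"
  unfolding dominated_def by (metis order_trans)

lemma dominated_antisym:
  assumes "dominated \<mu> \<nu>" "dominated \<nu> \<mu>"
  shows "\<mu> = \<nu>"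
proof
  fix k
  have e: "(\<Sum>i<k. \<mu> i) = (\<Sum>i<k. \<nu> i)" for k
    using assms by (simp add: dominated_def le_antisym)
  show "\<mu> k = \<nu> k" using e[of k] e[of "Suc k"] by simp
qed

lemma dominated_parts:
  assumes "\<mu> \<in> parts n d" "dominated \<mu> \<nu>" "is_partition \<nu>"
  shows "\<nu> \<in> parts n d"
proof -
  define M where "M = n + num_parts \<nu>"
  have z: "\<forall>i\<ge>M. \<nu> i = 0" using num_parts_le_iff[OF assms(3), of M] by (simp add: M_def)
  have ps: "psize \<nu> = d" using assms(2) partsD[OF assms(1)] by (simp add: dominated_def)
  have "d \<le> (\<Sum>i<n. \<nu> i)" using assms(2) partsD(3)[OF assms(1)] unfolding dominated_def by metis
  moreover have "(\<Sum>i<M. \<nu> i) = d" using psize_eq[OF z] ps by simp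
  moreover have "(\<Sum>i<M. \<nu> i) = (\<Sum>i<n. \<nu> i) + (\<Sum>i=n..<M. \<nu> i)"
    by (metis M_def atLeast0LessThan le_add1 sum.atLeastLessThan_concat zero_le)
  ultimately have "(\<Sum>i=n..<M. \<nu> i) = 0" by linarith
  then have "\<nu> i = 0" if "i \<ge> n" for i
    using z that by (cases "i < M") simp_all
  then have "num_parts \<nu> \<le> n" using num_parts_le_iff[OF assms(3)] by blast
  then show ?thesis using assms(3) ps by (simp add: parts_def)
qed

lemma strictly_above_parts: "lam \<in> parts n d \<Longrightarrow> strictly_above lam \<subseteq> parts n d"
  by (auto simp: strictly_above_def intro: dominated_parts)

lemma finite_strictly_above: "lam \<in> parts n d \<Longrightarrow> finite (strictly_above lam)"
  using strictly_above_parts finite_parts by (rule finite_subset)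

lemma sum_initial_le:
  fixes f :: "nat \<Rightarrow> int"
  assumes "mono f" "finite S"
  shows "(\<Sum>i<card S. f i) \<le> (\<Sum>i\<in>S. f i)"
  using assms(2)
proof (induction S rule: finite_linorder_max_induct)
  case empty
  then show ?case by simp
next
  case (insert b A)
  have "A \<subseteq> {..<b}" using insert.hyps by auto
  then have "card A \<le> b" using card_mono[of "{..<b}" A] by simp
  then have "f (card A) \<le> f b" using assms(1) by (rule monoD[rotated])
  moreover have "b \<notin> A" using insert.hyps by auto
  ultimately show ?case using insert by simp
qed

lemma initial_segment_eq:
  fixes S :: "nat set"
  assumes "finite S" "\<Sum>S \<le> (\<Sum>i<card S. i)"
  shows "S = {..<card S}"
  using assms
proof (induction S rule: finite_linorder_max_induct)
  case empty
  then show ?case by simp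
next
  case (insert b A)
  have "A \<subseteq> {..<b}" using insert.hyps by auto
  then have c: "card A \<le> b" using card_mono[of "{..<b}" A] by simp
  have n: "b \<notin> A" using insert.hyps by auto
  have "(\<Sum>i<card A. int i) \<le> (\<Sum>i\<in>A. int i)"
    by (rule sum_initial_le) (use insert.hyps in \<open>auto simp: mono_def\<close>)
  then have "int (\<Sum>i<card A. i) \<le> int (\<Sum>A)" by (simp only: of_nat_sum)
  then have "(\<Sum>i<card A. i) \<le> \<Sum>A" by (simp only: of_nat_le_iff)
  moreover have "b + \<Sum>A \<le> (\<Sum>i<card A. i) + card A"
    using insert.prems insert.hyps n by simp
  ultimately have b: "b = card A" "\<Sum>A \<le> (\<Sum>i<card A. i)" using c by linarith+
  have A: "A = {..<card A}" using insert.IH[OF b(2)] .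
  have "card (insert b A) = Suc (card A)" using insert.hyps(1) n by simp
  then show ?case using A b(1) lessThan_Suc by metis
qed

text \<open>Sum \<alpha>_j = \<mu>_\<tau>(j) - \<tau>(j) + j over the k indices with \<tau>(j) < k.
  The left side is at most the sum of the k largest parts of \<nu>, and on the right the indices j
  add up to at least 0 + ... + (k-1). For \<mu> = \<nu> equality holds for every k, so \<tau>
  preserves all initial segments.\<close>

lemma straighten_dominates:
  assumes "\<mu> \<in> parts n d" "\<nu> \<in> parts n d" "\<tau> permutes {..<n}" "\<pi> permutes {..<n}"
    and "admissible n \<mu> \<tau>" "straighten n \<mu> \<tau> = \<nu> \<circ> \<pi>"
  shows "dominated \<mu> \<nu>" and "\<mu> = \<nu> \<Longrightarrow> \<tau> = id"
proof -
  define S where "S k = {j. j < n \<and> \<tau> j < k}" for k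
  have fS: "finite (S k)" for k by (simp add: S_def)
  have bij: "bij_betw \<tau> (S k) {..<k}" if "k \<le> n" for k
    unfolding bij_betw_def
  proof
    show "inj_on \<tau> (S k)" using permutes_inj[OF assms(3)] inj_on_subset by blast
    have "\<exists>j<n. \<tau> j = i" if "i < k" for i
    proof -
      have "i \<in> \<tau> ` {..<n}" unfolding permutes_image[OF assms(3)] using that \<open>k \<le> n\<close> by simp
      then show ?thesis by auto
    qed
    then show "\<tau> ` S k = {..<k}" unfolding S_def by (auto simp: image_iff)
  qed
  have cS: "card (S k) = k" if "k \<le> n" for k
    using bij_betw_same_card[OF bij[OF that]] by simp
  have key: "(\<Sum>i<k. int (\<mu> i)) + ((\<Sum>j\<in>S k. int j) - (\<Sum>i<k. int i)) \<le> (\<Sum>i<k. int (\<nu> i))" if k: "k \<le> n" for k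
  proof -
    have "(\<Sum>j\<in>S k. int (\<nu> (\<pi> j))) = (\<Sum>j\<in>S k. int (\<mu> (\<tau> j)) - int (\<tau> j) + int j)"
    proof (intro sum.cong refl)
      fix j assume "j \<in> S k"
      then have j: "j < n" by (simp add: S_def)
      have "\<nu> (\<pi> j) = \<mu> (\<tau> j) + j - \<tau> j" using fun_cong[OF assms(6), of j] j by (simp add: straighten_def)
      moreover have "\<tau> j \<le> \<mu> (\<tau> j) + j" using assms(5) j by (simp add: admissible_def)
      ultimately show "int (\<nu> (\<pi> j)) = int (\<mu> (\<tau> j)) - int (\<tau> j) + int j" by simp
    qed
    also have "\<dots> = (\<Sum>j\<in>S k. int (\<mu> (\<tau> j)) - int (\<tau> j)) + (\<Sum>j\<in>S k. int j)"
      by (rule sum.distrib)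
    also have "(\<Sum>j\<in>S k. int (\<mu> (\<tau> j)) - int (\<tau> j)) = (\<Sum>i<k. int (\<mu> i) - int i)"
      by (rule sum.reindex_bij_betw[OF bij[OF k]])
    finally have 1: "(\<Sum>j\<in>S k. int (\<nu> (\<pi> j))) = (\<Sum>i<k. int (\<mu> i)) - (\<Sum>i<k. int i) + (\<Sum>j\<in>S k. int j)"
      by (simp add: sum_subtractf)
    have inj: "inj_on \<pi> (S k)" using permutes_inj[OF assms(4)] inj_on_subset by blast
    have "(\<Sum>i<card (\<pi> ` S k). - int (\<nu> i)) \<le> (\<Sum>l\<in>\<pi> ` S k. - int (\<nu> l))"
    proof (rule sum_initial_le)
      show "mono (\<lambda>i. - int (\<nu> i))" using partition_antimono[OF partsD(1)[OF assms(2)]] by (intro monoI) simp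
    qed (use fS in simp)
    also have "card (\<pi> ` S k) = k" using card_image[OF inj] cS[OF k] by simp
    finally have "(\<Sum>j\<in>S k. int (\<nu> (\<pi> j))) \<le> (\<Sum>i<k. int (\<nu> i))"
      by (simp add: sum_negf sum.reindex[OF inj] o_def)
    then show ?thesis using 1 by simp
  qed
  have low: "(\<Sum>i<k. int i) \<le> (\<Sum>j\<in>S k. int j)" if "k \<le> n" for k
    using sum_initial_le[of int "S k"] fS cS[OF that] by (simp add: mono_def)
  show "dominated \<mu> \<nu>"
    unfolding dominated_def
  proof (intro conjI allI)
    show "psize \<mu> = psize \<nu>" using partsD(4) assms by metis
    fix k
    show "(\<Sum>i<k. \<mu> i) \<le> (\<Sum>i<k. \<nu> i)"
    proof (cases "k \<le> n")
      case True
      have "(\<Sum>i<k. int (\<mu> i)) \<le> (\<Sum>i<k. int (\<nu> i))" using key[OF True] low[OF True] by linarith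
      then have "int (\<Sum>i<k. \<mu> i) \<le> int (\<Sum>i<k. \<nu> i)" by (simp only: of_nat_sum)
      then show ?thesis by (simp only: of_nat_le_iff)
    next
      case False
      have "(\<Sum>i<k. \<alpha> i) = d" if "\<alpha> \<in> parts n d" for \<alpha>
      proof -
        have "\<forall>i\<ge>k. \<alpha> i = 0" using partsD(2)[OF that] False by simp
        then show ?thesis using psize_eq[of k \<alpha>] partsD(4)[OF that] by simp
      qed
      then show ?thesis using assms by simp
    qed
  qed
  assume eq: "\<mu> = \<nu>"
  have S: "S k = {..<k}" if k: "k \<le> n" for k
  proof -
    have "(\<Sum>j\<in>S k. int j) \<le> (\<Sum>i<k. int i)" using key[OF k] eq by simp
    then have "int (\<Sum>(S k)) \<le> int (\<Sum>i<card (S k). i)" unfolding cS[OF k] by (simp only: of_nat_sum)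
    then have "\<Sum>(S k) \<le> (\<Sum>i<card (S k). i)" by (simp only: of_nat_le_iff)
    then show ?thesis using initial_segment_eq[OF fS] cS[OF k] by metis
  qed
  show "\<tau> = id"
  proof
    fix j
    show "\<tau> j = id j"
    proof (cases "j < n")
      case True
      have "j \<in> S (Suc j)" using S[of "Suc j"] True by simp
      moreover have "j \<notin> S j" using S[of j] True by simp
      ultimately show ?thesis by (simp add: S_def True)
    qed (use permutes_not_in[OF assms(3)] in simp)
  qed
qed

lemma finite_distinct_perms: "finite (distinct_perms n \<nu>)"
proof -
  have "distinct_perms n \<nu> = (\<lambda>\<pi>. \<nu> \<circ> \<pi>) ` {\<pi>. \<pi> permutes {..<n}}" by (auto simp: distinct_perms_def)
  then show ?thesis by (simp add: finite_permutations)
qed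

section \<open>Unitriangularity of \<epsilon> and the matrices \<open>dmat\<close>\<close>

lemma epsilon_nonzero:
  assumes "\<mu> \<in> parts n d" "\<nu> \<in> parts n d" "\<alpha> \<in> distinct_perms n \<nu>" "epsilon n \<mu> \<alpha> \<noteq> 0"
  shows "dominated \<mu> \<nu>" and "\<mu> = \<nu> \<Longrightarrow> \<alpha> = \<mu>"
proof -
  have w: "\<alpha> \<in> weak_comps n d" using distinct_perms_subset[OF partsD(5)[OF assms(2)]] assms(3) by blast
  obtain \<tau> where t: "\<tau> permutes {..<n}" "admissible n \<mu> \<tau>" "\<alpha> = straighten n \<mu> \<tau>"
  proof -
    obtain \<tau> where "\<tau> \<in> {\<tau>. \<tau> permutes {..<n}}" "(if admissible n \<mu> \<tau> \<and> \<alpha> = straighten n \<mu> \<tau> then sign \<tau> else 0) \<noteq> 0"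
      using assms(4) unfolding epsilon_eq[OF w] by (rule sum.not_neutral_contains_not_neutral)
    then show ?thesis using that[of \<tau>] by (auto split: if_splits)
  qed
  obtain \<pi> where p: "\<pi> permutes {..<n}" "\<alpha> = \<nu> \<circ> \<pi>" using assms(3) by (auto simp: distinct_perms_iff)
  have e: "straighten n \<mu> \<tau> = \<nu> \<circ> \<pi>" using t(3) p(2) by simp
  show "dominated \<mu> \<nu>" by (rule straighten_dominates(1)[OF assms(1,2) t(1) p(1) t(2) e])
  assume "\<mu> = \<nu>"
  then have "\<tau> = id" by (rule straighten_dominates(2)[OF assms(1,2) t(1) p(1) t(2) e])
  then show "\<alpha> = \<mu>" using t(3) partsD(2)[OF assms(1)] by (auto simp: straighten_def)
qed

lemma epsilon_self:
  assumes "\<mu> \<in> parts n d"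
  shows "epsilon n \<mu> \<mu> = 1"
proof -
  have id: "admissible n \<mu> id" "straighten n \<mu> id = \<mu>"
    using partsD(2)[OF assms] by (auto simp: admissible_def straighten_def)
  have "\<tau> = id" if "\<tau> permutes {..<n}" "admissible n \<mu> \<tau>" "\<mu> = straighten n \<mu> \<tau>" for \<tau>
    using straighten_dominates(2)[OF assms assms that(1) permutes_id that(2)] that(3) by simp
  then have "epsilon n \<mu> \<mu> = (\<Sum>\<tau> | \<tau> permutes {..<n}. if \<tau> = id then 1 else 0)"
    unfolding epsilon_eq[OF partsD(5)[OF assms]] using id by (intro sum.cong) (auto simp: sign_id)
  then show ?thesis by (simp add: finite_permutations permutes_id)
qed

lemma dmat_nonzero:
  assumes "\<mu> \<in> parts n d" "\<nu> \<in> parts n d" "dmat n \<phi> \<mu> \<nu> \<noteq> 0"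
  shows "dominated \<mu> \<nu>"
proof -
  obtain \<alpha> where "\<alpha> \<in> distinct_perms n \<nu>" "of_int (epsilon n \<mu> \<alpha>) * \<phi> \<alpha> \<noteq> 0"
    using assms(3) unfolding dmat_def by (rule sum.not_neutral_contains_not_neutral)
  then have "epsilon n \<mu> \<alpha> \<noteq> 0" by auto
  then show ?thesis using epsilon_nonzero(1)[OF assms(1,2) \<open>\<alpha> \<in> distinct_perms n \<nu>\<close>] by simp
qed

lemma dmat_self:
  assumes "\<mu> \<in> parts n d"
  shows "dmat n \<phi> \<mu> \<mu> = \<phi> \<mu>"
proof -
  have "epsilon n \<mu> \<alpha> = 0" if "\<alpha> \<in> distinct_perms n \<mu>" "\<alpha> \<noteq> \<mu>" for \<alpha>
    using epsilon_nonzero(2)[OF assms assms that(1)] that(2) by blast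
  then have "dmat n \<phi> \<mu> \<mu> = (\<Sum>\<alpha>\<in>distinct_perms n \<mu>. if \<alpha> = \<mu> then \<phi> \<mu> else 0)"
    unfolding dmat_def using epsilon_self[OF assms] by (intro sum.cong) auto
  moreover have "\<mu> \<in> distinct_perms n \<mu>" by (auto simp: distinct_perms_iff intro!: exI[of _ id] permutes_id)
  ultimately show ?thesis by (simp add: finite_distinct_perms)
qed

lemma bracket_eq: "bracket n lam \<mu> \<nu> = eigen n lam * dmat n (\<lambda>_. 1) \<mu> \<nu> - dmat n (eigen n) \<mu> \<nu>"
  by (simp add: bracket_def dmat_def right_diff_distrib sum_subtractf sum_distrib_left mult.commute)

lemma bracket_dmat: "bracket n lam \<mu> \<nu> = dmat n (\<lambda>\<alpha>. eigen n lam - eigen n \<alpha>) \<mu> \<nu>"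
  by (simp add: bracket_def dmat_def)

lemma coeff_prod_linear:
  assumes "finite A"
  shows "poly.coeff (\<Prod>j\<in>A. [:1, c j:]) 0 = 1 \<and> poly.coeff (\<Prod>j\<in>A. [:1, c j:]) 1 = (\<Sum>j\<in>A. c j :: 'a::comm_ring_1)"
  using assms
proof (induction A rule: finite_induct)
  case (insert x A)
  have L: "poly.coeff ([:1, a:] * p) 1 = poly.coeff p 1 + a * poly.coeff p 0"
    "poly.coeff ([:1, a:] * p) 0 = poly.coeff p 0" for a and p :: "'a poly"
    by (simp_all add: mult_pCons_left)
  show ?case
    unfolding prod.insert[OF insert.hyps] sum.insert[OF insert.hyps] L using insert.IH by simp
qed simp

definition dmat_poly :: "nat \<Rightarrow> (nat \<Rightarrow> nat) \<Rightarrow> (nat \<Rightarrow> nat) \<Rightarrow> qt_field poly" where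
  "dmat_poly n \<mu> \<nu> = (\<Sum>\<alpha>\<in>distinct_perms n \<nu>. Polynomial.smult (of_int (epsilon n \<mu> \<alpha>))
     (\<Prod>j<n. [:1, tpar ^ (n - Suc j) * qpar ^ \<alpha> j:]))"

lemma poly_dmat_poly: "poly (dmat_poly n \<mu> \<nu>) u = dmat n (eigen_poly n u) \<mu> \<nu>"
  by (simp add: dmat_poly_def dmat_def eigen_poly_def poly_sum poly_prod mult_ac)

lemma coeff_dmat_poly:
  "poly.coeff (dmat_poly n \<mu> \<nu>) 1 = dmat n (eigen n) \<mu> \<nu>"
  by (simp only: dmat_poly_def dmat_def eigen_def coeff_sum coeff_smult coeff_prod_linear[OF finite_lessThan] mult.commute)

text \<open>[|\<alpha>|] is the coefficient of u in \<open>eigen_poly n u \<alpha>\<close>. The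
  identity for every u in an infinite field is one of polynomials, from which the linear coefficient
  is taken.\<close>

theorem dmat_self_adjoint:
  assumes "\<mu> \<in> parts n d" "\<kappa> \<in> parts n d"
  shows "(\<Sum>\<nu>\<in>parts n d. \<Sum>\<rho>\<in>parts n d. dmat n (eigen n) \<mu> \<nu> * dmat n (\<lambda>_. 1) \<kappa> \<rho> * gram n \<nu> \<rho>) =
    (\<Sum>\<nu>\<in>parts n d. \<Sum>\<rho>\<in>parts n d. dmat n (\<lambda>_. 1) \<mu> \<nu> * dmat n (eigen n) \<kappa> \<rho> * gram n \<nu> \<rho>)"
proof -
  let ?L = "\<Sum>\<nu>\<in>parts n d. \<Sum>\<rho>\<in>parts n d. Polynomial.smult (dmat n (\<lambda>_. 1) \<kappa> \<rho> * gram n \<nu> \<rho>) (dmat_poly n \<mu> \<nu>)"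
  let ?R = "\<Sum>\<nu>\<in>parts n d. \<Sum>\<rho>\<in>parts n d. Polynomial.smult (dmat n (\<lambda>_. 1) \<mu> \<nu> * gram n \<nu> \<rho>) (dmat_poly n \<kappa> \<rho>)"
  have "poly ?L = poly ?R"
  proof
    fix u show "poly ?L u = poly ?R u"
      using dmat_self_adjoint_u[OF partsD(5)[OF assms(1)] partsD(5)[OF assms(2)], of u]
      by (simp add: poly_sum poly_dmat_poly mult_ac)
  qed
  then have "?L = ?R" by (simp only: poly_eq_poly_eq_iff)
  then have "poly.coeff ?L 1 = poly.coeff ?R 1" by (simp only:)
  then show ?thesis by (simp only: coeff_sum coeff_smult coeff_dmat_poly) (simp only: mult_ac)
qed

text \<open>The power of t marks the position and the power of q beside it is the entry.\<close>

lemma eigen_inj: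
  assumes "\<alpha> \<in> weak_comps n d" "\<beta> \<in> weak_comps n d'" "eigen n \<alpha> = eigen n \<beta>"
  shows "\<alpha> = \<beta>"
proof
  fix i
  let ?p = "\<lambda>\<alpha>. \<Sum>j<n. Polynomial.monom (Polynomial.monom (1::rat) (\<alpha> j)) (n - Suc j)"
  have hs: "to_fract (sum f A) = (\<Sum>a\<in>A. to_fract (f a))" for f :: "nat \<Rightarrow> rat poly poly" and A
    by (induction A rule: infinite_finite_induct) simp_all
  have "eigen n \<alpha> = to_fract (?p \<alpha>)" for \<alpha>
    unfolding eigen_def qt_monom hs ..
  then have "?p \<alpha> = ?p \<beta>" using assms(3) by (simp only: to_fract_eq_iff)
  moreover have "poly.coeff (?p \<gamma>) (n - Suc i) = Polynomial.monom 1 (\<gamma> i)" if "i < n" for \<gamma>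
  proof -
    have "poly.coeff (?p \<gamma>) (n - Suc i) = (\<Sum>j<n. if j = i then Polynomial.monom 1 (\<gamma> j) else 0)"
      unfolding coeff_sum using that by (intro sum.cong) auto
    then show ?thesis using that by simp
  qed
  ultimately have "Polynomial.monom (1::rat) (\<alpha> i) = Polynomial.monom 1 (\<beta> i)" if "i < n"
    using that by metis
  then show "\<alpha> i = \<beta> i"
    using assms(1,2) by (cases "i < n") (auto simp: weak_comps_def monom_eq_iff')
qed

section \<open>Schur functions as kernel coefficients\<close>

lemma det_drop_unit_row:
  fixes A :: "'a::idom mat"
  assumes "A = mat (Suc N) (Suc N) f" "f (N, N) = 1" "\<And>j. j < N \<Longrightarrow> f (N, j) = 0"
  shows "det A = det (mat N N f)"
proof -
  have c: "A \<in> carrier_mat (Suc N) (Suc N)" by (simp add: assms(1))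
  have "det A = (\<Sum>j<Suc N. A $$ (N, j) * cofactor A N j)"
    by (rule laplace_expansion_row[OF c]) simp
  also have "\<dots> = cofactor A N N"
    using assms by simp
  also have "\<dots> = det (mat_delete A N N)"
    unfolding cofactor_def by (simp add: power_add[symmetric])
  also have "mat_delete A N N = mat N N f"
    by (rule eq_matI) (auto simp: assms(1) mat_delete_def)
  finally show ?thesis .
qed

text \<open>The Jacobi-Trudi determinant has \<open>num_parts \<mu>\<close> rows, the kernel n. A
  zero part appends a row with S_0 = 1 on the diagonal and S of negative index to its left, which
  does not change the value.\<close>

lemma schur_pleth_eq_gdet:
  assumes "\<mu> \<in> parts n d"
  shows "schur_pleth \<mu> (Xtq n) = gdet n 0 (stair n \<mu>)"
proof -
  define f where "f = (\<lambda>(a, b). pleth (complete_sym (int (\<mu> a) - int a + int b)) (Xtq n))"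
  have p: "is_partition \<mu>" "num_parts \<mu> \<le> n" using assms by (auto simp: parts_def)
  have neg: "pleth (complete_sym z) (Xtq n) = 0" if "z < 0" for z
    using that by (simp add: complete_sym_def pleth_def)
  have "det (mat n n f) = det (mat (num_parts \<mu>) (num_parts \<mu>) f)"
    using p(2)
  proof (induction n rule: dec_induct)
    case (step N)
    have z: "\<mu> N = 0" using partition_zero_iff[OF p(1)] step by simp
    have "det (mat (Suc N) (Suc N) f) = det (mat N N f)"
    proof (rule det_drop_unit_row[OF refl])
      show "f (N, N) = 1" using gsym_0[of n] by (simp add: f_def z gsym_def)
      show "f (N, j) = 0" if "j < N" for j using that by (simp add: f_def z neg)
    qed
    then show ?case using step by simp
  qed simp
  then have "schur_pleth \<mu> (Xtq n) = det (mat n n f)"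
    by (simp add: schur_pleth_def f_def)
  also have "\<dots> = (\<Sum>p | p permutes {..<n}. of_int (sign p) * (\<Prod>i<n. f (i, p i)))"
    by (rule det_permutes)
  also have "\<dots> = gdet n 0 (stair n \<mu>)"
    unfolding gdet_def
  proof (intro sum.cong refl arg_cong2[where f = "(*)"] prod.cong)
    fix p i assume "p \<in> {p. p permutes {..<n}}" "i \<in> {..<n}"
    then have i: "i < n" "p i < n" using permutes_less[of p n i] by auto
    show "f (i, p i) = fps_nth (krow n 0 (desc n p i)) (stair n \<mu> i)"
    proof (cases "i \<le> \<mu> i + p i")
      case True
      have "int (\<mu> i) - int i + int (p i) = int (\<mu> i + p i - i)" using True by simp
      moreover have "\<not> stair n \<mu> i < desc n p i" "stair n \<mu> i - desc n p i = \<mu> i + p i - i"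
        using True i by (auto simp: stair_def)
      ultimately show ?thesis by (simp add: f_def krow_nth gsym_def Const_1)
    next
      case False
      then have "int (\<mu> i) - int i + int (p i) < 0" by simp
      moreover have "stair n \<mu> i < desc n p i" using False i by (auto simp: stair_def)
      ultimately show ?thesis by (simp add: f_def krow_nth neg)
    qed
  qed
  finally show ?thesis .
qed

lemma schur_pleth_expand:
  assumes "\<mu> \<in> parts n d"
  shows "schur_pleth \<mu> (Xtq n) = (\<Sum>\<nu>\<in>parts n d. Const (dmat n (\<lambda>_. 1) \<mu> \<nu>) * (\<Prod>i<n. gsym n (\<nu> i)))"
proof -
  have one: "eigen_poly n 0 = (\<lambda>_. 1)" by (rule ext) (rule eigen_poly_0)
  show ?thesis unfolding schur_pleth_eq_gdet[OF assms] gdet_stair[OF partsD(5)[OF assms]] one ..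
qed

text \<open>A numerical statistic that grows strictly along the dominance order, so that extremal
  partitions and inductions can be taken over the natural numbers.\<close>

definition rank :: "nat \<Rightarrow> (nat \<Rightarrow> nat) \<Rightarrow> nat" where
  "rank n \<mu> = (\<Sum>k\<le>n. \<Sum>i<k. \<mu> i)"

lemma rank_mono: "dominated \<mu> \<nu> \<Longrightarrow> rank n \<mu> \<le> rank n \<nu>"
  unfolding rank_def by (rule sum_mono) (simp add: dominated_def)

lemma rank_strict:
  assumes "\<mu> \<in> parts n d" "\<nu> \<in> parts n d" "dominated \<mu> \<nu>" "rank n \<nu> \<le> rank n \<mu>"
  shows "\<mu> = \<nu>"
proof -
  have le: "(\<Sum>i<k. \<mu> i) \<le> (\<Sum>i<k. \<nu> i)" for k using assms(3) by (simp add: dominated_def)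
  have eq: "(\<Sum>i<k. \<mu> i) = (\<Sum>i<k. \<nu> i)" if "k \<le> n" for k
  proof (rule ccontr)
    assume "(\<Sum>i<k. \<mu> i) \<noteq> (\<Sum>i<k. \<nu> i)"
    then have "(\<Sum>i<k. \<mu> i) < (\<Sum>i<k. \<nu> i)" using le[of k] by simp
    then have "rank n \<mu> < rank n \<nu>"
      unfolding rank_def using le that by (intro sum_strict_mono_ex1) auto
    then show False using assms(4) by simp
  qed
  show ?thesis
  proof
    fix i show "\<mu> i = \<nu> i"
    proof (cases "i < n")
      case True
      then show ?thesis using eq[of i] eq[of "Suc i"] by simp
    next
      case False
      then show ?thesis using partsD(2)[OF assms(1)] partsD(2)[OF assms(2)] by simp
    qed
  qed
qed

lemma maximal_part:
  assumes "\<kappa> \<in> parts n d" "Q \<kappa>"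
  obtains \<mu> where "\<mu> \<in> parts n d" "Q \<mu>" "dominated \<kappa> \<mu>"
    "\<And>\<nu>. \<nu> \<in> parts n d \<Longrightarrow> Q \<nu> \<Longrightarrow> dominated \<mu> \<nu> \<Longrightarrow> \<nu> = \<mu>"
proof -
  let ?S = "{\<mu> \<in> parts n d. Q \<mu> \<and> dominated \<kappa> \<mu>}"
  have S: "finite ?S" "?S \<noteq> {}" using finite_parts[of n d] assms dominated_refl by auto
  then have "Max (rank n ` ?S) \<in> rank n ` ?S" by (intro Max_in) auto
  then obtain \<mu> where \<mu>: "\<mu> \<in> ?S" "rank n \<mu> = Max (rank n ` ?S)" by auto
  show thesis
  proof (rule that[of \<mu>])
    show "\<mu> \<in> parts n d" "Q \<mu>" "dominated \<kappa> \<mu>" using \<mu>(1) by auto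
    fix \<nu> assume \<nu>: "\<nu> \<in> parts n d" "Q \<nu>" "dominated \<mu> \<nu>"
    have "\<nu> \<in> ?S" using \<nu> \<mu>(1) dominated_trans by blast
    then have "rank n \<nu> \<le> rank n \<mu>" unfolding \<mu>(2) using S(1) by (intro Max_ge) auto
    then show "\<nu> = \<mu>" using rank_strict[of \<mu> n d \<nu>] \<mu>(1) \<nu> by auto
  qed
qed

lemma minimal_part:
  assumes "\<kappa> \<in> parts n d" "Q \<kappa>"
  obtains \<mu> where "\<mu> \<in> parts n d" "Q \<mu>"
    "\<And>\<nu>. \<nu> \<in> parts n d \<Longrightarrow> Q \<nu> \<Longrightarrow> dominated \<nu> \<mu> \<Longrightarrow> \<nu> = \<mu>"
proof -
  let ?S = "{\<mu> \<in> parts n d. Q \<mu>}"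
  have S: "finite ?S" "?S \<noteq> {}" using finite_parts[of n d] assms by auto
  then have "Min (rank n ` ?S) \<in> rank n ` ?S" by (intro Min_in) auto
  then obtain \<mu> where \<mu>: "\<mu> \<in> ?S" "rank n \<mu> = Min (rank n ` ?S)" by auto
  show thesis
  proof (rule that[of \<mu>])
    show "\<mu> \<in> parts n d" "Q \<mu>" using \<mu>(1) by auto
    fix \<nu> assume \<nu>: "\<nu> \<in> parts n d" "Q \<nu>" "dominated \<nu> \<mu>"
    have "rank n \<mu> \<le> rank n \<nu>" unfolding \<mu>(2) using S(1) \<nu> by (intro Min_le) auto
    then show "\<nu> = \<mu>" using rank_strict[of \<nu> n d \<mu>] \<mu>(1) \<nu> by auto
  qed
qed

section \<open>The expansion of the determinant\<close>

definition bordered :: "nat \<Rightarrow> (nat \<Rightarrow> nat) \<Rightarrow> (nat \<Rightarrow> nat) list \<Rightarrow> ((nat \<Rightarrow> nat) \<Rightarrow> qt_field) \<Rightarrow> qt_field mat" where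
  "bordered n lam mus X = mat (Suc (length mus)) (Suc (length mus)) (\<lambda>(s, c).
     if s = 0 then X ((lam # mus) ! c) else bracket n lam ((lam # mus) ! c) (mus ! (s - 1)))"

text \<open>The cofactor at the column of \<mu>, written with a unit vector as first row so that it
  is indexed by the partition and not by its place in the list.\<close>

definition ecof :: "nat \<Rightarrow> (nat \<Rightarrow> nat) \<Rightarrow> (nat \<Rightarrow> nat) list \<Rightarrow> (nat \<Rightarrow> nat) \<Rightarrow> qt_field" where
  "ecof n lam mus \<mu> = det (bordered n lam mus (\<lambda>\<nu>. if \<nu> = \<mu> then 1 else 0))"

lemma sum_nth_distinct:
  assumes "distinct xs"
  shows "(\<Sum>c<length xs. f (xs ! c)) = (\<Sum>x\<in>set xs. f x)"
  by (rule sum.reindex_bij_betw[OF bij_betw_nth[OF assms refl refl]])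

lemma det_bordered_cofactor:
  "det (bordered n lam mus X) =
    (\<Sum>c<Suc (length mus). X ((lam # mus) ! c) * cofactor (bordered n lam mus (\<lambda>_. 0)) 0 c)"
proof -
  have c: "bordered n lam mus X \<in> carrier_mat (Suc (length mus)) (Suc (length mus))" for X
    by (simp add: bordered_def)
  have m: "mat_delete (bordered n lam mus X) 0 c = mat_delete (bordered n lam mus (\<lambda>_. 0)) 0 c" for c
    by (rule eq_matI) (auto simp: mat_delete_def bordered_def)
  have "det (bordered n lam mus X) = (\<Sum>c<Suc (length mus). bordered n lam mus X $$ (0, c) * cofactor (bordered n lam mus X) 0 c)"
    by (rule laplace_expansion_row[OF c]) simp
  also have "\<dots> = (\<Sum>c<Suc (length mus). X ((lam # mus) ! c) * cofactor (bordered n lam mus (\<lambda>_. 0)) 0 c)"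
    unfolding cofactor_def m by (intro sum.cong) (simp_all add: bordered_def)
  finally show ?thesis .
qed

lemma ecof_nth:
  assumes "distinct (lam # mus)" "c < Suc (length mus)"
  shows "ecof n lam mus ((lam # mus) ! c) = cofactor (bordered n lam mus (\<lambda>_. 0)) 0 c"
proof -
  have "(lam # mus) ! c' = (lam # mus) ! c \<longleftrightarrow> c' = c" if "c' < Suc (length mus)" for c'
    using nth_eq_iff_index_eq[OF assms(1), of c' c] that assms(2) by simp
  then have "ecof n lam mus ((lam # mus) ! c) =
     (\<Sum>c'<Suc (length mus). if c' = c then cofactor (bordered n lam mus (\<lambda>_. 0)) 0 c' else 0)"
    unfolding ecof_def det_bordered_cofactor by (intro sum.cong) auto
  then show ?thesis using assms(2) by simp
qed

lemma det_bordered: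
  assumes "distinct (lam # mus)"
  shows "det (bordered n lam mus X) = (\<Sum>\<mu>\<in>set (lam # mus). X \<mu> * ecof n lam mus \<mu>)"
proof -
  have "det (bordered n lam mus X) = (\<Sum>c<length (lam # mus). X ((lam # mus) ! c) * ecof n lam mus ((lam # mus) ! c))"
    unfolding det_bordered_cofactor using ecof_nth[OF assms] by (intro sum.cong) auto
  also have "\<dots> = (\<Sum>\<mu>\<in>set (lam # mus). X \<mu> * ecof n lam mus \<mu>)"
    by (rule sum_nth_distinct[OF assms])
  finally show ?thesis .
qed

lemma det_det_matrix:
  assumes "distinct (lam # mus)"
  shows "det (det_matrix n lam mus) = (\<Sum>\<mu>\<in>set (lam # mus). Const (ecof n lam mus \<mu>) * schur_pleth \<mu> (Xtq n))"
proof -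
  have c: "det_matrix n lam mus \<in> carrier_mat (Suc (length mus)) (Suc (length mus))"
    by (simp add: det_matrix_def)
  have m: "mat_delete (det_matrix n lam mus) 0 c = map_mat Const (mat_delete (bordered n lam mus (\<lambda>_. 0)) 0 c)" for c
    by (rule eq_matI) (auto simp: mat_delete_def bordered_def det_matrix_def)
  have "Const (- 1) = - 1" by (simp add: Const_eq_cst cst_hom)
  then have cf: "cofactor (det_matrix n lam mus) 0 c = Const (cofactor (bordered n lam mus (\<lambda>_. 0)) 0 c)" for c
    unfolding cofactor_def m Const.hom_det by (simp add: Const_mult Const.hom_power)
  have "det (det_matrix n lam mus) = (\<Sum>c<Suc (length mus). det_matrix n lam mus $$ (0, c) * cofactor (det_matrix n lam mus) 0 c)"
    by (rule laplace_expansion_row[OF c]) simp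
  also have "\<dots> = (\<Sum>c<length (lam # mus). Const (ecof n lam mus ((lam # mus) ! c)) * schur_pleth ((lam # mus) ! c) (Xtq n))"
    unfolding cf using ecof_nth[OF assms] by (intro sum.cong) (auto simp: det_matrix_def mult.commute)
  also have "\<dots> = (\<Sum>\<mu>\<in>set (lam # mus). Const (ecof n lam mus \<mu>) * schur_pleth \<mu> (Xtq n))"
    by (rule sum_nth_distinct[OF assms])
  finally show ?thesis .
qed

text \<open>The sum expands the determinant whose first row repeats the row of \<nu>.\<close>

lemma ecof_bracket:
  assumes "distinct (lam # mus)" "\<nu> \<in> set mus"
  shows "(\<Sum>\<mu>\<in>set (lam # mus). bracket n lam \<mu> \<nu> * ecof n lam mus \<mu>) = 0"
proof -
  obtain s where s: "s < length mus" "mus ! s = \<nu>" using assms(2) by (metis in_set_conv_nth)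
  let ?M = "bordered n lam mus (\<lambda>\<mu>. bracket n lam \<mu> \<nu>)"
  have "det ?M = 0"
  proof (rule det_identical_rows[of _ "Suc (length mus)" 0 "Suc s"])
    show "row ?M 0 = row ?M (Suc s)" by (rule eq_vecI) (use s in \<open>auto simp: bordered_def\<close>)
  qed (use s in \<open>simp_all add: bordered_def\<close>)
  then show ?thesis unfolding det_bordered[OF assms(1)] .
qed

text \<open>The minor is triangular for dominance, but the order of the list is arbitrary. A nonzero
  Leibniz term requires \<mu>^(p s) \<le> \<mu>^(s) for every s; as \<open>p\<close> preserves the
  total rank, equality holds throughout and p is the identity.\<close>

lemma ecof_lam:
  assumes "lam \<in> parts n d" "distinct mus" "set mus = strictly_above lam"
  shows "ecof n lam mus lam = v_norm n lam"
proof -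
  let ?r = "length mus"
  have mem: "mus ! s \<in> parts n d" if "s < ?r" for s
    using strictly_above_parts[OF assms(1)] assms(3) nth_mem[OF that] by blast
  have dist: "distinct (lam # mus)" using assms by (simp add: strictly_above_def)
  have md: "mat_delete (bordered n lam mus (\<lambda>_. 0)) 0 0 = mat ?r ?r (\<lambda>(s, c). bracket n lam (mus ! c) (mus ! s))"
    by (rule eq_matI) (auto simp: mat_delete_def bordered_def)
  have "ecof n lam mus lam = det (mat ?r ?r (\<lambda>(s, c). bracket n lam (mus ! c) (mus ! s)))"
    using ecof_nth[OF dist, of 0 n] md by (simp add: cofactor_def)
  also have "\<dots> = (\<Sum>p | p permutes {..<?r}. of_int (sign p) * (\<Prod>s<?r. bracket n lam (mus ! p s) (mus ! s)))"
    by (simp add: det_permutes)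
  also have "\<dots> = (\<Sum>p | p permutes {..<?r}. if p = id then \<Prod>s<?r. bracket n lam (mus ! s) (mus ! s) else 0)"
  proof (intro sum.cong refl)
    fix p assume "p \<in> {p. p permutes {..<?r}}"
    then have p: "p permutes {..<?r}" by simp
    show "of_int (sign p) * (\<Prod>s<?r. bracket n lam (mus ! p s) (mus ! s)) =
        (if p = id then \<Prod>s<?r. bracket n lam (mus ! s) (mus ! s) else 0)"
    proof (cases "(\<Prod>s<?r. bracket n lam (mus ! p s) (mus ! s)) = 0")
      case False
      then have nz: "bracket n lam (mus ! p s) (mus ! s) \<noteq> 0" if "s < ?r" for s using that by simp
      have dom: "dominated (mus ! p s) (mus ! s)" if "s < ?r" for s
        using dmat_nonzero[OF mem[OF permutes_less[OF p that]] mem[OF that]] nz[OF that] unfolding bracket_dmat by blast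
      have tot: "(\<Sum>s<?r. rank n (mus ! p s)) = (\<Sum>s<?r. rank n (mus ! s))"
        using sum.permute[OF p, of "\<lambda>s. rank n (mus ! s)"] by (simp add: o_def)
      have "rank n (mus ! s) \<le> rank n (mus ! p s)" if s: "s < ?r" for s
      proof (rule ccontr)
        assume "\<not> rank n (mus ! s) \<le> rank n (mus ! p s)"
        then have "(\<Sum>s<?r. rank n (mus ! p s)) < (\<Sum>s<?r. rank n (mus ! s))"
          using s rank_mono[OF dom] by (intro sum_strict_mono_ex1) (auto simp: not_le)
        then show False using tot by simp
      qed
      then have "mus ! p s = mus ! s" if "s < ?r" for s
        using rank_strict[OF mem[OF permutes_less[OF p that]] mem[OF that] dom[OF that]] that by blast
      then have "p s = s" if "s < ?r" for s
        using nth_eq_iff_index_eq[OF assms(2) permutes_less[OF p that] that] that by blast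
      then have "p = id" using permutes_not_in[OF p] by (metis eq_id_iff lessThan_iff)
      then show ?thesis by (simp add: sign_id)
    next
      case True
      then show ?thesis by (cases "p = id") simp_all
    qed
  qed
  also have "\<dots> = (\<Prod>s<?r. bracket n lam (mus ! s) (mus ! s))"
    by (simp add: finite_permutations permutes_id)
  also have "\<dots> = (\<Prod>s<?r. eigen n lam - eigen n (mus ! s))"
    by (intro prod.cong refl) (simp add: bracket_dmat dmat_self[OF mem])
  also have "\<dots> = v_norm n lam"
    unfolding v_norm_def assms(3)[symmetric]
    by (rule prod.reindex_bij_betw[OF bij_betw_nth[OF assms(2) refl refl]])
  finally show ?thesis .
qed

lemma v_norm_nonzero:
  assumes "lam \<in> parts n d"
  shows "v_norm n lam \<noteq> 0"
proof -
  have "eigen n lam \<noteq> eigen n \<mu>" if "\<mu> \<in> strictly_above lam" for \<mu>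
  proof -
    have "\<mu> \<in> parts n d" "\<mu> \<noteq> lam" using strictly_above_parts[OF assms] that by (auto simp: strictly_above_def)
    then show ?thesis using eigen_inj[OF partsD(5)[OF assms] partsD(5)] by metis
  qed
  then show ?thesis
    unfolding v_norm_def using finite_strictly_above[OF assms] by (simp add: prod_zero_iff)
qed

text \<open>Separates the cofactors from the list \<open>mus\<close>: only their two relations
  matter from here on. For the function combined with weights \<open>e\<close>, \<open>F\<close>
  holds the coefficients in the g_\<nu> and \<open>f\<close> those at the monomials.\<close>

locale det_vector =
  fixes n d :: nat and lam :: "nat \<Rightarrow> nat" and e :: "(nat \<Rightarrow> nat) \<Rightarrow> qt_field"
  assumes lam: "lam \<in> parts n d"
    and brk: "\<And>\<nu>. \<nu> \<in> strictly_above lam \<Longrightarrow> (\<Sum>\<mu>\<in>insert lam (strictly_above lam). bracket n lam \<mu> \<nu> * e \<mu>) = 0"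
    and e_lam: "e lam = v_norm n lam"
begin

abbreviation "A \<equiv> insert lam (strictly_above lam)"

definition F :: "(nat \<Rightarrow> nat) \<Rightarrow> qt_field" where
  "F \<nu> = (\<Sum>\<mu>\<in>A. e \<mu> * dmat n (\<lambda>_. 1) \<mu> \<nu>)"

definition f :: "(nat \<Rightarrow> nat) \<Rightarrow> qt_field" where
  "f \<kappa> = (\<Sum>\<nu>\<in>parts n d. F \<nu> * gram n \<nu> \<kappa>)"

lemma A_parts: "\<mu> \<in> A \<Longrightarrow> \<mu> \<in> parts n d"
  using strictly_above_parts[OF lam] lam by auto

lemma A_dom: "\<mu> \<in> A \<Longrightarrow> dominated lam \<mu>"
  by (auto simp: strictly_above_def dominated_refl)

lemma finite_A: "finite A" using finite_strictly_above[OF lam] by simp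

lemma A_iff: "\<nu> \<in> parts n d \<Longrightarrow> \<nu> \<in> A \<longleftrightarrow> dominated lam \<nu>"
  using partsD(1) by (auto simp: strictly_above_def dominated_refl)

lemma comb_nonzero:
  assumes "\<nu> \<in> parts n d" "(\<Sum>\<mu>\<in>A. e \<mu> * dmat n \<phi> \<mu> \<nu>) \<noteq> 0"
  shows "dominated lam \<nu>"
proof -
  obtain \<mu> where \<mu>: "\<mu> \<in> A" "e \<mu> * dmat n \<phi> \<mu> \<nu> \<noteq> 0"
    using assms(2) by (rule sum.not_neutral_contains_not_neutral)
  then have "dominated \<mu> \<nu>" using dmat_nonzero[OF A_parts[OF \<mu>(1)] assms(1)] by auto
  then show ?thesis using A_dom[OF \<mu>(1)] dominated_trans by blast
qed

lemma comb_lam: "(\<Sum>\<mu>\<in>A. e \<mu> * dmat n \<phi> \<mu> lam) = v_norm n lam * \<phi> lam"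
proof -
  have "dmat n \<phi> \<mu> lam = 0" if "\<mu> \<in> strictly_above lam" for \<mu>
  proof (rule ccontr)
    assume "dmat n \<phi> \<mu> lam \<noteq> 0"
    then have "dominated \<mu> lam" using dmat_nonzero[OF A_parts lam] that by blast
    moreover have "dominated lam \<mu>" "\<mu> \<noteq> lam" using that by (auto simp: strictly_above_def)
    ultimately show False using dominated_antisym by blast
  qed
  moreover have "lam \<notin> strictly_above lam" by (simp add: strictly_above_def)
  ultimately show ?thesis
    using finite_strictly_above[OF lam] by (simp add: e_lam dmat_self[OF lam])
qed

lemma F_nonzero: "\<nu> \<in> parts n d \<Longrightarrow> F \<nu> \<noteq> 0 \<Longrightarrow> dominated lam \<nu>"
  unfolding F_def by (rule comb_nonzero)

lemma F_lam: "F lam = v_norm n lam"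
  unfolding F_def comb_lam by simp

text \<open>The determinant supplies these equations only for \<nu> > \<lambda>. At \<lambda> the
  eigenvalue difference is zero, and elsewhere triangularity leaves no term.\<close>

lemma bracket_zero:
  assumes "\<nu> \<in> parts n d"
  shows "(\<Sum>\<mu>\<in>A. e \<mu> * bracket n lam \<mu> \<nu>) = 0"
proof (cases "\<nu> \<in> strictly_above lam")
  case True
  then show ?thesis using brk by (simp add: mult.commute)
next
  case False
  show ?thesis
  proof (cases "\<nu> = lam")
    case True
    then show ?thesis unfolding bracket_dmat True comb_lam by simp
  next
    case ne: False
    then have "\<not> dominated lam \<nu>" using False A_iff[OF assms] by blast
    then show ?thesis unfolding bracket_dmat using comb_nonzero[OF assms] by blast
  qed
qed

lemma eigen_comb:
  assumes "\<nu> \<in> parts n d"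
  shows "(\<Sum>\<mu>\<in>A. e \<mu> * dmat n (eigen n) \<mu> \<nu>) = eigen n lam * F \<nu>"
proof -
  have "(\<Sum>\<mu>\<in>A. e \<mu> * bracket n lam \<mu> \<nu>) = eigen n lam * F \<nu> - (\<Sum>\<mu>\<in>A. e \<mu> * dmat n (eigen n) \<mu> \<nu>)"
    unfolding bracket_eq F_def right_diff_distrib sum_subtractf sum_distrib_left by (simp only: mult.left_commute)
  then show ?thesis using bracket_zero[OF assms] by simp
qed

text \<open>Summing self-adjointness with weights \<open>e\<close> moves \<phi> from the test index
  \<kappa> onto the vector, where its effect is known.\<close>

lemma adjoint:
  assumes sa: "\<And>\<mu>. \<mu> \<in> parts n d \<Longrightarrow>
      (\<Sum>\<nu>\<in>parts n d. \<Sum>\<rho>\<in>parts n d. dmat n \<phi> \<mu> \<nu> * dmat n (\<lambda>_. 1) \<kappa> \<rho> * gram n \<nu> \<rho>) =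
      (\<Sum>\<nu>\<in>parts n d. \<Sum>\<rho>\<in>parts n d. dmat n (\<lambda>_. 1) \<mu> \<nu> * dmat n \<phi> \<kappa> \<rho> * gram n \<nu> \<rho>)"
  shows "(\<Sum>\<rho>\<in>parts n d. dmat n \<phi> \<kappa> \<rho> * f \<rho>) =
    (\<Sum>\<rho>\<in>parts n d. dmat n (\<lambda>_. 1) \<kappa> \<rho> * (\<Sum>\<nu>\<in>parts n d. (\<Sum>\<mu>\<in>A. e \<mu> * dmat n \<phi> \<mu> \<nu>) * gram n \<nu> \<rho>))"
proof -
  have comb: "(\<Sum>\<rho>\<in>parts n d. dmat n b \<kappa> \<rho> * (\<Sum>\<nu>\<in>parts n d. (\<Sum>\<mu>\<in>A. e \<mu> * dmat n a \<mu> \<nu>) * gram n \<nu> \<rho>)) =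
    (\<Sum>\<mu>\<in>A. e \<mu> * (\<Sum>\<nu>\<in>parts n d. \<Sum>\<rho>\<in>parts n d. dmat n a \<mu> \<nu> * dmat n b \<kappa> \<rho> * gram n \<nu> \<rho>))" for a b
  proof -
    have "(\<Sum>\<rho>\<in>parts n d. dmat n b \<kappa> \<rho> * (\<Sum>\<nu>\<in>parts n d. (\<Sum>\<mu>\<in>A. e \<mu> * dmat n a \<mu> \<nu>) * gram n \<nu> \<rho>)) =
      (\<Sum>\<rho>\<in>parts n d. \<Sum>\<nu>\<in>parts n d. \<Sum>\<mu>\<in>A. e \<mu> * (dmat n a \<mu> \<nu> * dmat n b \<kappa> \<rho> * gram n \<nu> \<rho>))"
      unfolding sum_distrib_left sum_distrib_right by (intro sum.cong refl) (simp only: mult_ac)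
    also have "\<dots> = (\<Sum>\<rho>\<in>parts n d. \<Sum>\<mu>\<in>A. \<Sum>\<nu>\<in>parts n d. e \<mu> * (dmat n a \<mu> \<nu> * dmat n b \<kappa> \<rho> * gram n \<nu> \<rho>))"
      by (intro sum.cong refl sum.swap)
    also have "\<dots> = (\<Sum>\<mu>\<in>A. \<Sum>\<rho>\<in>parts n d. \<Sum>\<nu>\<in>parts n d. e \<mu> * (dmat n a \<mu> \<nu> * dmat n b \<kappa> \<rho> * gram n \<nu> \<rho>))"
      by (rule sum.swap)
    also have "\<dots> = (\<Sum>\<mu>\<in>A. \<Sum>\<nu>\<in>parts n d. \<Sum>\<rho>\<in>parts n d. e \<mu> * (dmat n a \<mu> \<nu> * dmat n b \<kappa> \<rho> * gram n \<nu> \<rho>))"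
      by (intro sum.cong refl sum.swap)
    finally show ?thesis unfolding sum_distrib_left .
  qed
  show ?thesis
    unfolding f_def F_def comb using sa A_parts by (intro sum.cong refl) simp
qed

text \<open>Self-adjointness carries the eigenvector property from \<open>F\<close> over to
  \<open>f\<close>, where it becomes a generalized eigenvalue problem with the Schur matrix on the
  right.\<close>

lemma eigen_equation:
  assumes "\<kappa> \<in> parts n d"
  shows "(\<Sum>\<rho>\<in>parts n d. dmat n (eigen n) \<kappa> \<rho> * f \<rho>) = eigen n lam * (\<Sum>\<rho>\<in>parts n d. dmat n (\<lambda>_. 1) \<kappa> \<rho> * f \<rho>)"
proof -
  have "(\<Sum>\<rho>\<in>parts n d. dmat n (eigen n) \<kappa> \<rho> * f \<rho>) =
      (\<Sum>\<rho>\<in>parts n d. dmat n (\<lambda>_. 1) \<kappa> \<rho> * (\<Sum>\<nu>\<in>parts n d. (\<Sum>\<mu>\<in>A. e \<mu> * dmat n (eigen n) \<mu> \<nu>) * gram n \<nu> \<rho>))"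
    by (rule adjoint) (rule dmat_self_adjoint[OF _ assms])
  also have "\<dots> = (\<Sum>\<rho>\<in>parts n d. dmat n (\<lambda>_. 1) \<kappa> \<rho> * (eigen n lam * f \<rho>))"
    unfolding f_def sum_distrib_left[of "eigen n lam"] by (intro sum.cong refl) (simp add: eigen_comb mult.assoc)
  finally show ?thesis by (simp only: sum_distrib_left mult.left_commute)
qed

text \<open>\<open>dmat\<close> reaches only upwards in dominance, so above a maximal point of the
  support only the diagonal term remains.\<close>

lemma maximal_term:
  assumes "\<kappa> \<in> parts n d" "\<And>\<nu>. \<nu> \<in> parts n d \<Longrightarrow> g \<nu> \<noteq> 0 \<Longrightarrow> dominated \<kappa> \<nu> \<Longrightarrow> \<nu> = \<kappa>"
  shows "(\<Sum>\<rho>\<in>parts n d. dmat n \<phi> \<kappa> \<rho> * g \<rho>) = \<phi> \<kappa> * g \<kappa>"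
proof -
  have "dmat n \<phi> \<kappa> \<rho> * g \<rho> = 0" if "\<rho> \<in> parts n d" "\<rho> \<noteq> \<kappa>" for \<rho>
    using assms(2)[OF that(1)] dmat_nonzero[OF assms(1) that(1)] that(2) by fastforce
  then have "(\<Sum>\<rho>\<in>parts n d. dmat n \<phi> \<kappa> \<rho> * g \<rho>) = (\<Sum>\<rho>\<in>parts n d. if \<rho> = \<kappa> then \<phi> \<kappa> * g \<kappa> else 0)"
    by (intro sum.cong) (auto simp: dmat_self[OF assms(1)])
  then show ?thesis using assms(1) by (simp add: finite_parts)
qed

text \<open>At a maximal point the eigenvalue problem compares the eigenvalue of \<kappa> directly
  with that of \<lambda>, and these separate partitions.\<close>

lemma f_maximal:
  assumes "\<kappa> \<in> parts n d" "f \<kappa> \<noteq> 0" "\<And>\<nu>. \<nu> \<in> parts n d \<Longrightarrow> f \<nu> \<noteq> 0 \<Longrightarrow> dominated \<kappa> \<nu> \<Longrightarrow> \<nu> = \<kappa>"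
  shows "\<kappa> = lam"
proof -
  have m: "(\<Sum>\<rho>\<in>parts n d. dmat n \<phi> \<kappa> \<rho> * f \<rho>) = \<phi> \<kappa> * f \<kappa>" for \<phi>
    by (rule maximal_term[OF assms(1)]) (rule assms(3))
  have "eigen n \<kappa> * f \<kappa> = eigen n lam * (1 * f \<kappa>)"
    using eigen_equation[OF assms(1)] unfolding m[of "eigen n"] m[of "\<lambda>_. 1"] .
  then have "eigen n \<kappa> = eigen n lam" using assms(2) by simp
  then show ?thesis using eigen_inj[OF partsD(5)[OF assms(1)] partsD(5)[OF lam]] by simp
qed

lemma f_nonzero:
  assumes "\<kappa> \<in> parts n d" "f \<kappa> \<noteq> 0"
  shows "dominated \<kappa> lam" "f lam \<noteq> 0"
proof -
  obtain \<mu> where \<mu>: "\<mu> \<in> parts n d" "f \<mu> \<noteq> 0" "dominated \<kappa> \<mu>"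
    "\<And>\<nu>. \<nu> \<in> parts n d \<Longrightarrow> f \<nu> \<noteq> 0 \<Longrightarrow> dominated \<mu> \<nu> \<Longrightarrow> \<nu> = \<mu>"
    using maximal_part[of \<kappa> n d "\<lambda>\<mu>. f \<mu> \<noteq> 0"] assms by blast
  then have "\<mu> = lam" by (intro f_maximal)
  then show "dominated \<kappa> lam" "f lam \<noteq> 0" using \<mu> by simp_all
qed

end

lemma ex_det_vector:
  assumes "lam \<in> parts n d"
  obtains e where "det_vector n d lam e"
proof -
  obtain mus where mus: "set mus = strictly_above lam" "distinct mus"
    using finite_distinct_list[OF finite_strictly_above[OF assms]] by blast
  have dist: "distinct (lam # mus)" using mus by (simp add: strictly_above_def)
  have "det_vector n d lam (ecof n lam mus)"
    using ecof_bracket[OF dist, of _ n] ecof_lam[OF assms mus(2,1)] assms mus(1)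
    by unfold_locales simp_all
  then show ?thesis by (rule that)
qed

lemma parts_incl: "\<nu> \<in> parts n d \<Longrightarrow> \<nu> \<in> parts d d"
  using num_parts_le_psize by (auto simp: parts_def)

lemma is_partition_parts: "is_partition lam \<Longrightarrow> lam \<in> parts (psize lam) (psize lam)"
  using num_parts_le_psize by (simp add: parts_def)

lemma gfun_parts:
  assumes "\<nu> \<in> parts n d"
  shows "gfun n \<nu> = gfun d \<nu>"
  using gfun_extend[OF partsD(2)[OF assms], of "max n d"] gfun_extend[OF partsD(2)[OF parts_incl[OF assms]], of "max n d"]
  by simp

lemma mcoef_parts:
  assumes "\<nu> \<in> parts n d"
  shows "mcoef n \<nu> f = mcoef d \<nu> f"
  using mcoef_extend[OF partsD(2)[OF assms], of "max n d" f] mcoef_extend[OF partsD(2)[OF parts_incl[OF assms]], of "max n d" f]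
  by simp

lemma gram_parts:
  assumes "\<nu> \<in> parts n d" "\<kappa> \<in> parts n d"
  shows "gram n \<nu> \<kappa> = gram d \<nu> \<kappa>"
  unfolding gram_def gfun_parts[OF assms(1)] by (rule mcoef_parts[OF assms(2)])

section \<open>The Macdonald polynomials\<close>

text \<open>\<open>a\<close> lists the coefficients of \<open>P\<^bsub>lam\<^esub>\<close> in the \<open>g\<^sub>\<nu>\<close>; the sums are its coefficients at the monomials.\<close>

definition dual_pair :: "nat \<Rightarrow> (nat \<Rightarrow> nat) \<Rightarrow> ((nat \<Rightarrow> nat) \<Rightarrow> qt_field) \<Rightarrow> bool" where
  "dual_pair d lam a \<longleftrightarrow> (\<forall>\<nu>\<in>parts d d. a \<nu> \<noteq> 0 \<longrightarrow> dominated lam \<nu>) \<and> a lam \<noteq> 0 \<and>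
     (\<forall>\<kappa>\<in>parts d d. (\<Sum>\<nu>\<in>parts d d. a \<nu> * gram d \<nu> \<kappa>) \<noteq> 0 \<longrightarrow> dominated \<kappa> lam) \<and>
     (\<Sum>\<nu>\<in>parts d d. a \<nu> * gram d \<nu> lam) = 1"

text \<open>In d variables nondegeneracy keeps \<open>f\<close> from vanishing identically. Hence
  \<open>f lam\<close> \<noteq> 0, and dividing by it normalizes the leading coefficient.\<close>

lemma ex_dual_pair:
  assumes "lam \<in> parts d d"
  shows "\<exists>a. dual_pair d lam a"
proof -
  obtain e where "det_vector d d lam e" using ex_det_vector[OF assms] .
  then interpret det_vector d d lam e .
  have "\<exists>\<kappa>\<in>parts d d. f \<kappa> \<noteq> 0"
  proof (rule ccontr)
    assume "\<not> (\<exists>\<kappa>\<in>parts d d. f \<kappa> \<noteq> 0)"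
    then have "F lam = 0"
      using assms by (intro gram_nondegenerate[of d F lam]) (auto simp: f_def)
    then show False using F_lam v_norm_nonzero[OF assms] by simp
  qed
  then have nz: "f lam \<noteq> 0" using f_nonzero(2) by blast
  have s: "(\<Sum>\<nu>\<in>parts d d. F \<nu> / f lam * gram d \<nu> \<kappa>) = f \<kappa> / f lam" for \<kappa>
    by (simp add: f_def sum_divide_distrib)
  have "dual_pair d lam (\<lambda>\<nu>. F \<nu> / f lam)"
    unfolding dual_pair_def s using nz F_nonzero f_nonzero(1) F_lam v_norm_nonzero[OF assms] by auto
  then show ?thesis by blast
qed

text \<open>The choice is harmless: \<open>triangular_both\<close> shows that supports and
  normalization determine the values on partitions of d. The size of \<open>lam\<close> is used as
  the number of variables, so the coefficients do not depend on n.\<close>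

definition mac_coef :: "(nat \<Rightarrow> nat) \<Rightarrow> (nat \<Rightarrow> nat) \<Rightarrow> qt_field" where
  "mac_coef lam = (SOME a. dual_pair (psize lam) lam a)"

lemma mac_coef_dual: "lam \<in> parts d d \<Longrightarrow> dual_pair d lam (mac_coef lam)"
  unfolding mac_coef_def partsD(4) using ex_dual_pair by (rule someI_ex)

lemma mac_coefD:
  assumes "lam \<in> parts d d"
  shows "\<And>\<nu>. \<nu> \<in> parts d d \<Longrightarrow> mac_coef lam \<nu> \<noteq> 0 \<Longrightarrow> dominated lam \<nu>" "mac_coef lam lam \<noteq> 0"
    "\<And>\<kappa>. \<kappa> \<in> parts d d \<Longrightarrow> (\<Sum>\<nu>\<in>parts d d. mac_coef lam \<nu> * gram d \<nu> \<kappa>) \<noteq> 0 \<Longrightarrow> dominated \<kappa> lam"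
    "(\<Sum>\<nu>\<in>parts d d. mac_coef lam \<nu> * gram d \<nu> lam) = 1"
  using mac_coef_dual[OF assms] by (auto simp: dual_pair_def)

definition mac_sym :: "(nat \<Rightarrow> nat) \<Rightarrow> symfun" where
  "mac_sym lam = (if is_partition lam then gcomb (psize lam) (psize lam) (mac_coef lam) else 0)"

lemma mac_sym_parts: "lam \<in> parts d d \<Longrightarrow> mac_sym lam = gcomb d d (mac_coef lam)"
  using partsD[of lam d d] by (simp add: mac_sym_def)

lemma mcoef_mac_sym: "lam \<in> parts d d \<Longrightarrow> mcoef d \<kappa> (mac_sym lam) = (\<Sum>\<nu>\<in>parts d d. mac_coef lam \<nu> * gram d \<nu> \<kappa>)"
  by (simp add: mac_sym_parts mcoef_gcomb)

lemma mcoef_mac_sym_dominated: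
  assumes "lam \<in> parts d d" "\<kappa> \<in> parts d d" "mcoef d \<kappa> (mac_sym lam) \<noteq> 0"
  shows "dominated \<kappa> lam"
  using mac_coefD(3)[OF assms(1,2)] assms(3) unfolding mcoef_mac_sym[OF assms(1)] by blast

lemma mcoef_mac_sym_self: "lam \<in> parts d d \<Longrightarrow> mcoef d lam (mac_sym lam) = 1"
  using mcoef_mac_sym mac_coefD(4) by simp

lemma mcoef_mac_sym_weight:
  assumes "lam \<in> parts d d" "(\<Sum>i<N. \<gamma> i) \<noteq> d"
  shows "mcoef N \<gamma> (mac_sym lam) = 0"
  unfolding mac_sym_parts[OF assms(1)] using keys_gcomb assms(2) by (intro mcoef_weight[of _ d]) auto

text \<open>Subtract the right multiple of the coefficients of P_\<lambda>. The difference
  \<open>D\<close> lives above \<lambda>, where its monomial coefficients vanish. Pair it with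
  P_\<kappa> for a minimal \<kappa> in its support: through the g-expansion of P_\<kappa> the result
  is 0, through its monomial expansion it is \<open>D \<kappa>\<close>.\<close>

theorem triangular_both:
  assumes lam: "lam \<in> parts n d"
    and F: "\<And>\<nu>. \<nu> \<in> parts n d \<Longrightarrow> F \<nu> \<noteq> 0 \<Longrightarrow> dominated lam \<nu>"
    and f: "\<And>\<kappa>. \<kappa> \<in> parts n d \<Longrightarrow> (\<Sum>\<nu>\<in>parts n d. F \<nu> * gram n \<nu> \<kappa>) \<noteq> 0 \<Longrightarrow> dominated \<kappa> lam"
    and \<nu>: "\<nu> \<in> parts n d"
  shows "F \<nu> = (\<Sum>\<rho>\<in>parts n d. F \<rho> * gram n \<rho> lam) * mac_coef lam \<nu>"
proof -
  note lamd = parts_incl[OF lam]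
  have up: "\<nu> \<in> parts n d" if "dominated lam \<nu>" "\<nu> \<in> parts d d" for \<nu>
    using dominated_parts[OF lam that(1) partsD(1)[OF that(2)]] .
  \<comment> \<open>Passage from n to d variables. Partitions above \<lambda> have at most n parts,
    so extension by zero agrees with the support condition.\<close>
  define F0 where "F0 \<nu> = (if \<nu> \<in> parts n d then F \<nu> else 0)" for \<nu>
  define f0 where "f0 \<kappa> = (\<Sum>\<nu>\<in>parts d d. F0 \<nu> * gram d \<nu> \<kappa>)" for \<kappa>
  have F0: "dominated lam \<nu>" if "F0 \<nu> \<noteq> 0" for \<nu>
    using that F by (auto simp: F0_def split: if_splits)
  have f0: "f0 \<kappa> = (\<Sum>\<nu>\<in>parts n d. F \<nu> * gram n \<nu> \<kappa>)" if "\<kappa> \<in> parts n d" for \<kappa>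
  proof -
    have "f0 \<kappa> = (\<Sum>\<nu>\<in>parts n d. F0 \<nu> * gram d \<nu> \<kappa>)"
      unfolding f0_def using parts_incl by (intro sum.mono_neutral_right finite_parts) (auto simp: F0_def)
    then show ?thesis using gram_parts that by (simp add: F0_def)
  qed
  define D where "D \<nu> = F0 \<nu> - f0 lam * mac_coef lam \<nu>" for \<nu>
  have Dlam: "dominated lam \<nu>" if "\<nu> \<in> parts d d" "D \<nu> \<noteq> 0" for \<nu>
    using that F0[of \<nu>] mac_coefD(1)[OF lamd that(1)] by (cases "F0 \<nu> = 0") (auto simp: D_def)
  have Df: "(\<Sum>\<nu>\<in>parts d d. D \<nu> * gram d \<nu> \<kappa>) = f0 \<kappa> - f0 lam * mcoef d \<kappa> (mac_sym lam)" for \<kappa>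
    unfolding D_def mcoef_mac_sym[OF lamd] f0_def[of \<kappa>]
    by (simp add: left_diff_distrib sum_subtractf sum_distrib_left mult.assoc)
  have Dz: "(\<Sum>\<nu>\<in>parts d d. D \<nu> * gram d \<nu> \<kappa>) = 0" if "\<kappa> \<in> parts d d" "dominated lam \<kappa>" for \<kappa>
  proof (cases "\<kappa> = lam")
    case True
    then show ?thesis unfolding Df by (simp add: mcoef_mac_sym_self[OF lamd])
  next
    case False
    then have nd: "\<not> dominated \<kappa> lam" using that(2) dominated_antisym by blast
    have "f0 \<kappa> = 0" using f[OF up[OF that(2,1)]] nd unfolding f0[OF up[OF that(2,1)]] by blast
    moreover have "mcoef d \<kappa> (mac_sym lam) = 0" using mcoef_mac_sym_dominated[OF lamd that(1)] nd by blast
    ultimately show ?thesis unfolding Df by simp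
  qed
  have "D \<mu> = 0" if \<mu>: "\<mu> \<in> parts d d" for \<mu>
  proof (rule ccontr)
    assume "D \<mu> \<noteq> 0"
    then obtain \<kappa> where \<kappa>: "\<kappa> \<in> parts d d" "D \<kappa> \<noteq> 0"
      "\<And>\<nu>. \<nu> \<in> parts d d \<Longrightarrow> D \<nu> \<noteq> 0 \<Longrightarrow> dominated \<nu> \<kappa> \<Longrightarrow> \<nu> = \<kappa>"
      using minimal_part[of \<mu> d d "\<lambda>\<mu>. D \<mu> \<noteq> 0", OF \<mu>] by blast
    have "(\<Sum>\<alpha>\<in>parts d d. mac_coef \<kappa> \<alpha> * (\<Sum>\<nu>\<in>parts d d. D \<nu> * gram d \<nu> \<alpha>)) = 0"
    proof (rule sum.neutral, rule ballI)
      fix \<alpha> assume a: "\<alpha> \<in> parts d d"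
      show "mac_coef \<kappa> \<alpha> * (\<Sum>\<nu>\<in>parts d d. D \<nu> * gram d \<nu> \<alpha>) = 0"
      proof (cases "mac_coef \<kappa> \<alpha> = 0")
        case False
        then have "dominated \<kappa> \<alpha>" by (rule mac_coefD(1)[OF \<kappa>(1) a])
        then have "dominated lam \<alpha>" using Dlam[OF \<kappa>(1,2)] dominated_trans by blast
        then show ?thesis using Dz[OF a] by simp
      qed simp
    qed
    moreover have "(\<Sum>\<alpha>\<in>parts d d. mac_coef \<kappa> \<alpha> * (\<Sum>\<nu>\<in>parts d d. D \<nu> * gram d \<nu> \<alpha>)) =
        (\<Sum>\<nu>\<in>parts d d. D \<nu> * mcoef d \<nu> (mac_sym \<kappa>))"
    proof -
      have "(\<Sum>\<alpha>\<in>parts d d. mac_coef \<kappa> \<alpha> * (\<Sum>\<nu>\<in>parts d d. D \<nu> * gram d \<nu> \<alpha>)) =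
          (\<Sum>\<alpha>\<in>parts d d. \<Sum>\<nu>\<in>parts d d. D \<nu> * (mac_coef \<kappa> \<alpha> * gram d \<alpha> \<nu>))"
        unfolding sum_distrib_left by (intro sum.cong refl) (subst gram_sym, simp only: mult.left_commute)
      also have "\<dots> = (\<Sum>\<nu>\<in>parts d d. \<Sum>\<alpha>\<in>parts d d. D \<nu> * (mac_coef \<kappa> \<alpha> * gram d \<alpha> \<nu>))"
        by (rule sum.swap)
      finally show ?thesis unfolding mcoef_mac_sym[OF \<kappa>(1)] sum_distrib_left .
    qed
    moreover have "(\<Sum>\<nu>\<in>parts d d. D \<nu> * mcoef d \<nu> (mac_sym \<kappa>)) = (\<Sum>\<nu>\<in>parts d d. if \<nu> = \<kappa> then D \<kappa> else 0)"
    proof (intro sum.cong refl)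
      fix \<nu> assume n: "\<nu> \<in> parts d d"
      show "D \<nu> * mcoef d \<nu> (mac_sym \<kappa>) = (if \<nu> = \<kappa> then D \<kappa> else 0)"
        using \<kappa>(3)[OF n] mcoef_mac_sym_dominated[OF \<kappa>(1) n] mcoef_mac_sym_self[OF \<kappa>(1)] by auto
    qed
    ultimately show False using \<kappa>(1,2) by (simp add: finite_parts)
  qed
  then have "F0 \<nu> = f0 lam * mac_coef lam \<nu>" using parts_incl[OF \<nu>] by (simp add: D_def)
  then show ?thesis using \<nu> f0[OF lam] by (simp add: F0_def)
qed

section \<open>Macdonald's characterization of \<open>mac_sym\<close>\<close>

lemma strictly_below_parts:
  assumes "lam \<in> parts d d" "\<mu> \<in> strictly_below lam"
  shows "\<mu> \<in> parts d d"
  using assms num_parts_le_psize[of \<mu>] partsD(4)[OF assms(1)]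
  by (auto simp: strictly_below_def dominated_def parts_def)

lemma lookup_monomial_sym:
  assumes "is_partition \<mu>" "\<forall>i\<ge>N. \<gamma> i = 0"
  shows "lookup (monomial_sym N \<mu>) (mkey N \<gamma>) =
    (if num_parts \<mu> \<le> N \<and> \<gamma> \<in> distinct_perms N \<mu> then 1 else 0)"
proof (cases "num_parts \<mu> \<le> N")
  case True
  have "\<mu> \<in> parts N (psize \<mu>)" using assms(1) True by (simp add: parts_def)
  then have "distinct_perms N \<mu> \<subseteq> {\<alpha>. \<forall>i\<ge>N. \<alpha> i = 0}"
    using distinct_perms_subset[OF partsD(5)] by (fastforce simp: weak_comps_def)
  then have "lookup (\<Sum>\<alpha>\<in>distinct_perms N \<mu>. single (mkey N \<alpha>) (1::qt_field)) (mkey N \<gamma>) =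
      (if \<gamma> \<in> distinct_perms N \<mu> then 1 else 0)"
    by (rule lookup_sum_mkey[OF finite_distinct_perms _ assms(2)])
  then show ?thesis using True by (simp only: monomial_sym_def prod_xvar if_True simp_thms)
qed (simp add: monomial_sym_def)

text \<open>The keys \<open>mkey N \<gamma>\<close> determine a polynomial only if no variable
  beyond the first \<open>N\<close> occurs.\<close>

definition in_vars :: "nat \<Rightarrow> 'a::comm_ring_1 mpol \<Rightarrow> bool" where
  "in_vars N f \<longleftrightarrow> (\<forall>k\<in>keys f. keys k \<subseteq> {..<N})"

lemma in_vars_single: "keys k \<subseteq> {..<N} \<Longrightarrow> in_vars N (single k c)"
  by (simp add: in_vars_def)

lemma in_vars_add: "in_vars N f \<Longrightarrow> in_vars N g \<Longrightarrow> in_vars N (f + g)"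
  using keys_add[of f g] by (auto simp: in_vars_def)

lemma in_vars_0: "in_vars N 0"
  by (simp add: in_vars_def)

lemma in_vars_sum: "(\<And>a. a \<in> A \<Longrightarrow> in_vars N (f a)) \<Longrightarrow> in_vars N (sum f A)"
  by (induction A rule: infinite_finite_induct) (simp_all add: in_vars_add in_vars_0)

lemma in_vars_mult:
  assumes "in_vars N f" "in_vars N g"
  shows "in_vars N (f * g)"
  unfolding in_vars_def
proof
  fix k assume "k \<in> keys (f * g)"
  then obtain a b where ab: "k = a + b" "a \<in> keys f" "b \<in> keys g"
    using keys_mult[of f g] by auto
  then show "keys k \<subseteq> {..<N}"
    using assms keys_add[of a b] unfolding in_vars_def by blast
qed

lemma in_vars_1: "in_vars N 1"
  by (simp add: in_vars_def)

lemma in_vars_pow_mset: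
  assumes "\<And>k. in_vars N (P k)"
  shows "in_vars N (pow_mset P m)"
  by (induction m rule: mset_exp_induct)
    (simp_all add: pow_mset_0 in_vars_1 pow_mset_add pow_mset_unit in_vars_mult assms)

lemma in_vars_pleth: "in_vars N (pleth f (Xalph N))"
  unfolding pleth_Xalph[OF finite_keys subset_refl]
proof (intro in_vars_sum in_vars_mult in_vars_pow_mset)
  show "in_vars N (Const c)" for c unfolding Const_def by (rule in_vars_single) simp
  show "in_vars N (px N k)" for k
    unfolding px_eq_psum psum_def by (intro in_vars_sum in_vars_single) simp
qed

lemma in_vars_monomial_sym: "in_vars N (monomial_sym N \<mu>)"
proof (cases "num_parts \<mu> \<le> N")
  case True
  have "keys (mkey N \<alpha>) \<subseteq> {..<N}" for \<alpha>
    by (auto simp: in_keys_iff lookup_mkey split: if_splits)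
  then show ?thesis using True by (simp add: monomial_sym_def prod_xvar in_vars_sum in_vars_single)
qed (simp add: monomial_sym_def in_vars_def)

lemma in_vars_eqI:
  assumes "in_vars N f" "in_vars N g"
    "\<And>\<gamma>. \<forall>i\<ge>N. \<gamma> i = 0 \<Longrightarrow> lookup f (mkey N \<gamma>) = lookup g (mkey N \<gamma>)"
  shows "f = g"
proof (rule poly_mapping_eqI)
  fix k
  show "lookup f k = lookup g k"
  proof (cases "keys k \<subseteq> {..<N}")
    case True
    have z: "lookup k i = 0" if "i \<ge> N" for i
    proof (rule ccontr)
      assume "lookup k i \<noteq> 0"
      then have "i \<in> keys k" by (simp add: in_keys_iff)
      then show False using True that by auto
    qed
    have "k = mkey N (lookup k)"
      by (rule poly_mapping_eqI) (simp add: lookup_mkey z)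
    then show ?thesis using assms(3)[of "lookup k"] z by simp
  next
    case False
    then have "k \<notin> keys f" "k \<notin> keys g" using assms(1,2) by (auto simp: in_vars_def)
    then show ?thesis by (simp add: in_keys_iff)
  qed
qed

lemma lookup_triangular_rhs:
  assumes lam: "lam \<in> parts d d" and \<nu>: "\<nu> \<in> parts N d'" and \<gamma>: "\<gamma> \<in> distinct_perms N \<nu>"
  shows "lookup (monomial_sym N lam + (\<Sum>\<mu>\<in>strictly_below lam. Const (u \<mu>) * monomial_sym N \<mu>)) (mkey N \<gamma>) =
    (if \<nu> = lam then 1 else if \<nu> \<in> strictly_below lam then u \<nu> else 0)"
proof -
  have z: "\<forall>i\<ge>N. \<gamma> i = 0" using distinct_perms_subset[OF partsD(5)[OF \<nu>]] \<gamma> by (auto simp: weak_comps_def)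
  have l: "lookup (monomial_sym N \<mu>) (mkey N \<gamma>) = (if \<nu> = \<mu> then 1 else 0)" if "is_partition \<mu>" for \<mu>
    unfolding lookup_monomial_sym[OF that z]
    using distinct_perms_disjoint[OF partsD(1)[OF \<nu>] that \<gamma>] \<gamma> \<nu> by (auto simp: parts_def)
  have fin: "finite (strictly_below lam)"
    using strictly_below_parts[OF lam] finite_parts[of d d] by (meson finite_subset subsetI)
  have "lookup (\<Sum>\<mu>\<in>strictly_below lam. Const (u \<mu>) * monomial_sym N \<mu>) (mkey N \<gamma>) =
      (\<Sum>\<mu>\<in>strictly_below lam. if \<nu> = \<mu> then u \<mu> else 0)"
    unfolding lookup_sum lookup_Const_mult by (intro sum.cong) (auto simp: l strictly_below_def)
  also have "\<dots> = (if \<nu> \<in> strictly_below lam then u \<nu> else 0)"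
    using fin by simp
  finally show ?thesis
    using l[OF partsD(1)[OF lam]] by (simp add: lookup_add strictly_below_def)
qed

text \<open>\<open>f\<close> need not be homogeneous, so all degrees d' are tested; for d' \<noteq>
  d dominance forces the coefficients to vanish. In degree d' it is enough to look at d'
  variables.\<close>

lemma monomial_triangular_iff:
  assumes "lam \<in> parts d d"
  shows "monomial_triangular lam f \<longleftrightarrow>
    (\<forall>d'. \<forall>\<nu>\<in>parts d' d'. (mcoef d' \<nu> f \<noteq> 0 \<longrightarrow> dominated \<nu> lam) \<and> (\<nu> = lam \<longrightarrow> mcoef d' \<nu> f = 1))"
    (is "_ \<longleftrightarrow> ?R")
proof
  assume "monomial_triangular lam f"
  then obtain u where u: "\<And>N. pleth f (Xalph N) =
     monomial_sym N lam + (\<Sum>mu\<in>strictly_below lam. Const (u mu) * monomial_sym N mu)"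
    unfolding monomial_triangular_def by blast
  show ?R
  proof (intro allI ballI)
    fix d' \<nu> assume \<nu>: "\<nu> \<in> parts d' d'"
    have "\<nu> \<in> distinct_perms d' \<nu>" by (auto simp: distinct_perms_iff intro!: exI[of _ id] permutes_id)
    then have "mcoef d' \<nu> f = (if \<nu> = lam then 1 else if \<nu> \<in> strictly_below lam then u \<nu> else 0)"
      unfolding lookup_pleth[symmetric] u by (rule lookup_triangular_rhs[OF assms \<nu>])
    then show "(mcoef d' \<nu> f \<noteq> 0 \<longrightarrow> dominated \<nu> lam) \<and> (\<nu> = lam \<longrightarrow> mcoef d' \<nu> f = 1)"
      by (auto simp: strictly_below_def dominated_refl split: if_splits)
  qed
next
  assume R: ?R
  \<comment> \<open>The coefficients must not depend on \<open>N\<close>, hence they are read off in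
    |\<nu>| variables.\<close>
  define u where "u = (\<lambda>\<nu>. mcoef (psize \<nu>) \<nu> f)"
  have "pleth f (Xalph N) = monomial_sym N lam + (\<Sum>mu\<in>strictly_below lam. Const (u mu) * monomial_sym N mu)" for N
  proof (rule in_vars_eqI[of N])
    show "in_vars N (pleth f (Xalph N))" by (rule in_vars_pleth)
    show "in_vars N (monomial_sym N lam + (\<Sum>mu\<in>strictly_below lam. Const (u mu) * monomial_sym N mu))"
    proof (intro in_vars_add in_vars_sum in_vars_mult in_vars_monomial_sym)
      show "in_vars N (Const c)" for c unfolding Const_def by (rule in_vars_single) simp
    qed
    fix \<gamma> :: "nat \<Rightarrow> nat" assume z: "\<forall>i\<ge>N. \<gamma> i = 0"
    define d' where "d' = (\<Sum>i<N. \<gamma> i)"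
    have "\<gamma> \<in> weak_comps N d'" using z by (simp add: weak_comps_def d'_def)
    then obtain \<nu> \<pi> where \<nu>: "\<nu> \<in> parts N d'" "\<pi> permutes {..<N}" "\<gamma> = \<nu> \<circ> \<pi>"
      by (rule sort_weak_comp)
    note \<nu>d = parts_incl[OF \<nu>(1)]
    have "lookup (pleth f (Xalph N)) (mkey N \<gamma>) = mcoef d' \<nu> f"
      unfolding lookup_pleth \<nu>(3) mcoef_permute[OF \<nu>(2)] by (rule mcoef_parts[OF \<nu>(1)])
    also have "\<dots> = (if \<nu> = lam then 1 else if \<nu> \<in> strictly_below lam then u \<nu> else 0)"
      using R \<nu>d partsD(1,4)[OF \<nu>d] by (auto simp: u_def strictly_below_def)
    also have "\<dots> = lookup (monomial_sym N lam + (\<Sum>mu\<in>strictly_below lam. Const (u mu) * monomial_sym N mu)) (mkey N \<gamma>)"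
      by (rule lookup_triangular_rhs[OF assms \<nu>(1), symmetric]) (use \<nu>(2,3) in \<open>unfold distinct_perms_iff, blast\<close>)
    finally show "lookup (pleth f (Xalph N)) (mkey N \<gamma>) =
      lookup (monomial_sym N lam + (\<Sum>mu\<in>strictly_below lam. Const (u mu) * monomial_sym N mu)) (mkey N \<gamma>)" .
  qed
  then show "monomial_triangular lam f" unfolding monomial_triangular_def by blast
qed

lemma mac_sym_triangular:
  assumes "lam \<in> parts d d"
  shows "monomial_triangular lam (mac_sym lam)"
  unfolding monomial_triangular_iff[OF assms]
proof (intro allI ballI)
  fix d' \<nu> assume \<nu>: "\<nu> \<in> parts d' d'"
  show "(mcoef d' \<nu> (mac_sym lam) \<noteq> 0 \<longrightarrow> dominated \<nu> lam) \<and> (\<nu> = lam \<longrightarrow> mcoef d' \<nu> (mac_sym lam) = 1)"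
  proof (cases "d' = d")
    case True
    then show ?thesis using \<nu> mcoef_mac_sym_dominated[OF assms] mcoef_mac_sym_self[OF assms] by blast
  next
    case False
    then have "mcoef d' \<nu> (mac_sym lam) = 0" using partsD(3)[OF \<nu>] by (intro mcoef_mac_sym_weight[OF assms]) simp
    moreover have "\<nu> \<noteq> lam" using False partsD(4)[OF \<nu>] partsD(4)[OF assms] by auto
    ultimately show ?thesis by simp
  qed
qed

lemma qt_inner_mac_sym:
  "lam \<in> parts d d \<Longrightarrow> qt_inner (mac_sym lam) f = (\<Sum>\<nu>\<in>parts d d. mac_coef lam \<nu> * mcoef d \<nu> f)"
  by (simp add: mac_sym_parts qt_inner_gcomb)

text \<open>A common term \<nu> satisfies \<lambda> \<le> \<nu> from the g-expansion and \<nu> \<le>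
  \<mu> from the monomial expansion. With the symmetry of the scalar product this yields
  orthogonality.\<close>

lemma qt_inner_mac_sym_nonzero:
  assumes "lam \<in> parts d d" "\<mu> \<in> parts d' d'" "qt_inner (mac_sym lam) (mac_sym \<mu>) \<noteq> 0"
  shows "dominated lam \<mu>"
proof -
  obtain \<nu> where \<nu>: "\<nu> \<in> parts d d" "mac_coef lam \<nu> * mcoef d \<nu> (mac_sym \<mu>) \<noteq> 0"
    using assms(3) unfolding qt_inner_mac_sym[OF assms(1)] by (rule sum.not_neutral_contains_not_neutral)
  have "d = d'"
  proof (rule ccontr)
    assume "d \<noteq> d'"
    then have "mcoef d \<nu> (mac_sym \<mu>) = 0"
      using partsD(3)[OF \<nu>(1)] by (intro mcoef_mac_sym_weight[OF assms(2)]) simp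
    then show False using \<nu>(2) by simp
  qed
  then have "dominated \<nu> \<mu>" using mcoef_mac_sym_dominated[OF assms(2), of \<nu>] \<nu> by auto
  moreover have "dominated lam \<nu>" using mac_coefD(1)[OF assms(1) \<nu>(1)] \<nu>(2) by auto
  ultimately show ?thesis using dominated_trans by blast
qed

lemma macdonald_family_mac_sym: "macdonald_family mac_sym"
  unfolding macdonald_family_def
proof (intro conjI allI impI)
  fix lam assume "is_partition lam"
  then show "monomial_triangular lam (mac_sym lam)" using mac_sym_triangular is_partition_parts by blast
next
  fix lam mu :: "nat \<Rightarrow> nat" assume p: "is_partition lam" "is_partition mu" "lam \<noteq> mu"
  show "qt_inner (mac_sym lam) (mac_sym mu) = 0"
  proof (rule ccontr)
    assume nz: "qt_inner (mac_sym lam) (mac_sym mu) \<noteq> 0"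
    then have "qt_inner (mac_sym mu) (mac_sym lam) \<noteq> 0" by (simp add: qt_inner_sym)
    then have "dominated lam mu" "dominated mu lam"
      using nz qt_inner_mac_sym_nonzero is_partition_parts p by blast+
    then show False using dominated_antisym p(3) by blast
  qed
next
  fix lam :: "nat \<Rightarrow> nat" assume "\<not> is_partition lam"
  then show "mac_sym lam = 0" by (simp add: mac_sym_def)
qed

text \<open>The scalar products with every \<open>mac_sym \<mu>\<close> agree: for \<mu> < \<lambda>
  by induction and orthogonality, for \<mu> = \<lambda> because only the leading coefficient enters,
  otherwise because the supports are disjoint. The triangularity of \<open>mac_coef\<close> then
  recovers the monomial coefficients.\<close>

lemma macdonald_family_unique:
  assumes P: "macdonald_family P" and lam: "lam \<in> parts d d"
  shows "P lam = mac_sym lam"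
  using lam
proof (induction "rank d lam" arbitrary: lam rule: less_induct)
  case (less lam)
  note lam = less.prems
  have tri: "(mcoef d' \<nu> (P lam) \<noteq> 0 \<longrightarrow> dominated \<nu> lam) \<and> (\<nu> = lam \<longrightarrow> mcoef d' \<nu> (P lam) = 1)"
    if "\<nu> \<in> parts d' d'" for d' \<nu>
  proof -
    have "monomial_triangular lam (P lam)"
      using P partsD(1)[OF lam] by (simp add: macdonald_family_def)
    then show ?thesis using that unfolding monomial_triangular_iff[OF lam] by blast
  qed
  have inner: "qt_inner (mac_sym \<mu>) (P lam) = qt_inner (mac_sym \<mu>) (mac_sym lam)" if \<mu>: "\<mu> \<in> parts d d" for \<mu>
  proof (cases "dominated \<mu> lam")
    case True
    show ?thesis
    proof (cases "\<mu> = lam")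
      case eq: True
      have "mac_coef lam \<nu> * mcoef d \<nu> (P lam) = mac_coef lam \<nu> * mcoef d \<nu> (mac_sym lam)" if n: "\<nu> \<in> parts d d" for \<nu>
      proof (cases "\<nu> = lam")
        case True
        then show ?thesis using tri[OF lam] mcoef_mac_sym_self[OF lam] by simp
      next
        case False
        then have "mac_coef lam \<nu> = 0 \<or> \<not> dominated \<nu> lam"
          using mac_coefD(1)[OF lam n] dominated_antisym by blast
        then show ?thesis using tri[OF n] mcoef_mac_sym_dominated[OF lam n] by auto
      qed
      then show ?thesis unfolding eq qt_inner_mac_sym[OF lam] by (intro sum.cong) auto
    next
      case False
      have "rank d \<mu> < rank d lam" using rank_strict[OF \<mu> lam True] False by (meson not_le)
      then have "P \<mu> = mac_sym \<mu>" using less.hyps \<mu> by blast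
      moreover have "qt_inner (P \<mu>) (P lam) = 0"
        using P partsD(1)[OF lam] partsD(1)[OF \<mu>] False unfolding macdonald_family_def by blast
      moreover have "qt_inner (mac_sym \<mu>) (mac_sym lam) = 0"
        using macdonald_family_mac_sym partsD(1)[OF lam] partsD(1)[OF \<mu>] False unfolding macdonald_family_def by blast
      ultimately show ?thesis by simp
    qed
  next
    case False
    have "mac_coef \<mu> \<nu> * mcoef d \<nu> g = 0" if "\<nu> \<in> parts d d" "mcoef d \<nu> g \<noteq> 0 \<longrightarrow> dominated \<nu> lam" for \<nu> g
      using mac_coefD(1)[OF \<mu> that(1)] that(2) False dominated_trans by fastforce
    then have "qt_inner (mac_sym \<mu>) (P lam) = 0" "qt_inner (mac_sym \<mu>) (mac_sym lam) = 0"
      unfolding qt_inner_mac_sym[OF \<mu>] using tri mcoef_mac_sym_dominated[OF lam] by (simp_all add: sum.neutral)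
    then show ?thesis by simp
  qed
  define g where "g \<nu> = mcoef d \<nu> (P lam) - mcoef d \<nu> (mac_sym lam)" for \<nu>
  have g: "(\<Sum>\<nu>\<in>parts d d. mac_coef \<mu> \<nu> * g \<nu>) = 0" if "\<mu> \<in> parts d d" for \<mu>
    using inner[OF that] unfolding qt_inner_mac_sym[OF that] g_def by (simp add: right_diff_distrib sum_subtractf)
  have gz: "g \<nu> = 0" if n: "\<nu> \<in> parts d d" for \<nu>
  proof (rule ccontr)
    assume "g \<nu> \<noteq> 0"
    then obtain \<kappa> where \<kappa>: "\<kappa> \<in> parts d d" "g \<kappa> \<noteq> 0"
      "\<And>\<nu>. \<nu> \<in> parts d d \<Longrightarrow> g \<nu> \<noteq> 0 \<Longrightarrow> dominated \<kappa> \<nu> \<Longrightarrow> \<nu> = \<kappa>"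
      using maximal_part[of \<nu> d d "\<lambda>\<nu>. g \<nu> \<noteq> 0"] n by blast
    have "(\<Sum>\<nu>\<in>parts d d. mac_coef \<kappa> \<nu> * g \<nu>) = (\<Sum>\<nu>\<in>parts d d. if \<nu> = \<kappa> then mac_coef \<kappa> \<kappa> * g \<kappa> else 0)"
    proof (intro sum.cong refl)
      fix \<nu> assume "\<nu> \<in> parts d d"
      then show "mac_coef \<kappa> \<nu> * g \<nu> = (if \<nu> = \<kappa> then mac_coef \<kappa> \<kappa> * g \<kappa> else 0)"
        using \<kappa>(3)[of \<nu>] mac_coefD(1)[OF \<kappa>(1), of \<nu>] by auto
    qed
    then have "mac_coef \<kappa> \<kappa> * g \<kappa> = 0" using g[OF \<kappa>(1)] \<kappa>(1) by (simp add: finite_parts)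
    then show False using \<kappa>(2) mac_coefD(2)[OF \<kappa>(1)] by simp
  qed
  have "P lam + Const (- 1) * mac_sym lam = 0"
  proof (rule mcoef_separates)
    fix d' \<nu> assume n: "\<nu> \<in> parts d' d'"
    have "mcoef d' \<nu> (P lam) = mcoef d' \<nu> (mac_sym lam)"
    proof (cases "d' = d")
      case True
      then show ?thesis using gz[of \<nu>] n by (simp add: g_def)
    next
      case False
      then have "\<not> dominated \<nu> lam" using partsD(4)[OF n] partsD(4)[OF lam] by (auto simp: dominated_def)
      then have "mcoef d' \<nu> (P lam) = 0" using tri[OF n] by blast
      moreover have "mcoef d' \<nu> (mac_sym lam) = 0"
        using False partsD(3)[OF n] by (intro mcoef_mac_sym_weight[OF lam]) simp
      ultimately show ?thesis by simp
    qed
    then show "mcoef d' \<nu> (P lam + Const (- 1) * mac_sym lam) = 0"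
      by (simp only: mcoef_add mcoef_scale)
  qed
  moreover have "Const (- 1) * mac_sym lam = - mac_sym lam"
    by (rule poly_mapping_eqI) (simp add: lookup_Const_mult)
  ultimately show "P lam = mac_sym lam" by simp
qed

theorem macdonald_P_eq: "macdonald_P = mac_sym"
  unfolding macdonald_P_def
proof (rule the_equality)
  show "macdonald_family mac_sym" by (rule macdonald_family_mac_sym)
  fix P assume P: "macdonald_family P"
  show "P = mac_sym"
  proof
    fix lam show "P lam = mac_sym lam"
    proof (cases "is_partition lam")
      case True
      then show ?thesis using macdonald_family_unique[OF P is_partition_parts] by blast
    next
      case False
      then show ?thesis using P by (simp add: macdonald_family_def mac_sym_def)
    qed
  qed
qed

section \<open>The normalization\<close>

definition add_column :: "nat \<Rightarrow> (nat \<Rightarrow> nat) \<Rightarrow> nat \<Rightarrow> nat" where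
  "add_column n \<kappa> i = (if i < n then Suc (\<kappa> i) else 0)"

lemma add_column_parts:
  assumes "\<kappa> \<in> parts n d"
  shows "add_column n \<kappa> \<in> parts n (d + n)"
proof -
  have "antimono (add_column n \<kappa>)"
    using assms by (auto simp: parts_iff add_column_def antimono_def)
  moreover have "(\<Sum>i<n. add_column n \<kappa> i) = (\<Sum>i<n. \<kappa> i + 1)"
    by (intro sum.cong) (auto simp: add_column_def)
  then have "(\<Sum>i<n. add_column n \<kappa> i) = d + n"
    unfolding sum.distrib using partsD(3)[OF assms] by simp
  ultimately show ?thesis
    by (simp add: parts_iff weak_comps_def) (simp add: add_column_def)
qed

lemma add_column_dominated:
  assumes "\<kappa> \<in> parts n d" "\<mu> \<in> parts n d'"
  shows "dominated (add_column n \<kappa>) (add_column n \<mu>) \<longleftrightarrow> dominated \<kappa> \<mu>"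
proof -
  have s: "(\<Sum>i<k. add_column n \<nu> i) = (\<Sum>i<k. \<nu> i) + min k n" if "\<nu> \<in> parts n e" for \<nu> e k
    using partsD(2)[OF that] by (induction k) (auto simp: add_column_def)
  show ?thesis
    unfolding dominated_def s[OF assms(1)] s[OF assms(2)]
      partsD(4)[OF assms(1)] partsD(4)[OF assms(2)]
      partsD(4)[OF add_column_parts[OF assms(1)]] partsD(4)[OF add_column_parts[OF assms(2)]]
    by simp
qed

lemma remove_column:
  assumes "\<mu> \<in> parts n d" "\<forall>i<n. 1 \<le> \<mu> i"
  shows "n \<le> d" "(\<lambda>i. \<mu> i - 1) \<in> parts n (d - n)" "add_column n (\<lambda>i. \<mu> i - 1) = \<mu>"
proof -
  have "(\<Sum>i<n. \<mu> i) = (\<Sum>i<n. (\<mu> i - 1) + 1)"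
    using assms(2) by (intro sum.cong) auto
  then have s: "d = (\<Sum>i<n. \<mu> i - 1) + n"
    unfolding sum.distrib partsD(3)[OF assms(1)] by simp
  then show "n \<le> d" by simp
  have "antimono (\<lambda>i. \<mu> i - 1)"
    using assms(1) by (auto simp: parts_iff antimono_def intro: diff_le_mono)
  then show "(\<lambda>i. \<mu> i - 1) \<in> parts n (d - n)"
    using s partsD(2)[OF assms(1)] by (simp add: parts_iff weak_comps_def)
  show "add_column n (\<lambda>i. \<mu> i - 1) = \<mu>"
    using assms(2) partsD(2)[OF assms(1)] by (auto simp: add_column_def fun_eq_iff)
qed

lemma lookup_comb:
  "lookup (\<Sum>\<nu>\<in>parts n d. Const (F \<nu>) * (\<Prod>i<n. gsym n (\<nu> i))) (mkey n \<gamma>) =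
    (\<Sum>\<nu>\<in>parts n d. F \<nu> * gram n \<nu> \<gamma>)"
  by (simp add: lookup_sum lookup_Const_mult gcoef_eq_gram[symmetric] gcoef_def)

lemma Const_comb:
  "(\<Sum>\<mu>\<in>A. Const (e \<mu>) * (\<Sum>\<nu>\<in>B. Const (c \<mu> \<nu>) * G \<nu>)) = (\<Sum>\<nu>\<in>B. Const (\<Sum>\<mu>\<in>A. e \<mu> * c \<mu> \<nu>) * G \<nu>)"
proof -
  have "(\<Sum>\<mu>\<in>A. Const (e \<mu>) * (\<Sum>\<nu>\<in>B. Const (c \<mu> \<nu>) * G \<nu>)) = (\<Sum>\<mu>\<in>A. \<Sum>\<nu>\<in>B. Const (e \<mu> * c \<mu> \<nu>) * G \<nu>)"
    by (simp only: sum_distrib_left Const_mult mult.assoc)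
  also have "\<dots> = (\<Sum>\<nu>\<in>B. \<Sum>\<mu>\<in>A. Const (e \<mu> * c \<mu> \<nu>) * G \<nu>)" by (rule sum.swap)
  finally show ?thesis by (simp only: Const_sum sum_distrib_right)
qed

lemma gdet_comb:
  assumes "\<And>\<mu>. \<mu> \<in> A \<Longrightarrow> h \<mu> \<in> weak_comps n d"
  shows "(\<Sum>\<mu>\<in>A. Const (e \<mu>) * gdet n u (stair n (h \<mu>))) =
    (\<Sum>\<nu>\<in>parts n d. Const (\<Sum>\<mu>\<in>A. e \<mu> * dmat n (eigen_poly n u) (h \<mu>) \<nu>) * (\<Prod>i<n. gsym n (\<nu> i)))"
  unfolding Const_comb[symmetric] using gdet_stair[OF assms] by (intro sum.cong) auto

lemma gdet_add_column:
  "gdet n (- 1) (stair n (add_column n \<mu>)) = (\<Prod>i<n. xvar i) * gdet n (- tpar) (stair n \<mu>)"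
proof -
  have "stair n (add_column n \<mu>) = (\<lambda>i. if i < n then Suc (stair n \<mu> i) else 0)"
    by (auto simp: fun_eq_iff stair_def add_column_def)
  then show ?thesis using gdet_shift[of n "stair n \<mu>"] by (simp add: stair_def)
qed

text \<open>By the shift identity x_1...x_n D(-t) P_\<kappa> is, up to a scalar, a combination of
  g_\<nu> with \<nu> \<ge> \<lambda> for \<lambda> = \<kappa> + (1^n), and its monomials lie below
  \<lambda>. So it is a multiple of P_\<lambda>; comparing its coefficients at g_\<lambda> and at
  m_\<lambda> gives the relation.\<close>

theorem mac_coef_add_column:
  assumes \<kappa>: "\<kappa> \<in> parts n d"
  shows "mac_coef \<kappa> \<kappa> * eigen_poly n (- 1) (add_column n \<kappa>) =
    eigen_poly n (- tpar) \<kappa> * mac_coef (add_column n \<kappa>) (add_column n \<kappa>)"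
proof -
  define lam where "lam = add_column n \<kappa>"
  have lam: "lam \<in> parts n (d + n)" unfolding lam_def by (rule add_column_parts[OF \<kappa>])
  obtain e where "det_vector n d \<kappa> e" by (rule ex_det_vector[OF \<kappa>])
  then interpret E: det_vector n d \<kappa> e .
  let ?\<phi> = "eigen_poly n (- tpar)"
  \<comment> \<open>\<open>u\<close> holds the monomial coefficients after D(-t); \<open>W\<close>
    the g-coefficients of the same function times x_1...x_n, computed as the action of D(-1) on the
    shapes with a column added; \<open>w\<close> its monomial coefficients.\<close>
  define u where "u \<gamma> = (\<Sum>\<nu>\<in>parts n d. (\<Sum>\<mu>\<in>E.A. e \<mu> * dmat n ?\<phi> \<mu> \<nu>) * gram n \<nu> \<gamma>)" for \<gamma>
  define W where "W \<nu> = (\<Sum>\<mu>\<in>E.A. e \<mu> * dmat n (eigen_poly n (- 1)) (add_column n \<mu>) \<nu>)" for \<nu>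
  define w where "w \<gamma> = (\<Sum>\<nu>\<in>parts n (d + n). W \<nu> * gram n \<nu> \<gamma>)" for \<gamma>
  have adj: "(\<Sum>\<rho>\<in>parts n d. dmat n ?\<phi> \<alpha> \<rho> * E.f \<rho>) = (\<Sum>\<rho>\<in>parts n d. dmat n (\<lambda>_. 1) \<alpha> \<rho> * u \<rho>)"
    if "\<alpha> \<in> parts n d" for \<alpha>
    unfolding u_def by (rule E.adjoint) (rule dmat_self_adjoint_u[OF partsD(5) partsD(5)[OF that]])
  \<comment> \<open>At a maximal \<mu> in the support of \<open>u\<close> the adjoint identity
    expresses \<open>u \<mu>\<close> by values of \<open>E.f\<close> at partitions above \<mu>, and
    those with a nonzero value lie below \<kappa>.\<close>
  have u_dom: "dominated \<gamma> \<kappa>" if \<gamma>: "\<gamma> \<in> parts n d" "u \<gamma> \<noteq> 0" for \<gamma>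
  proof -
    obtain \<mu> where \<mu>: "\<mu> \<in> parts n d" "u \<mu> \<noteq> 0" "dominated \<gamma> \<mu>"
      "\<And>\<nu>. \<nu> \<in> parts n d \<Longrightarrow> u \<nu> \<noteq> 0 \<Longrightarrow> dominated \<mu> \<nu> \<Longrightarrow> \<nu> = \<mu>"
      using maximal_part[of \<gamma> n d "\<lambda>\<mu>. u \<mu> \<noteq> 0"] \<gamma> by blast
    have "(\<Sum>\<rho>\<in>parts n d. dmat n ?\<phi> \<mu> \<rho> * E.f \<rho>) = 1 * u \<mu>"
      unfolding adj[OF \<mu>(1)] by (rule E.maximal_term[OF \<mu>(1,4)])
    then have "(\<Sum>\<rho>\<in>parts n d. dmat n ?\<phi> \<mu> \<rho> * E.f \<rho>) \<noteq> 0" using \<mu>(2) by simp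
    then obtain \<rho> where \<rho>: "\<rho> \<in> parts n d" "dmat n ?\<phi> \<mu> \<rho> * E.f \<rho> \<noteq> 0"
      by (rule sum.not_neutral_contains_not_neutral)
    then have "dominated \<mu> \<rho>" "dominated \<rho> \<kappa>"
      using dmat_nonzero[OF \<mu>(1) \<rho>(1)] E.f_nonzero(1)[OF \<rho>(1)] by auto
    then show ?thesis using \<mu>(3) dominated_trans by blast
  qed
  have u_\<kappa>: "u \<kappa> = ?\<phi> \<kappa> * E.f \<kappa>"
  proof -
    have "(\<Sum>\<rho>\<in>parts n d. dmat n ?\<phi> \<kappa> \<rho> * E.f \<rho>) = ?\<phi> \<kappa> * E.f \<kappa>"
      by (rule E.maximal_term[OF \<kappa>]) (use E.f_nonzero(1) dominated_antisym in blast)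
    moreover have "(\<Sum>\<rho>\<in>parts n d. dmat n (\<lambda>_. 1) \<kappa> \<rho> * u \<rho>) = 1 * u \<kappa>"
      by (rule E.maximal_term[OF \<kappa>]) (use u_dom dominated_antisym in blast)
    ultimately show ?thesis using adj[OF \<kappa>] by simp
  qed
  have w: "w \<gamma> = (if \<forall>i<n. 1 \<le> \<gamma> i then u (\<lambda>i. \<gamma> i - 1) else 0)" for \<gamma>
  proof -
    have "w \<gamma> = lookup (\<Sum>\<mu>\<in>E.A. Const (e \<mu>) * gdet n (- 1) (stair n (add_column n \<mu>))) (mkey n \<gamma>)"
      unfolding w_def W_def using gdet_comb[of E.A "add_column n" n "d + n" e "- 1"] lookup_comb
        partsD(5)[OF add_column_parts[OF E.A_parts]] by simp
    also have "(\<Sum>\<mu>\<in>E.A. Const (e \<mu>) * gdet n (- 1) (stair n (add_column n \<mu>))) =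
        single (mkey n (\<lambda>_. 1)) 1 * (\<Sum>\<mu>\<in>E.A. Const (e \<mu>) * gdet n (- tpar) (stair n \<mu>))"
      unfolding gdet_add_column sum_distrib_left prod_xvar[symmetric] power_one_right
      by (simp only: mult.left_commute)
    also have "(\<Sum>\<mu>\<in>E.A. Const (e \<mu>) * gdet n (- tpar) (stair n \<mu>)) =
        (\<Sum>\<nu>\<in>parts n d. Const (\<Sum>\<mu>\<in>E.A. e \<mu> * dmat n ?\<phi> \<mu> \<nu>) * (\<Prod>i<n. gsym n (\<nu> i)))"
      by (rule gdet_comb) (rule partsD(5)[OF E.A_parts])
    finally show ?thesis unfolding lookup_monom_1_mult lookup_comb u_def .
  qed
  have F: "W lam = (\<Sum>\<rho>\<in>parts n (d + n). W \<rho> * gram n \<rho> lam) * mac_coef lam lam"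
  proof (rule triangular_both[OF lam _ _ lam])
    fix \<nu> assume \<nu>: "\<nu> \<in> parts n (d + n)" "W \<nu> \<noteq> 0"
    obtain \<mu> where \<mu>: "\<mu> \<in> E.A" "e \<mu> * dmat n (eigen_poly n (- 1)) (add_column n \<mu>) \<nu> \<noteq> 0"
      using \<nu>(2) unfolding W_def by (rule sum.not_neutral_contains_not_neutral)
    have "dominated (add_column n \<mu>) \<nu>"
      using \<mu>(2) dmat_nonzero[OF add_column_parts[OF E.A_parts[OF \<mu>(1)]] \<nu>(1)] by auto
    moreover have "dominated lam (add_column n \<mu>)"
      unfolding lam_def add_column_dominated[OF \<kappa> E.A_parts[OF \<mu>(1)]] by (rule E.A_dom[OF \<mu>(1)])
    ultimately show "dominated lam \<nu>" using dominated_trans by blast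
  next
    fix \<gamma> assume \<gamma>: "\<gamma> \<in> parts n (d + n)" "(\<Sum>\<nu>\<in>parts n (d + n). W \<nu> * gram n \<nu> \<gamma>) \<noteq> 0"
    then have "w \<gamma> \<noteq> 0" by (simp add: w_def)
    then have g: "\<forall>i<n. 1 \<le> \<gamma> i" "u (\<lambda>i. \<gamma> i - 1) \<noteq> 0" unfolding w by (auto split: if_splits)
    note r = remove_column[OF \<gamma>(1) g(1)]
    have p: "(\<lambda>i. \<gamma> i - 1) \<in> parts n d" using r(2) by simp
    have "dominated (add_column n (\<lambda>i. \<gamma> i - 1)) lam"
      unfolding lam_def add_column_dominated[OF p \<kappa>] by (rule u_dom[OF p g(2)])
    then show "dominated \<gamma> lam" unfolding r(3) .
  qed
  have "(\<Sum>\<rho>\<in>parts n (d + n). W \<rho> * gram n \<rho> lam) = u \<kappa>"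
  proof -
    have "(\<lambda>i. lam i - 1) = \<kappa>" using partsD(2)[OF \<kappa>] by (auto simp: lam_def add_column_def)
    then show ?thesis unfolding w_def[symmetric] w by (simp add: lam_def add_column_def)
  qed
  moreover have "W lam = e \<kappa> * eigen_poly n (- 1) lam"
  proof -
    have "e \<mu> * dmat n (eigen_poly n (- 1)) (add_column n \<mu>) lam =
        (if \<mu> = \<kappa> then e \<kappa> * eigen_poly n (- 1) lam else 0)" if \<mu>: "\<mu> \<in> E.A" for \<mu>
    proof (cases "\<mu> = \<kappa>")
      case True
      then show ?thesis using dmat_self[OF lam] by (simp add: lam_def)
    next
      case False
      then have "\<not> dominated \<mu> \<kappa>" using E.A_dom[OF \<mu>] dominated_antisym by blast
      then have "\<not> dominated (add_column n \<mu>) lam"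
        unfolding lam_def add_column_dominated[OF E.A_parts[OF \<mu>] \<kappa>] .
      then show ?thesis
        using dmat_nonzero[OF add_column_parts[OF E.A_parts[OF \<mu>]] lam] False by auto
    qed
    then have "W lam = (\<Sum>\<mu>\<in>E.A. if \<mu> = \<kappa> then e \<kappa> * eigen_poly n (- 1) lam else 0)"
      unfolding W_def by (intro sum.cong) auto
    then show ?thesis using E.finite_A by simp
  qed
  \<comment> \<open>The left side is the coefficient \<open>W lam\<close> at g_\<lambda>; the right
    side is the coefficient \<open>u \<kappa>\<close> at m_\<lambda> times that of g_\<lambda> in
    P_\<lambda>.\<close>
  ultimately have 1: "v_norm n \<kappa> * eigen_poly n (- 1) lam = ?\<phi> \<kappa> * E.f \<kappa> * mac_coef lam lam"
    using F by (simp add: u_\<kappa> E.e_lam)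
  have 2: "v_norm n \<kappa> = E.f \<kappa> * mac_coef \<kappa> \<kappa>"
    using triangular_both[of \<kappa> n d E.F \<kappa>] E.F_nonzero E.f_nonzero(1) \<kappa> E.F_lam
    by (simp add: E.f_def[symmetric])
  have 3: "E.f \<kappa> \<noteq> 0" using 2 v_norm_nonzero[OF \<kappa>] by auto
  have "E.f \<kappa> * (mac_coef \<kappa> \<kappa> * eigen_poly n (- 1) lam) = E.f \<kappa> * (?\<phi> \<kappa> * mac_coef lam lam)"
    using 1 unfolding 2 by (simp only: mult_ac)
  then show ?thesis using 3 by (simp add: lam_def)
qed

section \<open>The hook factors of the first column\<close>

lemma cells_less: "\<kappa> \<in> parts n d \<Longrightarrow> (i, j) \<in> cells \<kappa> \<Longrightarrow> i < n"
  using partsD(2)[of \<kappa> n d] by (auto simp: cells_def) (metis not_le not_less_zero)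

lemma finite_cells: "\<kappa> \<in> parts n d \<Longrightarrow> finite (cells \<kappa>)"
proof -
  assume \<kappa>: "\<kappa> \<in> parts n d"
  have "\<kappa> i \<le> d" if "i < n" for i
    using member_le_sum[of i "{..<n}" \<kappa>] partsD(3)[OF \<kappa>] that by simp
  then have "cells \<kappa> \<subseteq> {..<n} \<times> {..<d}"
    using cells_less[OF \<kappa>] by (auto simp: cells_def) (meson less_le_trans)
  then show ?thesis by (rule finite_subset) simp
qed

lemma prod_cells_add_column:
  fixes G :: "nat \<Rightarrow> nat \<Rightarrow> 'a::comm_monoid_mult"
  assumes \<kappa>: "\<kappa> \<in> parts n d"
  shows "(\<Prod>(i, j)\<in>cells (add_column n \<kappa>). G i j) = (\<Prod>i<n. G i 0) * (\<Prod>(i, j)\<in>cells \<kappa>. G i (Suc j))"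
proof -
  let ?f = "\<lambda>i. (i, 0::nat)" and ?g = "\<lambda>(i, j). (i, Suc j)"
  have "i < n" if "j < \<kappa> i" for i j
    using cells_less[OF \<kappa>, of i j] that by (simp add: cells_def)
  then have eq: "cells (add_column n \<kappa>) = ?f ` {..<n} \<union> ?g ` cells \<kappa>"
    by (auto simp: cells_def add_column_def image_iff less_Suc_eq_0_disj split: if_splits)
  have "(\<Prod>(i, j)\<in>cells (add_column n \<kappa>). G i j) =
      (\<Prod>(i, j)\<in>?f ` {..<n}. G i j) * (\<Prod>(i, j)\<in>?g ` cells \<kappa>. G i j)"
    unfolding eq using finite_cells[OF \<kappa>] by (intro prod.union_disjoint) auto
  also have "(\<Prod>(i, j)\<in>?f ` {..<n}. G i j) = (\<Prod>i<n. G i 0)"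
    by (subst prod.reindex) (auto simp: inj_on_def)
  also have "(\<Prod>(i, j)\<in>?g ` cells \<kappa>. G i j) = (\<Prod>(i, j)\<in>cells \<kappa>. G i (Suc j))"
    by (subst prod.reindex) (auto simp: inj_on_def split_beta)
  finally show ?thesis .
qed

lemma conjugate_add_column:
  assumes "\<kappa> \<in> parts n d"
  shows "conjugate (add_column n \<kappa>) 0 = n" "conjugate (add_column n \<kappa>) (Suc j) = conjugate \<kappa> j"
proof -
  have "{i. 0 < add_column n \<kappa> i} = {..<n}" by (auto simp: add_column_def)
  then show "conjugate (add_column n \<kappa>) 0 = n" by (simp add: conjugate_def)
  have "i < n" if "j < \<kappa> i" for i
    using cells_less[OF assms, of i j] that by (simp add: cells_def)
  then have "{i. Suc j < add_column n \<kappa> i} = {i. j < \<kappa> i}"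
    by (auto simp: add_column_def split: if_splits)
  then show "conjugate (add_column n \<kappa>) (Suc j) = conjugate \<kappa> j" by (simp add: conjugate_def)
qed

text \<open>Cell (i, 0) of the enlarged diagram has arm \<kappa>_i and leg n - 1 - i. Its factors 1
  - q^\<kappa>_i t^(n-i) and 1 - q^(\<kappa>_i+1) t^(n-1-i) are those of \<open>eigen_poly\<close>
  at u = -t and u = -1; the old cells keep their arms and legs.\<close>

lemma c_norm_add_column:
  assumes \<kappa>: "\<kappa> \<in> parts n d"
  shows "c_norm (add_column n \<kappa>) = eigen_poly n (- tpar) \<kappa> * c_norm \<kappa>"
    and "c_norm_conj (add_column n \<kappa>) = eigen_poly n (- 1) (add_column n \<kappa>) * c_norm_conj \<kappa>"
  unfolding c_norm_def c_norm_conj_def prod_cells_add_column[OF \<kappa>] conjugate_add_column[OF \<kappa>] eigen_poly_def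
  by (intro arg_cong2[where f = "(*)"] prod.cong refl;
      use cells_less[OF \<kappa>] in \<open>auto simp: add_column_def mult_ac\<close>)+

lemma partition_remove_column:
  assumes "is_partition lam" "num_parts lam = n"
  obtains \<kappa> where "\<kappa> \<in> parts n (psize lam - n)" "lam = add_column n \<kappa>" "n \<le> psize lam"
proof -
  have l: "lam \<in> parts n (psize lam)" using assms by (simp add: parts_def)
  have "\<forall>i<n. 1 \<le> lam i" using partition_zero_iff[OF assms(1)] assms(2) by (metis less_one not_le)
  note r = remove_column[OF l this]
  show ?thesis by (rule that[OF r(2) r(3)[symmetric] r(1)])
qed

text \<open>Induction by deleting the first column. Each step takes n to be the current number of
  parts, so n varies along the induction; this is possible because \<open>mac_coef\<close> does not
  involve n.\<close>

theorem mac_coef_c_norm: "is_partition lam \<Longrightarrow> mac_coef lam lam * c_norm lam = c_norm_conj lam"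
proof (induction "psize lam" arbitrary: lam rule: less_induct)
  case (less lam)
  define n where "n = num_parts lam"
  obtain \<kappa> where \<kappa>: "\<kappa> \<in> parts n (psize lam - n)" "lam = add_column n \<kappa>" "n \<le> psize lam"
    using partition_remove_column[OF less.prems n_def[symmetric]] .
  show ?case
  proof (cases "n = 0")
    case True
    then have z: "lam = (\<lambda>_. 0)" using \<kappa>(2) by (auto simp: add_column_def)
    have l: "lam \<in> parts 0 0" using is_partition_parts[OF less.prems] by (simp add: z psize_def)
    have p: "parts 0 0 = {lam}" using l by (auto simp: z parts_iff weak_comps_def)
    have "gram 0 lam lam = 1" unfolding gcoef_eq_gram[symmetric] gcoef_def by (simp add: lookup_1_mkey)
    then have "mac_coef lam lam = 1" using mac_coefD(4)[OF l] by (simp add: p)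
    moreover have "cells lam = {}" by (simp add: z cells_def)
    ultimately show ?thesis by (simp add: c_norm_def c_norm_conj_def)
  next
    case False
    then have "psize \<kappa> < psize lam" using \<kappa>(3) partsD(4)[OF \<kappa>(1)] by simp
    then have IH: "mac_coef \<kappa> \<kappa> * c_norm \<kappa> = c_norm_conj \<kappa>" by (rule less.hyps) (rule partsD(1)[OF \<kappa>(1)])
    have "mac_coef lam lam * c_norm lam = (eigen_poly n (- tpar) \<kappa> * mac_coef lam lam) * c_norm \<kappa>"
      unfolding \<kappa>(2) c_norm_add_column[OF \<kappa>(1)] by (simp only: mult_ac)
    also have "\<dots> = eigen_poly n (- 1) lam * (mac_coef \<kappa> \<kappa> * c_norm \<kappa>)"
      unfolding \<kappa>(2) mac_coef_add_column[OF \<kappa>(1), symmetric] by (simp only: mult_ac)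
    also have "\<dots> = c_norm_conj lam"
      unfolding IH \<kappa>(2) c_norm_add_column[OF \<kappa>(1)] ..
    finally show ?thesis .
  qed
qed

text \<open>Partitions with more than n parts do not dominate \<lambda>, so their coefficients are
  zero and the sum shrinks from \<open>parts d d\<close> to \<open>parts n d\<close>.\<close>

lemma pleth_mac_sym:
  assumes "lam \<in> parts n d"
  shows "pleth (mac_sym lam) (Xalph n) = (\<Sum>\<nu>\<in>parts n d. Const (mac_coef lam \<nu>) * (\<Prod>i<n. gsym n (\<nu> i)))"
proof -
  note lamd = parts_incl[OF assms]
  have "pleth (mac_sym lam) (Xalph n) = (\<Sum>\<nu>\<in>parts d d. Const (mac_coef lam \<nu>) * pleth (gfun d \<nu>) (Xalph n))"
    by (simp add: mac_sym_parts[OF lamd] pleth_gcomb pleth_gfun)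
  also have "\<dots> = (\<Sum>\<nu>\<in>parts n d. Const (mac_coef lam \<nu>) * pleth (gfun d \<nu>) (Xalph n))"
  proof (rule sum.mono_neutral_right[OF finite_parts])
    show "parts n d \<subseteq> parts d d" using parts_incl by blast
    show "\<forall>\<nu>\<in>parts d d - parts n d. Const (mac_coef lam \<nu>) * pleth (gfun d \<nu>) (Xalph n) = 0"
    proof
      fix \<nu> assume \<nu>: "\<nu> \<in> parts d d - parts n d"
      then have "\<not> dominated lam \<nu>" using dominated_parts[OF assms] partsD(1) by blast
      then have "mac_coef lam \<nu> = 0" using mac_coefD(1)[OF lamd] \<nu> by blast
      then show "Const (mac_coef lam \<nu>) * pleth (gfun d \<nu>) (Xalph n) = 0" by (simp add: Const_0)
    qed
  qed
  also have "\<dots> = (\<Sum>\<nu>\<in>parts n d. Const (mac_coef lam \<nu>) * (\<Prod>i<n. gsym n (\<nu> i)))"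
    by (intro sum.cong refl) (simp add: gfun_parts[symmetric] pleth_gfun)
  finally show ?thesis .
qed

theorem theorem3p1:
  fixes n :: nat and lam :: "nat \<Rightarrow> nat" and mus :: "(nat \<Rightarrow> nat) list"
  assumes "n \<ge> 1"
    and "is_partition lam" and "num_parts lam \<le> n"
    and "distinct mus" and "set mus = strictly_above lam"
  shows "macdonald_J n lam =
    Const (c_norm_conj lam / v_norm n lam) * det (det_matrix n lam mus)"
proof -
  define d where "d = psize lam"
  have lam: "lam \<in> parts n d" using assms by (simp add: parts_def d_def)
  have dist: "distinct (lam # mus)" using assms(4,5) by (simp add: strictly_above_def)
  interpret E: det_vector n d lam "ecof n lam mus"
    using ecof_bracket[OF dist, of _ n] ecof_lam[OF lam assms(4,5)] lam assms(5)
    by unfold_locales simp_all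
  have "det (det_matrix n lam mus) = (\<Sum>\<mu>\<in>E.A. Const (ecof n lam mus \<mu>) *
      (\<Sum>\<nu>\<in>parts n d. Const (dmat n (\<lambda>_. 1) \<mu> \<nu>) * (\<Prod>i<n. gsym n (\<nu> i))))"
    unfolding det_det_matrix[OF dist] using assms(5) schur_pleth_expand[OF E.A_parts]
    by (intro sum.cong) auto
  then have D: "det (det_matrix n lam mus) = (\<Sum>\<nu>\<in>parts n d. Const (E.F \<nu>) * (\<Prod>i<n. gsym n (\<nu> i)))"
    unfolding Const_comb E.F_def .
  have F: "E.F \<nu> = E.f lam * mac_coef lam \<nu>" if "\<nu> \<in> parts n d" for \<nu>
    using triangular_both[of lam n d E.F \<nu>] E.F_nonzero E.f_nonzero(1) lam that
    by (simp add: E.f_def[symmetric])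
  \<comment> \<open>The determinant is \<open>E.f lam\<close> times P_\<lambda>; the coefficient at
    g_\<lambda> expresses this unknown factor through v_\<lambda> and the leading coefficient
    computed from the hooks.\<close>
  have v: "v_norm n lam = E.f lam * mac_coef lam lam" using F[OF lam] E.F_lam by simp
  have "c_norm lam * mac_coef lam \<nu> = c_norm_conj lam / v_norm n lam * E.F \<nu>" if "\<nu> \<in> parts n d" for \<nu>
    unfolding F[OF that] mac_coef_c_norm[OF assms(2), symmetric]
    using v v_norm_nonzero[OF lam] by simp
  then show ?thesis
    unfolding macdonald_J_def macdonald_P_eq pleth_mac_sym[OF lam] D sum_distrib_left mult.assoc[symmetric]
      Const_mult[symmetric]
    by (intro sum.cong) auto
qed

end
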